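(* Let $W$ be a positive random variable that satisfies: (1) $W$ takes values in $(0,1]$ and $\sup\{x\in\mathbb R:\mathbb P(W\le x)<1\}=1$; (2) there exist $C,\rho>0$ and $x_1\in(0,1)$ such that $\mathbb P(W\le x)\le Cx^\rho$ for all $x\in[0,x_1]$. Consider the weighted recursive tree with vertex-weights $(W_i)_{i\in\mathbb N}$ that are i.i.d. copies of $W$, fix $k\in\mathbb N$, and let $(v_\ell)_{\ell\in[k]}$ be $k$ vertices selected uniformly at random without replacement from $[n]$. For a fixed $c\in(0,\theta/(\theta-1))$, there exist $\beta\ge\beta'>0$ such that, as $n\to\infty$, uniformly over non-negative integers $m_\ell<c\log n$, $\ell\in[k]$, $$\mathbb P\big(\mathcal Z_n(v_\ell)=m_\ell\text{ for all }\ell\in[k]\big)=\prod_{\ell=1}^k\mathbb E\bigg[\frac{\mathbb E[W]}{\mathbb E[W]+W}\Big(\frac{W}{\mathbb E[W]+W}\Big)^{m_\ell}\bigg]\big(1+o(n^{-\beta})\big),$$ and $$\mathbb P\big(\mathcal Z_n(v_\ell)\ge m_\ell\text{ for all }\ell\in[k]\big)=\prod_{\ell=1}^k\mathbb E\bigg[\Big(\frac{W}{\mathbb E[W]+W}\Big)^{m_\ell}\bigg]\big(1+o(n^{-\beta'})\big).$$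
   Context: Weighted recursive tree (WRT): let $(W_i)_{i\ge1}$ be i.i.d. copies of a random variable $W$ with $\mathbb P(W>0)=1$ and $S_n:=\sum_{i=1}^nW_i$. $T_1$ consists of the single vertex $1$ (the root) with vertex-weight $W_1$. For $n\ge1$, $T_{n+1}$ is obtained from $T_n$ by adding vertex $n+1$ with vertex-weight $W_{n+1}$ and, conditionally on $T_n$ (including its vertex-weights), connecting it to one vertex $i\in[n]:=\{1,\ldots,n\}$ chosen with probability $W_i/S_n$, by an edge directed from $n+1$ to $i$. $\mathcal Z_n(i)$ denotes the in-degree of vertex $i$ in $T_n$. Set $\theta:=1+\mathbb E[W]$; $\log$ is the natural logarithm. The vertices $v_\ell$ are selected independently of the tree and the weights. *)

theory Defs
  imports
    "HOL-Probability.Probability"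
    "HOL-Library.Landau_Symbols"
    "Graph_Theory.Digraph"
begin

(* par j is the vertex to which vertex j (j >= 2) attaches itself upon arrival; vertices and
   weights are numbered from 1, so par 0, par 1 and Ws 0 play no role. *)

definition wrt_digraph :: "(nat \<Rightarrow> 'a \<Rightarrow> nat) \<Rightarrow> nat \<Rightarrow> 'a \<Rightarrow> (nat, nat \<times> nat) pre_digraph"
  where "wrt_digraph par n \<omega> =
    \<lparr>verts = {1..n}, arcs = (\<lambda>j. (j, par j \<omega>)) ` {2..n}, tail = fst, head = snd\<rparr>"

(* The tree T_n together with its vertex-weights, as a random element: the weights of the
   vertices 1..n and the attachment targets of the vertices 2..n. *)

definition wrt_state ::
    "(nat \<Rightarrow> 'a \<Rightarrow> real) \<Rightarrow> (nat \<Rightarrow> 'a \<Rightarrow> nat) \<Rightarrow> nat \<Rightarrow> 'a \<Rightarrow> (nat \<Rightarrow> real) \<times> (nat \<Rightarrow> nat)"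
  where "wrt_state Ws par n \<omega> = (\<lambda>i\<in>{1..n}. Ws i \<omega>, \<lambda>j\<in>{2..n}. par j \<omega>)"

definition wrt_state_space :: "nat \<Rightarrow> ((nat \<Rightarrow> real) \<times> (nat \<Rightarrow> nat)) measure"
  where "wrt_state_space n = PiM {1..n} (\<lambda>_. borel) \<Otimes>\<^sub>M PiM {2..n} (\<lambda>_. count_space UNIV)"

(* Only the sigma-algebra generated by the state matters here. *)

definition wrt_history ::
    "'a measure \<Rightarrow> (nat \<Rightarrow> 'a \<Rightarrow> real) \<Rightarrow> (nat \<Rightarrow> 'a \<Rightarrow> nat) \<Rightarrow> nat \<Rightarrow> 'a measure"
  where "wrt_history M Ws par n = vimage_algebra (space M) (wrt_state Ws par n) (wrt_state_space n)"

(* fresh_weight makes precise that vertex n+1 brings a weight that is independent of T_n and of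
   the choice of its neighbour; attachment alone only fixes the law of that choice
   conditionally on T_n and the weights Ws 1, ..., Ws n. *)

locale weighted_recursive_tree = weight: prob_space P + prob_space M
  for P :: "'b measure" and W :: "'b \<Rightarrow> real"
    and M :: "'a measure" and Ws :: "nat \<Rightarrow> 'a \<Rightarrow> real" and par :: "nat \<Rightarrow> 'a \<Rightarrow> nat" +
  assumes weight_measurable: "W \<in> borel_measurable P"
    and weight_pos: "AE x in P. 0 < W x"
    and weights_indep: "indep_vars (\<lambda>_. borel) Ws {1..}"
    and weights_copies: "\<And>i. i \<ge> 1 \<Longrightarrow> distr M borel (Ws i) = distr P borel W"
    and par_measurable: "\<And>j. j \<ge> 2 \<Longrightarrow> par j \<in> measurable M (count_space UNIV)"
    and par_range: "\<And>n \<omega>. n \<ge> 1 \<Longrightarrow> \<omega> \<in> space M \<Longrightarrow> par (Suc n) \<omega> \<in> {1..n}"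
    and attachment: "\<And>n i. n \<ge> 1 \<Longrightarrow> i \<in> {1..n} \<Longrightarrow>
      AE \<omega> in M. real_cond_exp M (wrt_history M Ws par n)
                    (indicator {\<omega> \<in> space M. par (Suc n) \<omega> = i}) \<omega>
                 = Ws i \<omega> / (\<Sum>j=1..n. Ws j \<omega>)"
    and fresh_weight: "\<And>n. n \<ge> 1 \<Longrightarrow>
      indep_set (sets (vimage_algebra (space M) (Ws (Suc n)) borel))
        (sets (vimage_algebra (space M) (\<lambda>\<omega>. (wrt_state Ws par n \<omega>, par (Suc n) \<omega>))
          (wrt_state_space n \<Otimes>\<^sub>M count_space UNIV)))"

definition wrt_degree :: "(nat \<Rightarrow> 'a \<Rightarrow> nat) \<Rightarrow> nat \<Rightarrow> nat \<Rightarrow> 'a \<Rightarrow> nat"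
  where "wrt_degree par n i \<omega> = in_degree (wrt_digraph par n \<omega>) i"

definition uniform_without_replacement ::
    "'a measure \<Rightarrow> nat \<Rightarrow> nat \<Rightarrow> (nat \<Rightarrow> 'a \<Rightarrow> nat) \<Rightarrow> bool"
  where "uniform_without_replacement M k n v \<longleftrightarrow>
    (\<lambda>\<omega>. \<lambda>l\<in>{1..k}. v l \<omega>) \<in> measurable M (count_space UNIV) \<and>
    distr M (count_space UNIV) (\<lambda>\<omega>. \<lambda>l\<in>{1..k}. v l \<omega>)
      = measure_pmf (pmf_of_set {f \<in> {1..k} \<rightarrow>\<^sub>E {1..n}. inj_on f {1..k}})"

end

theory Submission
  imports Defs "HOL-Real_Asymp.Real_Asymp"
begin

text \<open>Given all vertex-weights, the vertex that arrives at time \<open>t + 1\<close> picks each parent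
independently of the past, so the in-degrees of distinct vertices \<open>j\<^sub>1, \<dots>, j\<^sub>k\<close> satisfy a linear
recursion in \<open>t\<close>: label \<open>l\<close> is hit with probability \<open>W\<^bsub>j\<^esub> / S\<^sub>t\<close>, where \<open>j\<close> is its vertex
(\<open>deg_law\<close>, \<open>quenched_law\<close>). The partial sums \<open>S\<^sub>t\<close> are close to \<open>\<mu> t\<close>, and at most one label is
hit at a time, a constraint that hardly matters when hitting probabilities are of order \<open>1 / t\<close>.
Hence the degrees behave like those of independent vertices whose hitting probability at time
\<open>t\<close> is exactly \<open>w / (\<mu> t)\<close>. For such a vertex, the probabilities of degree \<open>m\<close>, summed over the
birth time, obey a recursion in \<open>t\<close> that \<open>t \<mu> / (\<mu> + w) (w / (\<mu> + w))\<^sup>m\<close> solves exactly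
(\<open>geo_fixed_point\<close>); averaging over \<open>w\<close> gives the claimed product.

The limit is as small as a power of \<open>n\<close>, so every comparison must control the relative error.
From above, products of one-vertex supersolutions dominate the joint law up to a factor
\<open>exp (4 d)\<close> per hit and a factor \<open>1 + O(d / t)\<close> per step, where \<open>d\<close> is the relative fluctuation
of \<open>S\<^sub>t\<close> (\<open>deg_law_upper\<close>). From below, the law of one more label, conditionally on the others,
is that of a vertex that misses the few time steps at which the others are hit; this costs a
fraction of order \<open>(log n) / n\<^sub>0\<close>, with \<open>n\<^sub>0\<close> the earliest birth time considered
(\<open>odds_law_insert\<close>, \<open>deg_law_lower\<close>).

Both comparisons need birth times after some \<open>n\<^sub>0 = n\<^sup>\<epsilon>\<close>. An older vertex is controlled by an
exponential moment: \<open>\<Prod> (1 + (z - 1) / (\<mu> s)) / z\<^sup>m\<close> is again a supersolution. With \<open>\<theta> = 1 + \<mu>\<close>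
and \<open>z = \<theta> e\<^bsup>- s\<^esup>\<close>, its share in the total is \<open>n\<close> to the power \<open>c s - (\<theta> - z) / \<mu>\<close> when
\<open>m < c log n\<close>, up to small losses. For small \<open>s\<close> this exponent is negative exactly because
\<open>c < \<theta> / (\<theta> - 1)\<close> (\<open>choose_tilt\<close>). The other losses are made small one after the other: the
lower bound \<open>e\<^bsup>- \<xi> m\<^esup> \<theta>\<^bsup>- m\<^esup>\<close> for the limit holds for every \<open>\<xi> > 0\<close> because the weights come
arbitrarily close to \<open>1\<close> (\<open>mean_geo_lower\<close>), and the time before \<open>n\<^sub>0\<close> contributes little because
the Laplace transform of the weight vanishes at infinity (\<open>small_sum_prob\<close>). The statement about
\<open>\<ge> m\<close> uses the same upper comparison with another boundary condition at degree \<open>0\<close>, and its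
lower bound is the sum of the bounds for single degrees up to \<open>c' log n\<close> with a slightly larger
\<open>c'\<close>.\<close>

section \<open>The degrees conditionally on the weights\<close>

text \<open>Almost surely the weights lie in \<open>(0, 1]\<close>. Replacing them by values that lie there everywhere
removes null sets from all later pathwise arguments.\<close>

definition unit_clamp :: "real \<Rightarrow> real"
  where "unit_clamp x = (if 0 < x \<and> x \<le> 1 then x else 1)"

lemma unit_clamp_range: "0 < unit_clamp x" "unit_clamp x \<le> 1"
  by (auto simp: unit_clamp_def)

lemma unit_clamp_measurable [measurable]: "unit_clamp \<in> borel_measurable borel"
  unfolding unit_clamp_def by measurable

text \<open>One recursion serves two families of events: degree equal to \<open>m\<close> (\<open>e\<close> true) and degree at least
\<open>m\<close> (\<open>e\<close> false). In both, a label is at \<open>m\<close> after a step if it was at \<open>m\<close> and is not hit, or if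
it was at \<open>m - 1\<close> and is hit. For \<open>m = 0\<close> the second case is impossible in the first family,
whereas \<open>degree \<ge> 0\<close> survives every hit; this indicator is the only place where the two families
differ.\<close>

definition active :: "bool \<Rightarrow> nat \<Rightarrow> real"
  where "active e m = (if e \<or> 0 < m then 1 else 0)"

text \<open>The law at time \<open>t\<close> of the numbers of hits of the labels in \<open>L\<close>, if label \<open>l\<close> is hit at step \<open>t\<close>
with probability \<open>a t l\<close> and at most one label is hit per step.\<close>

primrec deg_law :: "bool \<Rightarrow> 'l set \<Rightarrow> (nat \<Rightarrow> 'l \<Rightarrow> real) \<Rightarrow> nat \<Rightarrow> ('l \<Rightarrow> nat) \<Rightarrow> real"
  where
    "deg_law e L a 0 m = (if \<forall>l\<in>L. m l = 0 then 1 else 0)"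
  | "deg_law e L a (Suc t) m =
      (1 - (\<Sum>l\<in>L. active e (m l) * a t l)) * deg_law e L a t m
      + (\<Sum>l\<in>L. if m l = 0 then 0 else a t l * deg_law e L a t (m(l := m l - 1)))"

text \<open>The probability that label \<open>l\<close>, placed at vertex \<open>J l\<close>, gains an edge when vertex \<open>t + 1\<close>
arrives, given the weights \<open>w\<close>; it vanishes before the vertex is born.\<close>

definition hazard :: "(nat \<Rightarrow> real) \<Rightarrow> ('l \<Rightarrow> nat) \<Rightarrow> nat \<Rightarrow> 'l \<Rightarrow> real"
  where "hazard w J t l = (if J l \<le> t then w (J l) / (\<Sum>i=1..t. w i) else 0)"

definition attains :: "bool \<Rightarrow> nat \<Rightarrow> nat \<Rightarrow> bool"
  where "attains e z m \<longleftrightarrow> (if e then z = m else m \<le> z)"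

lemma hazard_nonneg:
  assumes "\<And>i. 1 \<le> i \<Longrightarrow> 0 \<le> w i" "1 \<le> J l"
  shows "0 \<le> hazard w J t l"
  using assms by (auto simp: hazard_def intro!: divide_nonneg_nonneg sum_nonneg)

lemma hazard_sum_le_1:
  assumes w: "\<And>i. 1 \<le> i \<Longrightarrow> 0 \<le> w i"
    and "finite L" "inj_on J L" "J ` L \<subseteq> {1..}"
  shows "(\<Sum>l\<in>L. hazard w J t l) \<le> 1"
proof -
  define S where "S = (\<Sum>i=1..t. w i)"
  have S: "0 \<le> S" unfolding S_def by (intro sum_nonneg) (use w in auto)
  have "(\<Sum>l\<in>L. hazard w J t l) = (\<Sum>l\<in>{l\<in>L. J l \<le> t}. w (J l)) / S"
    unfolding hazard_def S_def sum_divide_distrib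
    by (rule sum.mono_neutral_cong_right) (use assms in auto)
  also have "(\<Sum>l\<in>{l\<in>L. J l \<le> t}. w (J l)) = (\<Sum>i\<in>J ` {l\<in>L. J l \<le> t}. w i)"
    by (subst sum.reindex) (use assms in \<open>auto intro: inj_on_subset\<close>)
  also have "\<dots> / S \<le> 1"
  proof -
    have "(\<Sum>i\<in>J ` {l\<in>L. J l \<le> t}. w i) \<le> S"
      unfolding S_def by (rule sum_mono2) (use assms in auto)
    then show ?thesis using S by (cases "S = 0") (auto simp: divide_le_eq)
  qed
  finally show ?thesis by simp
qed

lemma deg_law_bounds:
  assumes "finite L" and a: "\<And>t l. l \<in> L \<Longrightarrow> 0 \<le> a t l" and a1: "\<And>t. (\<Sum>l\<in>L. a t l) \<le> 1"
  shows "0 \<le> deg_law e L a t m" "deg_law e L a t m \<le> 1"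
proof -
  have "0 \<le> deg_law e L a t m \<and> deg_law e L a t m \<le> 1"
  proof (induction t arbitrary: m)
    case 0
    then show ?case by simp
  next
    case (Suc t)
    let ?s = "\<Sum>l\<in>L. active e (m l) * a t l"
    let ?r = "\<Sum>l\<in>L. if m l = 0 then 0 else a t l * deg_law e L a t (m(l := m l - 1))"
    have "?s \<le> (\<Sum>l\<in>L. a t l)"
      by (rule sum_mono) (auto simp: active_def a)
    then have s: "?s \<le> 1" using a1[of t] by simp
    have r0: "0 \<le> ?r"
      by (rule sum_nonneg) (use Suc a in auto)
    have "?r \<le> ?s"
      by (rule sum_mono) (use Suc a in \<open>auto simp: active_def mult_left_le\<close>)
    moreover have "(1 - ?s) * deg_law e L a t m \<le> 1 - ?s"
      using s Suc[of m] by (intro mult_left_le) auto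
    moreover have "0 \<le> (1 - ?s) * deg_law e L a t m"
      using s Suc[of m] by (intro mult_nonneg_nonneg) auto
    ultimately show ?case using r0 by simp
  qed
  then show "0 \<le> deg_law e L a t m" "deg_law e L a t m \<le> 1" by auto
qed

locale bounded_wrt = weighted_recursive_tree P W M Ws par
  for P :: "'b measure" and W :: "'b \<Rightarrow> real"
    and M :: "'a measure" and Ws :: "nat \<Rightarrow> 'a \<Rightarrow> real" and par :: "nat \<Rightarrow> 'a \<Rightarrow> nat" +
  assumes weight_range: "AE x in P. 0 < W x \<and> W x \<le> 1"
begin

definition wt :: "nat \<Rightarrow> 'a \<Rightarrow> real"
  where "wt i \<omega> = unit_clamp (Ws i \<omega>)"

lemma Ws_measurable: "i \<ge> 1 \<Longrightarrow> Ws i \<in> borel_measurable M"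
  using weights_indep by (auto simp: indep_vars_def)

lemma wt_measurable: "i \<ge> 1 \<Longrightarrow> wt i \<in> borel_measurable M"
  unfolding wt_def by (intro measurable_compose[OF Ws_measurable unit_clamp_measurable])

lemma wt_eq_Ws: assumes "i \<ge> 1" shows "AE \<omega> in M. wt i \<omega> = Ws i \<omega>"
proof -
  have "AE x in distr P borel W. 0 < x \<and> x \<le> 1"
    using weight_range by (subst AE_distr_iff) (auto simp: weight_measurable)
  then have "AE x in distr M borel (Ws i). 0 < x \<and> x \<le> 1"
    by (subst weights_copies[OF assms])
  then have "AE \<omega> in M. 0 < Ws i \<omega> \<and> Ws i \<omega> \<le> 1"
    by (subst (asm) AE_distr_iff) (auto simp: Ws_measurable[OF assms])
  then show ?thesis by eventually_elim (auto simp: wt_def unit_clamp_def)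
qed

lemma wt_indep: "indep_vars (\<lambda>_. borel) wt {1..}"
  unfolding wt_def[abs_def]
  by (rule indep_vars_compose2[OF weights_indep]) auto

lemma wt_integral:
  fixes f :: "real \<Rightarrow> real"
  assumes "i \<ge> 1" and [measurable]: "f \<in> borel_measurable borel"
  shows "(\<integral>\<omega>. f (wt i \<omega>) \<partial>M) = (\<integral>x. f (W x) \<partial>P)"
proof -
  have [measurable]: "Ws i \<in> borel_measurable M" "W \<in> borel_measurable P"
    using Ws_measurable assms weight_measurable by auto
  have fc: "(\<lambda>x. f (unit_clamp x)) \<in> borel_measurable borel" by measurable
  have "(\<integral>\<omega>. f (wt i \<omega>) \<partial>M) = (\<integral>x. f (unit_clamp x) \<partial>distr M borel (Ws i))"
    by (simp add: integral_distr[OF _ fc] wt_def Ws_measurable[OF assms(1)])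
  also have "\<dots> = (\<integral>x. f (unit_clamp (W x)) \<partial>P)"
    by (simp add: weights_copies[OF assms(1)] integral_distr[OF weight_measurable fc])
  also have "\<dots> = (\<integral>x. f (W x) \<partial>P)"
  proof (rule integral_cong_AE)
    show "AE x in P. f (unit_clamp (W x)) = f (W x)"
      using weight_range by eventually_elim (simp add: unit_clamp_def)
  qed measurable
  finally show ?thesis .
qed

lemma wt_prod_integral:
  fixes f :: "'l \<Rightarrow> real \<Rightarrow> real"
  assumes "finite L" "inj_on J L" "J ` L \<subseteq> {1..}"
    and [measurable]: "\<And>l. l \<in> L \<Longrightarrow> f l \<in> borel_measurable borel"
    and bd: "\<And>l x. l \<in> L \<Longrightarrow> 0 < x \<Longrightarrow> x \<le> 1 \<Longrightarrow> \<bar>f l x\<bar> \<le> C"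
  shows "(\<integral>\<omega>. (\<Prod>l\<in>L. f l (wt (J l) \<omega>)) \<partial>M) = (\<Prod>l\<in>L. \<integral>x. f l (W x) \<partial>P)"
proof -
  have J: "J l \<ge> 1" if "l \<in> L" for l using assms(3) that by auto
  define h where "h i = f (the_inv_into L J i)" for i
  have h: "h (J l) = f l" if "l \<in> L" for l
    unfolding h_def using the_inv_into_f_f[OF assms(2) that] by simp
  have h_meas: "h i \<in> borel_measurable borel" if "i \<in> J ` L" for i
    using that h by auto
  have 1: "indep_vars (\<lambda>_. borel) wt (J ` L)"
    by (rule indep_vars_subset[OF wt_indep assms(3)])
  have 3: "indep_vars (\<lambda>_. borel) (\<lambda>i \<omega>. h i (wt i \<omega>)) (J ` L)"
    by (rule indep_vars_compose2[OF 1]) (use h_meas in auto)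
  have 4: "integrable M (\<lambda>\<omega>. h i (wt i \<omega>))" if "i \<in> J ` L" for i
  proof (rule integrable_const_bound[where B = C])
    show "AE \<omega> in M. norm (h i (wt i \<omega>)) \<le> C"
      using bd that h by (auto simp: wt_def unit_clamp_range)
    show "(\<lambda>\<omega>. h i (wt i \<omega>)) \<in> borel_measurable M"
      using that J by (intro measurable_compose[OF wt_measurable h_meas]) auto
  qed
  have "(\<integral>\<omega>. (\<Prod>i\<in>J ` L. h i (wt i \<omega>)) \<partial>M) = (\<Prod>i\<in>J ` L. \<integral>x. h i (W x) \<partial>P)"
    by (subst indep_vars_lebesgue_integral[OF _ 3 4])
      (use assms(1) J h_meas in \<open>auto intro!: prod.cong wt_integral\<close>)
  then show ?thesis
    by (simp add: prod.reindex[OF assms(2)] h cong: prod.cong)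
qed

abbreviation history :: "nat \<Rightarrow> 'a measure"
  where "history \<equiv> wrt_history M Ws par"

text \<open>The information in the tree \<open>T\<^sub>t\<close> together with the choice made by vertex \<open>t + 1\<close>: everything of
which the weight of vertex \<open>t + 1\<close> is independent.\<close>

definition choice_history :: "nat \<Rightarrow> 'a measure"
  where "choice_history t = vimage_algebra (space M)
    (\<lambda>\<omega>. (wrt_state Ws par t \<omega>, par (Suc t) \<omega>)) (wrt_state_space t \<Otimes>\<^sub>M count_space UNIV)"

lemma space_history [simp]: "space (history t) = space M" "space (choice_history t) = space M"
  by (simp_all add: wrt_history_def choice_history_def)

lemma state_space: "wrt_state Ws par t \<omega> \<in> space (wrt_state_space t)"
  by (auto simp: wrt_state_def wrt_state_space_def space_pair_measure space_PiM)

lemma state_measurable_iff: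
  assumes "space K = space M"
    and "\<And>i. i \<in> {1..t} \<Longrightarrow> Ws i \<in> borel_measurable K"
    and "\<And>j. j \<in> {2..t} \<Longrightarrow> par j \<in> measurable K (count_space UNIV)"
  shows "wrt_state Ws par t \<in> measurable K (wrt_state_space t)"
  unfolding wrt_state_def[abs_def] wrt_state_space_def
  by (intro measurable_Pair measurable_restrict assms)

lemma history_state: "wrt_state Ws par t \<in> measurable (history t) (wrt_state_space t)"
  unfolding wrt_history_def by (rule measurable_vimage_algebra1) (auto simp: state_space)

lemma choice_history_state:
  "(\<lambda>\<omega>. (wrt_state Ws par t \<omega>, par (Suc t) \<omega>)) \<in>
     measurable (choice_history t) (wrt_state_space t \<Otimes>\<^sub>M count_space UNIV)"
  unfolding choice_history_def
  by (rule measurable_vimage_algebra1) (auto simp: state_space space_pair_measure)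

lemma history_Ws: assumes "i \<in> {1..t}" shows "Ws i \<in> borel_measurable (history t)"
proof -
  have "(\<lambda>\<omega>. fst (wrt_state Ws par t \<omega>) i) \<in> borel_measurable (history t)"
    using measurable_compose[OF history_state[unfolded wrt_state_space_def] measurable_fst]
    by (rule measurable_compose) (use assms in simp)
  then show ?thesis using assms by (simp add: wrt_state_def)
qed

lemma history_par: assumes "j \<in> {2..t}" shows "par j \<in> measurable (history t) (count_space UNIV)"
proof -
  have "(\<lambda>\<omega>. snd (wrt_state Ws par t \<omega>) j) \<in> measurable (history t) (count_space UNIV)"
    using measurable_compose[OF history_state[unfolded wrt_state_space_def] measurable_snd]
    by (rule measurable_compose) (use assms in simp)
  then show ?thesis using assms by (simp add: wrt_state_def)
qed

lemma vimage_algebra_le: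
  assumes "f \<in> measurable K N" "space K = X"
  shows "sets (vimage_algebra X f N) \<subseteq> sets K"
  using assms measurable_sets[OF assms(1)] measurable_space[OF assms(1)]
  by (subst sets_vimage_algebra2) auto

lemma history_mono: assumes "s \<le> t" shows "sets (history s) \<subseteq> sets (history t)"
  unfolding wrt_history_def[of M Ws par s]
  by (rule vimage_algebra_le[OF state_measurable_iff])
     (use assms in \<open>simp_all add: history_Ws history_par\<close>)

lemma history_le_choice: "sets (history t) \<subseteq> sets (choice_history t)"
  unfolding wrt_history_def
  by (rule vimage_algebra_le)
     (use measurable_compose[OF choice_history_state measurable_fst] in auto)

lemma choice_par: "par (Suc t) \<in> measurable (choice_history t) (count_space UNIV)"
  using measurable_compose[OF choice_history_state measurable_snd] by simp

lemma choice_le_history: assumes "t \<ge> 1" shows "sets (choice_history t) \<subseteq> sets (history (Suc t))"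
  unfolding choice_history_def
proof (rule vimage_algebra_le)
  have "wrt_state Ws par t \<in> measurable (history (Suc t)) (wrt_state_space t)"
    by (rule state_measurable_iff) (simp_all add: history_Ws history_par)
  moreover have "par (Suc t) \<in> measurable (history (Suc t)) (count_space UNIV)"
    using assms by (intro history_par) simp
  ultimately show "(\<lambda>\<omega>. (wrt_state Ws par t \<omega>, par (Suc t) \<omega>)) \<in>
      measurable (history (Suc t)) (wrt_state_space t \<Otimes>\<^sub>M count_space UNIV)"
    by (rule measurable_Pair)
qed simp

lemma history_subalgebra: "subalgebra M (history t)"
proof -
  have "wrt_state Ws par t \<in> measurable M (wrt_state_space t)"
    by (rule state_measurable_iff) (simp_all add: Ws_measurable par_measurable)
  from vimage_algebra_le[OF this refl] show ?thesis
    by (simp add: subalgebra_def wrt_history_def)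
qed

lemma choice_sets: assumes "t \<ge> 1" "G \<in> sets (choice_history t)" shows "G \<in> sets M"
  using choice_le_history[OF assms(1)] assms(2) history_subalgebra[of "Suc t"]
  by (auto simp: subalgebra_def)

definition later_weights :: "nat \<Rightarrow> nat \<Rightarrow> (nat \<Rightarrow> real set) \<Rightarrow> 'a set"
  where "later_weights t N B = {\<omega> \<in> space M. \<forall>s\<in>{t<..N}. Ws s \<omega> \<in> B s}"

lemma later_weights_sets:
  assumes "\<And>s. B s \<in> sets borel" "t \<le> N"
  shows "later_weights t N B \<in> sets (history N)"
proof -
  have "{\<omega> \<in> space (history N). \<forall>s\<in>{t<..N}. Ws s \<omega> \<in> B s} \<in> sets (history N)"
  proof (rule sets.sets_Collect_finite_All)
    fix s assume "s \<in> {t<..N}"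
    then have "Ws s -` B s \<inter> space (history N) \<in> sets (history N)"
      by (intro measurable_sets[OF history_Ws] assms) auto
    then show "{\<omega> \<in> space (history N). Ws s \<omega> \<in> B s} \<in> sets (history N)"
      by (simp add: vimage_def Int_def conj_commute)
  qed auto
  then show ?thesis by (simp add: later_weights_def)
qed

text \<open>Independence of a single fresh weight propagates to all later weights, because the tree and the
choice up to time \<open>N\<close> contain the weights up to \<open>N\<close>.\<close>

lemma later_weights_indep:
  assumes "t \<ge> 1" "t \<le> N" and G: "G \<in> sets (choice_history t)" and B: "\<And>s. B s \<in> sets borel"
  shows "prob (G \<inter> later_weights t N B) = prob G * prob (later_weights t N B)"
proof -
  define q where "q s = prob (Ws s -` B s \<inter> space M)" for s
  have *: "prob (G \<inter> later_weights t N B) = prob G * (\<Prod>s\<in>{t<..N}. q s)"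
    if G: "G \<in> sets (choice_history t)" for G
    using \<open>t \<le> N\<close>
  proof (induction N rule: dec_induct)
    case base
    have "G \<subseteq> space M" using sets.sets_into_space[OF G] by simp
    then show ?case by (simp add: later_weights_def Int_absorb2)
  next
    case (step N)
    have "G \<inter> later_weights t N B \<in> sets (choice_history N)"
    proof (cases "N = t")
      case True
      have "G \<subseteq> space M" using sets.sets_into_space[OF G] by simp
      with True G show ?thesis by (simp add: later_weights_def Int_absorb2)
    next
      case False
      with step have "Suc t \<le> N" by simp
      then have "G \<in> sets (history N)"
        using subsetD[OF history_mono subsetD[OF choice_le_history[OF \<open>t \<ge> 1\<close>] G]] by simp
      moreover have "later_weights t N B \<in> sets (history N)"
        using step by (intro later_weights_sets B) simp
      ultimately show ?thesis
        by (intro subsetD[OF history_le_choice] sets.Int)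
    qed
    moreover have "Ws (Suc N) -` B (Suc N) \<inter> space M
        \<in> sets (vimage_algebra (space M) (Ws (Suc N)) borel)"
      by (intro in_vimage_algebra B)
    moreover have "1 \<le> N" using step assms by simp
    ultimately have "prob ((Ws (Suc N) -` B (Suc N) \<inter> space M) \<inter> (G \<inter> later_weights t N B))
        = q (Suc N) * prob (G \<inter> later_weights t N B)"
      unfolding q_def choice_history_def by (intro indep_setD[OF fresh_weight])
    moreover have "(Ws (Suc N) -` B (Suc N) \<inter> space M) \<inter> (G \<inter> later_weights t N B)
        = G \<inter> later_weights t (Suc N) B"
      using step by (auto simp: later_weights_def le_Suc_eq)
    moreover have "{t<..Suc N} = insert (Suc N) {t<..N}" using step by auto
    ultimately show ?case using step.IH by simp
  qed
  have "space M \<in> sets (choice_history t)"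
    using sets.top[of "choice_history t"] by simp
  from *[OF this] *[OF G] show ?thesis
    by (simp add: later_weights_def Int_def prob_space)
qed

text \<open>The tree \<open>T\<^sub>t\<close> and the weights of all vertices, present and future. The generator is chosen to be
closed under intersection, so that measures can be compared on it.\<close>

definition info :: "nat \<Rightarrow> 'a measure"
  where "info t = sigma (space M)
    {G \<inter> later_weights t N B | G N B. G \<in> sets (history t) \<and> t \<le> N \<and> (\<forall>s. B s \<in> sets borel)}"

lemma info_generator:
  "{G \<inter> later_weights t N B | G N B. G \<in> sets (history t) \<and> t \<le> N \<and> (\<forall>s. B s \<in> sets borel)}
    \<subseteq> Pow (space M)"
  by (auto simp: later_weights_def)

lemma space_info [simp]: "space (info t) = space M"
  unfolding info_def by (rule space_measure_of[OF info_generator])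

lemma sets_info: "sets (info t) = sigma_sets (space M)
    {G \<inter> later_weights t N B | G N B. G \<in> sets (history t) \<and> t \<le> N \<and> (\<forall>s. B s \<in> sets borel)}"
  unfolding info_def by (rule sets_measure_of[OF info_generator])

lemma info_subalgebra: "subalgebra M (info t)"
proof -
  have "sets (info t) \<subseteq> sets M" unfolding sets_info
  proof (rule sets.sigma_sets_subset, safe)
    fix G N and B :: "nat \<Rightarrow> real set"
    assume "G \<in> sets (history t)" "t \<le> N" "\<forall>s. B s \<in> sets borel"
    then show "G \<inter> later_weights t N B \<in> sets M"
      using history_subalgebra[of t] history_subalgebra[of N] later_weights_sets[of B t N]
      by (auto simp: subalgebra_def)
  qed
  then show ?thesis by (simp add: subalgebra_def)
qed

lemma history_le_info: "sets (history t) \<subseteq> sets (info t)"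
proof
  fix G assume G: "G \<in> sets (history t)"
  then have "G \<subseteq> space M" using sets.sets_into_space[OF G] by simp
  then have "G = G \<inter> later_weights t t (\<lambda>_. UNIV)" by (auto simp: later_weights_def)
  moreover have "\<forall>s::nat. (UNIV :: real set) \<in> sets borel" by simp
  ultimately show "G \<in> sets (info t)"
    unfolding sets_info using G by (intro sigma_sets.Basic) blast
qed

lemma info_Ws: assumes "1 \<le> i" shows "Ws i \<in> borel_measurable (info t)"
proof (cases "i \<le> t")
  case True
  have "Ws i \<in> borel_measurable (history t)" using True assms by (intro history_Ws) simp
  then show ?thesis
    using history_le_info[of t] by (auto simp: measurable_def)
next
  case False
  show ?thesis
  proof (rule measurableI)
    fix B :: "real set" assume B: "B \<in> sets borel"
    have "Ws i -` B \<inter> space (info t)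
        = space M \<inter> later_weights t i (\<lambda>s. if s = i then B else UNIV)"
      using False by (auto simp: later_weights_def)
    also have "\<dots> \<in> sets (info t)"
    proof -
      have "space M \<in> sets (history t)" using sets.top[of "history t"] by simp
      then show ?thesis
        unfolding sets_info using False B by (intro sigma_sets.Basic) force
    qed
    finally show "Ws i -` B \<inter> space (info t) \<in> sets (info t)" .
  qed simp
qed

lemma info_wt: "1 \<le> i \<Longrightarrow> wt i \<in> borel_measurable (info t)"
  unfolding wt_def by (rule measurable_compose[OF info_Ws unit_clamp_measurable])

lemma info_Int_stable: "Int_stable
  {G \<inter> later_weights t N B | G N B. G \<in> sets (history t) \<and> t \<le> N \<and> (\<forall>s. B s \<in> sets borel)}"
proof (rule Int_stableI, safe)
  fix G1 G2 N1 N2 and B1 B2 :: "nat \<Rightarrow> real set"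
  assume *: "G1 \<in> sets (history t)" "G2 \<in> sets (history t)" "t \<le> N1" "t \<le> N2"
    "\<forall>s. B1 s \<in> sets borel" "\<forall>s. B2 s \<in> sets borel"
  define B where "B s = (if s \<le> N1 then B1 s else UNIV) \<inter> (if s \<le> N2 then B2 s else UNIV)" for s
  have "(G1 \<inter> later_weights t N1 B1) \<inter> (G2 \<inter> later_weights t N2 B2)
      = (G1 \<inter> G2) \<inter> later_weights t (max N1 N2) B"
  proof -
    have "(\<forall>s\<in>{t<..max N1 N2}. Ws s \<omega> \<in> B s)
        \<longleftrightarrow> (\<forall>s\<in>{t<..N1}. Ws s \<omega> \<in> B1 s) \<and> (\<forall>s\<in>{t<..N2}. Ws s \<omega> \<in> B2 s)" for \<omega>
    proof (intro iffI conjI ballI)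
      fix s assume h: "\<forall>s\<in>{t<..max N1 N2}. Ws s \<omega> \<in> B s"
      show "Ws s \<omega> \<in> B1 s" if "s \<in> {t<..N1}"
        using that bspec[OF h, of s] by (auto simp: B_def)
      show "Ws s \<omega> \<in> B2 s" if "s \<in> {t<..N2}"
        using that bspec[OF h, of s] by (auto simp: B_def)
    qed (auto simp: B_def)
    then show ?thesis by (auto simp: later_weights_def)
  qed
  moreover have "G1 \<inter> G2 \<in> sets (history t)" "t \<le> max N1 N2" "\<forall>s. B s \<in> sets borel"
    using * by (auto simp: B_def)
  ultimately show "\<exists>G N B. (G1 \<inter> later_weights t N1 B1) \<inter> (G2 \<inter> later_weights t N2 B2)
      = G \<inter> later_weights t N B \<and> G \<in> sets (history t) \<and> t \<le> N \<and> (\<forall>s. B s \<in> sets borel)"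
    by blast
qed

lemma wt_pos: "0 < wt i \<omega>" "wt i \<omega> \<le> 1" "0 \<le> wt i \<omega>"
  using unit_clamp_range[of "Ws i \<omega>"] by (auto simp: wt_def)

definition share :: "nat \<Rightarrow> nat \<Rightarrow> 'a \<Rightarrow> real"
  where "share t i \<omega> = wt i \<omega> / (\<Sum>j=1..t. wt j \<omega>)"

lemma share_bounds: assumes "i \<in> {1..t}" shows "0 \<le> share t i \<omega>" "share t i \<omega> \<le> 1"
proof -
  have "wt i \<omega> \<le> (\<Sum>j=1..t. wt j \<omega>)"
    by (rule member_le_sum) (use assms wt_pos in auto)
  then show "0 \<le> share t i \<omega>" "share t i \<omega> \<le> 1"
    using wt_pos(1)[of i \<omega>] by (auto simp: share_def divide_le_eq)
qed

lemma share_info: "i \<in> {1..t} \<Longrightarrow> share t i \<in> borel_measurable (info s)"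
  unfolding share_def by (intro borel_measurable_divide borel_measurable_sum info_wt) auto

lemma share_history: "i \<in> {1..t} \<Longrightarrow> share t i \<in> borel_measurable (history t)"
  unfolding share_def wt_def
  by (intro borel_measurable_divide borel_measurable_sum
      measurable_compose[OF history_Ws unit_clamp_measurable]) auto

lemma share_eq: assumes "i \<in> {1..t}"
  shows "AE \<omega> in M. share t i \<omega> = Ws i \<omega> / (\<Sum>j=1..t. Ws j \<omega>)"
proof -
  have "AE \<omega> in M. \<forall>j\<in>{1..t}. wt j \<omega> = Ws j \<omega>"
    by (subst AE_ball_countable) (auto intro: wt_eq_Ws)
  then show ?thesis
    by eventually_elim (use assms in \<open>simp add: share_def\<close>)
qed

lemma bounded_integrable:
  fixes f :: "'a \<Rightarrow> real"
  assumes "f \<in> borel_measurable M" "\<And>\<omega>. \<bar>f \<omega>\<bar> \<le> C"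
  shows "integrable M f"
  by (rule integrable_const_bound[where B = C]) (use assms in auto)

abbreviation choice :: "nat \<Rightarrow> nat \<Rightarrow> 'a set"
  where "choice t i \<equiv> {\<omega> \<in> space M. par (Suc t) \<omega> = i}"

lemma choice_in: "choice t i \<in> sets (choice_history t)"
  using measurable_sets[OF choice_par, of "{i}" t] by (simp add: vimage_def Int_def conj_commute)

text \<open>Knowing the future weights as well does not change the attachment probabilities, because the
choice and the tree are jointly independent of them. It suffices to check this on the generator
of \<open>info t\<close>, where the later weights factor out.\<close>

lemma choice_cond_exp:
  assumes "1 \<le> t" "i \<in> {1..t}"
  shows "AE \<omega> in M. real_cond_exp M (info t) (indicator (choice t i)) \<omega> = share t i \<omega>"
proof -
  interpret h: finite_measure_subalgebra M "history t"
    by unfold_locales (rule history_subalgebra)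
  interpret inf: finite_measure_subalgebra M "info t"
    by unfold_locales (rule info_subalgebra)
  let ?C = "choice t i"
  have C: "?C \<in> sets M" using choice_sets[OF assms(1) choice_in] .
  have share_M: "share t i \<in> borel_measurable M"
    using measurable_from_subalg[OF info_subalgebra share_info[OF assms(2)]] .
  have hist_M: "G \<in> sets M" if "G \<in> sets (history t)" for G
    using that history_subalgebra by (auto simp: subalgebra_def)
  have share_int: "integrable M (\<lambda>\<omega>. indicator A \<omega> * share t i \<omega>)" if "A \<in> sets M" for A
    using that share_M share_bounds[OF assms(2)]
    by (intro bounded_integrable[where C = 1]) (auto simp: indicator_def)
  have cond: "AE \<omega> in M. real_cond_exp M (history t) (indicator ?C) \<omega> = share t i \<omega>"
    using attachment[OF assms] share_eq[OF assms(2)] by eventually_elim simp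
  have basic: "prob (?C \<inter> (G \<inter> L)) = (\<integral>\<omega>. indicator (G \<inter> L) \<omega> * share t i \<omega> \<partial>M)"
    if G: "G \<in> sets (history t)" and "t \<le> N" and B: "\<And>s. B s \<in> sets borel"
      and L: "L = later_weights t N B" for G N B L
  proof -
    have LM: "L \<in> sets M"
      using later_weights_sets[OF B \<open>t \<le> N\<close>] history_subalgebra[of N] L
      by (auto simp: subalgebra_def)
    have indep: "prob (A \<inter> L) = prob A * prob L" if "A \<in> sets (choice_history t)" for A
      unfolding L by (rule later_weights_indep) (use assms that B \<open>t \<le> N\<close> in auto)
    \<comment> \<open>Independence, stated as a constant conditional expectation, can be multiplied with \<open>share t
        i\<close>.\<close>
    have L_cond: "AE \<omega> in M. real_cond_exp M (history t) (indicator L) \<omega> = prob L"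
    proof (rule h.real_cond_exp_charact)
      fix A assume A: "A \<in> sets (history t)"
      have "(\<integral>\<omega>\<in>A. indicator L \<omega> \<partial>M) = prob (A \<inter> L)"
        using hist_M[OF A] LM
        by (simp add: set_lebesgue_integral_def indicator_inter_arith[symmetric])
      also have "\<dots> = prob A * prob L"
        using indep subsetD[OF history_le_choice A] by simp
      also have "\<dots> = (\<integral>\<omega>\<in>A. prob L \<partial>M)"
        using hist_M[OF A] by (simp add: set_lebesgue_integral_def)
      finally show "(\<integral>\<omega>\<in>A. indicator L \<omega> \<partial>M) = (\<integral>\<omega>\<in>A. prob L \<partial>M)" .
    qed (use LM in \<open>auto intro!: bounded_integrable[where C = 1] simp: indicator_def\<close>)
    have "prob (?C \<inter> (G \<inter> L)) = prob (?C \<inter> G) * prob L"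
      using indep[of "?C \<inter> G"] choice_in subsetD[OF history_le_choice G] by (simp add: Int_assoc)
    also have "prob (?C \<inter> G) = (\<integral>\<omega>. indicator G \<omega> * indicator ?C \<omega> \<partial>M)"
      using C hist_M[OF G] by (simp add: indicator_inter_arith[symmetric] Int_commute)
    also have "\<dots> = (\<integral>\<omega>. indicator G \<omega> * real_cond_exp M (history t) (indicator ?C) \<omega> \<partial>M)"
      using C hist_M[OF G] G
      by (intro h.real_cond_exp_intg(2)[symmetric])
         (auto intro!: bounded_integrable[where C = 1] simp: indicator_def)
    also have "\<dots> = (\<integral>\<omega>. indicator G \<omega> * share t i \<omega> \<partial>M)"
      using cond hist_M[OF G] share_M by (intro integral_cong_AE) auto
    also have "\<dots> * prob L = (\<integral>\<omega>. (indicator G \<omega> * share t i \<omega>) * prob L \<partial>M)" by simp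
    also have "\<dots> = (\<integral>\<omega>. (indicator G \<omega> * share t i \<omega>)
        * real_cond_exp M (history t) (indicator L) \<omega> \<partial>M)"
      using L_cond hist_M[OF G] share_M by (intro integral_cong_AE) auto
    also have "\<dots> = (\<integral>\<omega>. (indicator G \<omega> * share t i \<omega>) * indicator L \<omega> \<partial>M)"
    proof (rule h.real_cond_exp_intg(2))
      show "integrable M (\<lambda>\<omega>. indicator G \<omega> * share t i \<omega> * indicator L \<omega>)"
        using share_int[of "G \<inter> L"] hist_M[OF G] LM
        by (auto simp: indicator_inter_arith mult_ac)
      show "(\<lambda>\<omega>. indicator G \<omega> * share t i \<omega>) \<in> borel_measurable (history t)"
        using G share_history[OF assms(2)] by measurable
    qed (use LM in auto)
    finally show ?thesis by (simp add: indicator_inter_arith mult_ac)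
  qed
  let ?N1 = "restr_to_subalg (density M (indicator ?C)) (info t)"
  let ?N2 = "restr_to_subalg (density M (\<lambda>\<omega>. ennreal (share t i \<omega>))) (info t)"
  have sub: "subalgebra (density M f) (info t)" for f
    using info_subalgebra by (simp add: subalgebra_def)
  have info_M: "A \<in> sets M" if "A \<in> sets (info t)" for A
    using that info_subalgebra by (auto simp: subalgebra_def)
  have e1: "emeasure ?N1 A = ennreal (prob (?C \<inter> A))" if "A \<in> sets (info t)" for A
  proof -
    have "emeasure ?N1 A = (\<integral>\<^sup>+\<omega>. indicator (?C \<inter> A) \<omega> \<partial>M)"
      using C info_M[OF that]
      by (simp add: emeasure_restr_to_subalg[OF sub that] emeasure_density indicator_inter_arith)
    then show ?thesis using C info_M[OF that] by (simp add: emeasure_eq_measure)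
  qed
  have e2: "emeasure ?N2 A = ennreal (\<integral>\<omega>. indicator A \<omega> * share t i \<omega> \<partial>M)"
    if "A \<in> sets (info t)" for A
  proof -
    have "emeasure ?N2 A = (\<integral>\<^sup>+\<omega>. ennreal (indicator A \<omega> * share t i \<omega>) \<partial>M)"
      using info_M[OF that] share_M
      by (simp add: emeasure_restr_to_subalg[OF sub that] emeasure_density)
         (auto intro!: nn_integral_cong simp: indicator_def)
    also have "\<dots> = ennreal (\<integral>\<omega>. indicator A \<omega> * share t i \<omega> \<partial>M)"
      using share_bounds[OF assms(2)]
      by (intro nn_integral_eq_integral share_int info_M[OF that]) (auto simp: indicator_def)
    finally show ?thesis .
  qed
  have "?N1 = ?N2"
  proof (rule measure_eqI_generator_eq[OF info_Int_stable info_generator])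
    fix X assume X: "X \<in> {G \<inter> later_weights t N B | G N B.
        G \<in> sets (history t) \<and> t \<le> N \<and> (\<forall>s. B s \<in> sets borel)}"
    then have XI: "X \<in> sets (info t)" unfolding sets_info by (rule sigma_sets.Basic)
    from X obtain G N B where "X = G \<inter> later_weights t N B" "G \<in> sets (history t)" "t \<le> N"
      "\<And>s. B s \<in> sets borel" by blast
    then show "emeasure ?N1 X = emeasure ?N2 X"
      unfolding e1[OF XI] e2[OF XI] using basic by simp
  next
    show "range (\<lambda>_::nat. space M \<inter> later_weights t t (\<lambda>_. UNIV)) \<subseteq>
       {G \<inter> later_weights t N B | G N B.
        G \<in> sets (history t) \<and> t \<le> N \<and> (\<forall>s. B s \<in> sets borel)}"
      using sets.top[of "history t"] by force
    show "(\<Union>i::nat. space M \<inter> later_weights t t (\<lambda>_. UNIV)) = space M"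
      by (auto simp: later_weights_def)
    have "space M \<inter> later_weights t t (\<lambda>_. UNIV) = space (info t)"
      by (auto simp: later_weights_def)
    then show "emeasure ?N1 (space M \<inter> later_weights t t (\<lambda>_. UNIV)) \<noteq> \<infinity>"
      by (simp only: e1[OF sets.top]) simp
  qed (simp_all add: sets_restr_to_subalg[OF sub] sets_info)
  then have eq: "prob (?C \<inter> A) = (\<integral>\<omega>. indicator A \<omega> * share t i \<omega> \<partial>M)" if "A \<in> sets (info t)" for A
    using e1[OF that] e2[OF that] share_bounds[OF assms(2)]
    by (simp add: integral_nonneg_AE)
  show ?thesis
  proof (rule inf.real_cond_exp_charact)
    fix A assume A: "A \<in> sets (info t)"
    have "(\<integral>\<omega>\<in>A. indicator ?C \<omega> \<partial>M) = prob (?C \<inter> A)"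
      using info_M[OF A] C
      by (simp add: set_lebesgue_integral_def indicator_inter_arith[symmetric] Int_commute)
    then show "(\<integral>\<omega>\<in>A. indicator ?C \<omega> \<partial>M) = (\<integral>\<omega>\<in>A. share t i \<omega> \<partial>M)"
      using eq[OF A] by (simp add: set_lebesgue_integral_def)
  next
    show "integrable M (share t i)"
      using share_M share_bounds[OF assms(2)] by (intro bounded_integrable[where C = 1]) auto
  next
    show "integrable M (indicator (choice t i) :: 'a \<Rightarrow> real)"
      using C by (intro bounded_integrable[where C = 1]) (auto simp: indicator_def)
  qed (use share_info[OF assms(2)] in auto)
qed

lemma choice_integral:
  assumes "1 \<le> t" "i \<in> {1..t}" "f \<in> borel_measurable (info t)" and f: "\<And>\<omega>. \<bar>f \<omega>\<bar> \<le> C"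
  shows "(\<integral>\<omega>. f \<omega> * indicator (choice t i) \<omega> \<partial>M) = (\<integral>\<omega>. f \<omega> * share t i \<omega> \<partial>M)"
proof -
  interpret inf: finite_measure_subalgebra M "info t"
    by unfold_locales (rule info_subalgebra)
  have C: "choice t i \<in> sets M" using choice_sets[OF assms(1) choice_in] .
  have fM: "f \<in> borel_measurable M" by (rule measurable_from_subalg[OF info_subalgebra assms(3)])
  have 0: "0 \<le> C" using f[of undefined] by linarith
  have "(\<integral>\<omega>. f \<omega> * indicator (choice t i) \<omega> \<partial>M)
      = (\<integral>\<omega>. f \<omega> * real_cond_exp M (info t) (indicator (choice t i)) \<omega> \<partial>M)"
    using fM C f 0 assms(3)
    by (intro inf.real_cond_exp_intg(2)[symmetric])
       (auto intro!: bounded_integrable[where C = C] simp: indicator_def)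
  also have "\<dots> = (\<integral>\<omega>. f \<omega> * share t i \<omega> \<partial>M)"
    using choice_cond_exp[OF assms(1,2)] fM
      measurable_from_subalg[OF info_subalgebra share_info[OF assms(2)]]
    by (intro integral_cong_AE) auto
  finally show ?thesis .
qed

definition indeg :: "nat \<Rightarrow> nat \<Rightarrow> 'a \<Rightarrow> nat"
  where "indeg t j \<omega> = card {s \<in> {2..t}. par s \<omega> = j}"

definition deg_event :: "bool \<Rightarrow> 'l set \<Rightarrow> ('l \<Rightarrow> nat) \<Rightarrow> nat \<Rightarrow> ('l \<Rightarrow> nat) \<Rightarrow> 'a set"
  where "deg_event e L J t m = {\<omega> \<in> space M. \<forall>l\<in>L. attains e (indeg t (J l) \<omega>) (m l)}"

abbreviation path_hazard :: "('l \<Rightarrow> nat) \<Rightarrow> 'a \<Rightarrow> nat \<Rightarrow> 'l \<Rightarrow> real"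
  where "path_hazard J \<omega> \<equiv> hazard (\<lambda>i. wt i \<omega>) J"

lemma indeg_Suc:
  assumes "1 \<le> t"
  shows "indeg (Suc t) j \<omega> = indeg t j \<omega> + (if par (Suc t) \<omega> = j then 1 else 0)"
proof -
  have "{s \<in> {2..Suc t}. par s \<omega> = j} =
      (if par (Suc t) \<omega> = j then insert (Suc t) {s \<in> {2..t}. par s \<omega> = j}
       else {s \<in> {2..t}. par s \<omega> = j})"
    using assms by (auto simp: le_Suc_eq)
  then show ?thesis by (simp add: indeg_def)
qed

lemma indeg_measurable: "indeg t j \<in> measurable (history t) (count_space UNIV)"
proof (induction t)
  case 0
  have "indeg 0 j = (\<lambda>_. 0)" by (auto simp: indeg_def)
  then show ?case by simp
next
  case (Suc t)
  show ?case
  proof (cases "1 \<le> t")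
    case False
    then have "indeg (Suc t) j = (\<lambda>_. 0)" by (auto simp: indeg_def)
    then show ?thesis by simp
  next
    case True
    have [measurable]: "indeg t j \<in> measurable (history (Suc t)) (count_space UNIV)"
      using Suc history_mono[of t "Suc t"] by (auto simp: measurable_def)
    have [measurable]: "par (Suc t) \<in> measurable (history (Suc t)) (count_space UNIV)"
      using True by (intro history_par) simp
    have "indeg (Suc t) j = (\<lambda>\<omega>. indeg t j \<omega> + (if par (Suc t) \<omega> = j then 1 else 0))"
      using indeg_Suc[OF True] by auto
    moreover have "\<dots> \<in> measurable (history (Suc t)) (count_space UNIV)" by measurable
    ultimately show ?thesis by simp
  qed
qed

lemma deg_event_history:
  assumes "finite L" shows "deg_event e L J t m \<in> sets (history t)"
proof -
  have "{\<omega> \<in> space (history t). \<forall>l\<in>L. attains e (indeg t (J l) \<omega>) (m l)} \<in> sets (history t)"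
  proof (rule sets.sets_Collect_finite_All[OF _ assms])
    fix l
    have "indeg t (J l) -` {z. attains e z (m l)} \<inter> space (history t) \<in> sets (history t)"
      by (rule measurable_sets[OF indeg_measurable]) simp
    then show "{\<omega> \<in> space (history t). attains e (indeg t (J l) \<omega>) (m l)} \<in> sets (history t)"
      by (simp add: vimage_def Int_def conj_commute)
  qed
  then show ?thesis by (simp add: deg_event_def)
qed

text \<open>At most one of the labels is hit by a new vertex, since the chosen vertices are distinct; so the
indicators obey the recursion of \<open>deg_law\<close> with random hitting indicators.\<close>

lemma deg_event_step:
  fixes J :: "'l \<Rightarrow> nat"
  assumes "1 \<le> t" "finite L" "inj_on J L" "\<omega> \<in> space M"
  shows "indicator (deg_event e L J (Suc t) m) \<omega> =
    (1 - (\<Sum>l\<in>L. active e (m l) * indicator (choice t (J l)) \<omega>)) * indicator (deg_event e L J t m) \<omega>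
    + (\<Sum>l\<in>L. if m l = 0 then 0
        else indicator (choice t (J l)) \<omega> * indicator (deg_event e L J t (m(l := m l - 1))) \<omega> ::
            real)"
proof (cases "\<exists>l\<in>L. par (Suc t) \<omega> = J l")
  case False
  then have ch: "indicator (choice t (J l)) \<omega> = (0::real)" if "l \<in> L" for l using that by auto
  have "(\<Sum>l\<in>L. active e (m l) * indicator (choice t (J l)) \<omega>) = 0"
    "(\<Sum>l\<in>L. if m l = 0 then 0
        else indicator (choice t (J l)) \<omega> * indicator (deg_event e L J t (m(l := m l - 1))) \<omega> ::
            real) = 0"
    by (intro sum.neutral ballI; simp add: ch)+
  moreover have "\<omega> \<in> deg_event e L J (Suc t) m \<longleftrightarrow> \<omega> \<in> deg_event e L J t m"
    using False by (auto simp: deg_event_def indeg_Suc[OF assms(1)])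
  ultimately show ?thesis by (simp only: indicator_def) simp
next
  case True
  then obtain l0 where l0: "l0 \<in> L" "par (Suc t) \<omega> = J l0" by auto
  have ch: "indicator (choice t (J l)) \<omega> = (if l = l0 then 1 else 0 :: real)" if "l \<in> L" for l
    using l0 that assms by (auto simp: indicator_def inj_on_def)
  have deg: "indeg (Suc t) (J l) \<omega> = indeg t (J l) \<omega> + (if l = l0 then 1 else 0)" if "l \<in> L" for l
    using l0 that assms(3) by (auto simp: indeg_Suc[OF assms(1)] inj_on_def)
  have s1: "(\<Sum>l\<in>L. active e (m l) * indicator (choice t (J l)) \<omega>) = active e (m l0)"
  proof -
    have "(\<Sum>l\<in>L. active e (m l) * indicator (choice t (J l)) \<omega>)
        = (\<Sum>l\<in>L. if l = l0 then active e (m l0) else 0)"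
      by (rule sum.cong) (auto simp: ch)
    then show ?thesis using assms(2) l0 by simp
  qed
  have s2: "(\<Sum>l\<in>L. if m l = 0 then 0
        else indicator (choice t (J l)) \<omega> * indicator (deg_event e L J t (m(l := m l - 1))) \<omega>)
      = (if m l0 = 0 then 0 else indicator (deg_event e L J t (m(l0 := m l0 - 1))) \<omega> :: real)"
  proof -
    have "(\<Sum>l\<in>L. if m l = 0 then 0
        else indicator (choice t (J l)) \<omega> * indicator (deg_event e L J t (m(l := m l - 1))) \<omega>)
      = (\<Sum>l\<in>L. if l = l0 then (if m l0 = 0 then 0 else indicator
          (deg_event e L J t (m(l0 := m l0 - 1))) \<omega>) else 0 :: real)"
      by (rule sum.cong) (auto simp: ch)
    then show ?thesis using assms(2) l0 by simp
  qed
  have ev: "\<omega> \<in> deg_event e L J (Suc t) m \<longleftrightarrow>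
     (\<forall>l\<in>L - {l0}. attains e (indeg t (J l) \<omega>) (m l)) \<and> attains e (Suc (indeg t (J l0) \<omega>)) (m l0)"
    using assms(4) l0 deg by (auto simp: deg_event_def)
  have ev0: "\<omega> \<in> deg_event e L J t m' \<longleftrightarrow>
     (\<forall>l\<in>L - {l0}. attains e (indeg t (J l) \<omega>) (m' l))
         \<and> attains e (indeg t (J l0) \<omega>) (m' l0)" for m'
    using assms(4) l0 by (auto simp: deg_event_def)
  show ?thesis
  proof (cases "m l0 = 0")
    case True
    then show ?thesis
      unfolding s1 s2 by (auto simp: indicator_def ev ev0 active_def attains_def)
  next
    case False
    then have "\<omega> \<in> deg_event e L J (Suc t) m \<longleftrightarrow> \<omega> \<in> deg_event e L J t (m(l0 := m l0 - 1))"
      unfolding ev ev0 by (auto simp: attains_def)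
    with False show ?thesis
      unfolding s1 s2 by (simp add: indicator_def active_def)
  qed
qed

lemma path_hazard_bounds:
  assumes "finite L" "inj_on J L" "J ` L \<subseteq> {1..}"
  shows "l \<in> L \<Longrightarrow> 0 \<le> path_hazard J \<omega> t l" "(\<Sum>l\<in>L. path_hazard J \<omega> t l) \<le> 1"
    "l \<in> L \<Longrightarrow> path_hazard J \<omega> t l \<le> 1"
proof -
  show 1: "0 \<le> path_hazard J \<omega> t l" if "l \<in> L" for l
    using that assms by (intro hazard_nonneg) (auto intro: wt_pos)
  show 2: "(\<Sum>l\<in>L. path_hazard J \<omega> t l) \<le> 1"
    using assms by (intro hazard_sum_le_1) (auto intro: wt_pos)
  show "path_hazard J \<omega> t l \<le> 1" if "l \<in> L"
    using member_le_sum[of l L "path_hazard J \<omega> t"] 1 2 that assms(1) by fastforce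
qed

lemma path_hazard_info:
  assumes "J l \<ge> 1" shows "(\<lambda>\<omega>. path_hazard J \<omega> t l) \<in> borel_measurable (info s)"
proof (cases "J l \<le> t")
  case True
  have "(\<lambda>\<omega>. wt (J l) \<omega> / (\<Sum>i=1..t. wt i \<omega>)) \<in> borel_measurable (info s)"
    by (intro borel_measurable_divide borel_measurable_sum info_wt assms) auto
  with True show ?thesis by (simp add: hazard_def)
next
  case False
  then show ?thesis by (simp add: hazard_def)
qed

lemma path_law_info:
  assumes "finite L" "J ` L \<subseteq> {1..}"
  shows "(\<lambda>\<omega>. deg_law e L (path_hazard J \<omega>) t m) \<in> borel_measurable (info s)"
proof (induction t arbitrary: m)
  case (Suc t)
  have [measurable]: "(\<lambda>\<omega>. path_hazard J \<omega> t l) \<in> borel_measurable (info s)" if "l \<in> L" for l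
    using assms that by (intro path_hazard_info) auto
  note Suc[measurable]
  have *: "(\<lambda>\<omega>. if m l = 0 then 0 else path_hazard J \<omega> t l
      * deg_law e L (path_hazard J \<omega>) t (m(l := m l - 1)))
      \<in> borel_measurable (info s)" if "l \<in> L" for l
    using that by measurable
  show ?case unfolding deg_law.simps
    by (intro borel_measurable_add borel_measurable_times borel_measurable_diff
        borel_measurable_sum Suc borel_measurable_const *) auto
qed simp

lemma integral_linear_step:
  fixes X :: "'a \<Rightarrow> real" and Y Z :: "'l \<Rightarrow> 'a \<Rightarrow> real"
  assumes "integrable M X" "\<And>l. l \<in> L \<Longrightarrow> integrable M (Y l)" "\<And>l. l \<in> L \<Longrightarrow> integrable M (Z l)"
  shows "(\<integral>\<omega>. X \<omega> - (\<Sum>l\<in>L. c l * Y l \<omega>) + (\<Sum>l\<in>L. if d l then 0 else Z l \<omega>) \<partial>M)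
    = (\<integral>\<omega>. X \<omega> \<partial>M) - (\<Sum>l\<in>L. c l * (\<integral>\<omega>. Y l \<omega> \<partial>M)) + (\<Sum>l\<in>L. if d l then 0 else \<integral>\<omega>. Z l \<omega> \<partial>M)"
proof -
  have Z: "integrable M (\<lambda>\<omega>. if d l then 0 else Z l \<omega>)"
    "(\<integral>\<omega>. (if d l then 0 else Z l \<omega>) \<partial>M) = (if d l then 0 else \<integral>\<omega>. Z l \<omega> \<partial>M)" if "l \<in> L" for l
    using assms(3)[OF that] by (cases "d l"; simp)+
  show ?thesis
    using assms Z by (simp add: Bochner_Integration.integral_sum)
qed

text \<open>The recursion holds conditionally on all weights. The test function \<open>\<phi>\<close> of the weights is needed
for the induction, where it absorbs the attachment probability of the last step; later it is the
indicator of an event on which the weights are typical.\<close>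

theorem quenched_law:
  fixes J :: "'l \<Rightarrow> nat"
  assumes L: "finite L" "inj_on J L" "J ` L \<subseteq> {1..}" and "1 \<le> t"
    and "\<And>s. 1 \<le> s \<Longrightarrow> \<phi> \<in> borel_measurable (info s)" "\<And>\<omega>. \<bar>\<phi> \<omega>\<bar> \<le> C"
  shows "(\<integral>\<omega>. \<phi> \<omega> * indicator (deg_event e L J t m) \<omega> \<partial>M)
    = (\<integral>\<omega>. \<phi> \<omega> * deg_law e L (path_hazard J \<omega>) t m \<partial>M)"
  using assms(4,5,6)
proof (induction t arbitrary: m \<phi> rule: dec_induct)
  case base
  have J: "J l \<ge> 1" if "l \<in> L" for l using L that by auto
  have 1: "deg_law e L (path_hazard J \<omega>) 1 m = (if \<forall>l\<in>L. m l = 0 then 1 else 0)" for \<omega>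
  proof -
    have "path_hazard J \<omega> 0 l = 0" if "l \<in> L" for l using J[OF that] by (simp add: hazard_def)
    then have "(\<Sum>l\<in>L. active e (m l) * path_hazard J \<omega> 0 l) = 0"
      "(\<Sum>l\<in>L. if m l = 0 then 0 else path_hazard J \<omega> 0 l
          * deg_law e L (path_hazard J \<omega>) 0 (m(l := m l - 1))) = 0"
      by (auto intro!: sum.neutral)
    then show ?thesis by (simp only: One_nat_def deg_law.simps) simp
  qed
  have "\<omega> \<in> deg_event e L J 1 m \<longleftrightarrow> (\<forall>l\<in>L. m l = 0)" if "\<omega> \<in> space M" for \<omega>
    using that by (auto simp: deg_event_def indeg_def attains_def)
  then show ?case
    by (intro Bochner_Integration.integral_cong) (simp_all only: 1, simp_all add: indicator_def)
next
  case (step t m \<phi>)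
  let ?D = "\<lambda>m \<omega>. deg_law e L (path_hazard J \<omega>) t m"
  let ?h = "\<lambda>\<omega> l. path_hazard J \<omega> t l"
  let ?A = "\<lambda>m. deg_event e L J t m"
  let ?I = "\<lambda>l. indicator (choice t (J l)) :: 'a \<Rightarrow> real"
  have C0: "0 \<le> C" using step.prems(2)[of undefined] by linarith
  have J: "J l \<ge> 1" if "l \<in> L" for l using L that by auto
  note h_bd = path_hazard_bounds[OF L]
  have D_bd: "\<bar>?D m \<omega>\<bar> \<le> 1" for m \<omega>
    using deg_law_bounds[OF L(1), of "path_hazard J \<omega>" e t m] h_bd by (simp add: abs_le_iff)
  have toM: "f \<in> borel_measurable M" if "f \<in> borel_measurable (info t)" for f :: "'a \<Rightarrow> real"
    by (rule measurable_from_subalg[OF info_subalgebra that])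
  have \<phi>_info: "\<phi> \<in> borel_measurable (info t)" using step by auto
  have A_info: "(indicator (?A m) :: 'a \<Rightarrow> real) \<in> borel_measurable (info t)" for m
    using deg_event_history[OF L(1)] history_le_info by (intro borel_measurable_indicator) blast
  have choice_M: "choice t i \<in> sets M" for i using choice_sets[OF _ choice_in] step by simp
  have meas [measurable]: "\<phi> \<in> borel_measurable M" "(indicator (?A m) :: 'a \<Rightarrow> real)
      \<in> borel_measurable M"
    "?D m \<in> borel_measurable M" "?I l \<in> borel_measurable M" for m l
    using toM[OF \<phi>_info] toM[OF A_info] toM[OF path_law_info[OF L(1,3)]] choice_M by auto
  have meas_h [measurable]: "(\<lambda>\<omega>. ?h \<omega> l) \<in> borel_measurable M" if "l \<in> L" for l
    using toM[OF path_hazard_info] J[OF that] by auto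
  have prod_bd: "\<bar>\<phi> \<omega> * x * y\<bar> \<le> C" if "\<bar>x\<bar> \<le> 1" "\<bar>y\<bar> \<le> 1" for \<omega> x y
  proof -
    have "\<bar>\<phi> \<omega>\<bar> * \<bar>x\<bar> * \<bar>y\<bar> \<le> C * 1 * 1"
      using step.prems(2)[of \<omega>] that C0 by (intro mult_mono mult_nonneg_nonneg) auto
    then show ?thesis by (simp add: abs_mult)
  qed
  have int1: "integrable M (\<lambda>\<omega>. \<phi> \<omega> * indicator (?A m) \<omega>)" "integrable M (\<lambda>\<omega>. \<phi> \<omega> * ?D m \<omega>)" for m
    using prod_bd[of 1] D_bd
    by (auto intro!: bounded_integrable[where C = C] split: split_indicator)
  have int2: "integrable M (\<lambda>\<omega>. \<phi> \<omega> * indicator (?A m) \<omega> * ?I l \<omega>)"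
    "l \<in> L \<Longrightarrow> integrable M (\<lambda>\<omega>. \<phi> \<omega> * ?h \<omega> l * ?D m \<omega>)" for m l
    using h_bd D_bd by (auto intro!: bounded_integrable[where C = C] prod_bd)
  have hit: "(\<integral>\<omega>. \<phi> \<omega> * indicator (?A m) \<omega> * ?I l \<omega> \<partial>M) = (\<integral>\<omega>. \<phi> \<omega> * ?h \<omega> l * ?D m \<omega> \<partial>M)"
    if l: "l \<in> L" for l m
  proof -
    have "(\<integral>\<omega>. \<phi> \<omega> * indicator (?A m) \<omega> * ?I l \<omega> \<partial>M) = (\<integral>\<omega>. \<phi> \<omega> * indicator (?A m) \<omega> * ?h \<omega> l \<partial>M)"
    proof (cases "J l \<le> t")
      case True
      have "(\<integral>\<omega>. (\<phi> \<omega> * indicator (?A m) \<omega>) * ?I l \<omega> \<partial>M)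
          = (\<integral>\<omega>. (\<phi> \<omega> * indicator (?A m) \<omega>) * share t (J l) \<omega> \<partial>M)"
        using True J[OF l] step \<phi>_info A_info prod_bd[of 1]
        by (intro choice_integral[where C = C] borel_measurable_times)
            (auto simp: C0 split: split_indicator)
      then show ?thesis using True by (simp add: share_def hazard_def)
    next
      case False
      have "?I l \<omega> = 0" if "\<omega> \<in> space M" for \<omega>
        using par_range[OF _ that, of t] False step by auto
      then have "(\<integral>\<omega>. \<phi> \<omega> * indicator (?A m) \<omega> * ?I l \<omega> \<partial>M) = (\<integral>\<omega>. 0 \<partial>M)"
        by (intro Bochner_Integration.integral_cong) auto
      then show ?thesis using False by (simp add: hazard_def)
    qed
    also have "\<dots> = (\<integral>\<omega>. (\<phi> \<omega> * ?h \<omega> l) * indicator (?A m) \<omega> \<partial>M)"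
      by (simp add: mult_ac)
    also have "\<dots> = (\<integral>\<omega>. (\<phi> \<omega> * ?h \<omega> l) * ?D m \<omega> \<partial>M)"
    proof (rule step.IH)
      show "(\<lambda>\<omega>. \<phi> \<omega> * ?h \<omega> l) \<in> borel_measurable (info s)" if "1 \<le> s" for s
        using step.prems(1)[OF that] path_hazard_info[where J = J and l = l, OF J[OF l]]
            by (rule borel_measurable_times)
      show "\<bar>\<phi> \<omega> * ?h \<omega> l\<bar> \<le> C" for \<omega>
        using prod_bd[of "?h \<omega> l" 1] h_bd l by auto
    qed
    finally show ?thesis .
  qed
  have "(\<integral>\<omega>. \<phi> \<omega> * indicator (deg_event e L J (Suc t) m) \<omega> \<partial>M)
    = (\<integral>\<omega>. \<phi> \<omega> * indicator (?A m) \<omega> - (\<Sum>l\<in>L. active e (m l) * (\<phi> \<omega> * indicator (?A m) \<omega> * ?I l \<omega>))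
        + (\<Sum>l\<in>L. if m l = 0 then 0 else \<phi> \<omega> * indicator (?A (m(l := m l - 1))) \<omega> * ?I l \<omega>) \<partial>M)"
  proof (intro Bochner_Integration.integral_cong refl)
    fix \<omega> assume "\<omega> \<in> space M"
    note eq = deg_event_step[OF step.hyps(1) L(1,2) this, of e m]
    show "\<phi> \<omega> * indicator (deg_event e L J (Suc t) m) \<omega> = \<phi> \<omega> * indicator (?A m) \<omega>
        - (\<Sum>l\<in>L. active e (m l) * (\<phi> \<omega> * indicator (?A m) \<omega> * ?I l \<omega>))
        + (\<Sum>l\<in>L. if m l = 0 then 0 else \<phi> \<omega> * indicator (?A (m(l := m l - 1))) \<omega> * ?I l \<omega>)"
      unfolding eq by (simp add: algebra_simps sum_distrib_left if_distrib cong: if_cong)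
  qed
  also have "\<dots> = (\<integral>\<omega>. \<phi> \<omega> * indicator (?A m) \<omega> \<partial>M)
      - (\<Sum>l\<in>L. active e (m l) * (\<integral>\<omega>. \<phi> \<omega> * indicator (?A m) \<omega> * ?I l \<omega> \<partial>M))
      + (\<Sum>l\<in>L. if m l = 0 then 0 else (\<integral>\<omega>. \<phi> \<omega> * indicator (?A (m(l := m l - 1))) \<omega> * ?I l \<omega> \<partial>M))"
    by (intro integral_linear_step int1 int2)
  also have "\<dots> = (\<integral>\<omega>. \<phi> \<omega> * ?D m \<omega> \<partial>M)
      - (\<Sum>l\<in>L. active e (m l) * (\<integral>\<omega>. \<phi> \<omega> * ?h \<omega> l * ?D m \<omega> \<partial>M))
      + (\<Sum>l\<in>L. if m l = 0 then 0 else (\<integral>\<omega>. \<phi> \<omega> * ?h \<omega> l * ?D (m(l := m l - 1)) \<omega> \<partial>M))"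
    by (intro arg_cong2[where f = "(+)"] arg_cong2[where f = "(-)"] sum.cong refl step.IH
        step.prems)
       (simp_all add: hit)
  also have "\<dots> = (\<integral>\<omega>. \<phi> \<omega> * ?D m \<omega> - (\<Sum>l\<in>L. active e (m l) * (\<phi> \<omega> * ?h \<omega> l * ?D m \<omega>))
        + (\<Sum>l\<in>L. if m l = 0 then 0 else \<phi> \<omega> * ?h \<omega> l * ?D (m(l := m l - 1)) \<omega>) \<partial>M)"
    by (intro integral_linear_step[symmetric] int1 int2)
  also have "\<dots> = (\<integral>\<omega>. \<phi> \<omega> * deg_law e L (path_hazard J \<omega>) (Suc t) m \<partial>M)"
    by (intro Bochner_Integration.integral_cong refl)
       (simp add: algebra_simps sum_distrib_left if_distrib cong: if_cong)
  finally show ?case .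
qed

end

section \<open>One vertex among weights that grow like their mean\<close>

text \<open>The one-label version of \<open>deg_law\<close>: a vertex that is hit at time \<open>t\<close> with probability \<open>b t\<close>,
independently over time.\<close>

primrec lone_law :: "bool \<Rightarrow> (nat \<Rightarrow> real) \<Rightarrow> nat \<Rightarrow> nat \<Rightarrow> real"
  where
    "lone_law e b 0 m = (if m = 0 then 1 else 0)"
  | "lone_law e b (Suc t) m =
      (1 - active e m * b t) * lone_law e b t m
          + (if m = 0 then 0 else b t * lone_law e b t (m - 1))"

text \<open>The hitting probability if the weight sums were exactly equal to their means.\<close>

definition rate :: "real \<Rightarrow> real \<Rightarrow> nat \<Rightarrow> nat \<Rightarrow> real"
  where "rate \<mu> x j t = (if j \<le> t then x / (\<mu> * real t) else 0)"

text \<open>The expectation of \<open>z\<close> to the number of hits in \<open>[n0, t)\<close> of a vertex of weight \<open>1\<close> that is hit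
at the averaged rate.\<close>

definition growth :: "real \<Rightarrow> real \<Rightarrow> nat \<Rightarrow> nat \<Rightarrow> real"
  where "growth \<mu> z n0 t = (\<Prod>s=n0..<t. 1 + (z - 1) / (\<mu> * real s))"

lemma lone_law_before:
  assumes "t \<le> j" shows "lone_law e (rate \<mu> x j) t m = (if m = 0 then 1 else 0)"
  using assms by (induction t arbitrary: m) (auto simp: rate_def)

lemma lone_law_nonneg:
  assumes "\<And>s. 0 \<le> b s" "\<And>s. b s \<le> 1"
  shows "0 \<le> lone_law e b t m"
  using assms by (induction t arbitrary: m) (auto simp: active_def intro!: add_nonneg_nonneg
      mult_nonneg_nonneg)

lemma rate_bounds:
  assumes "0 \<le> x" "x \<le> 1" "0 < \<mu>" "1 \<le> \<mu> * real n0" "n0 \<le> j"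
  shows "0 \<le> rate \<mu> x j t" "rate \<mu> x j t \<le> 1"
proof -
  show "0 \<le> rate \<mu> x j t" using assms by (simp add: rate_def)
  show "rate \<mu> x j t \<le> 1"
  proof (cases "j \<le> t")
    case True
    then have "\<mu> * real n0 \<le> \<mu> * real t" using assms by (intro mult_left_mono) auto
    then have "x \<le> \<mu> * real t" "0 < \<mu> * real t" using assms by linarith+
    then show ?thesis using True by (simp add: rate_def)
  qed (simp add: rate_def)
qed

lemma growth_Suc:
  assumes "n0 \<le> t"
  shows "growth \<mu> z n0 (Suc t) = growth \<mu> z n0 t * (1 + (z - 1) / (\<mu> * real t))"
  using assms by (simp add: growth_def)

lemma growth_pos:
  assumes "0 < \<mu>" "1 \<le> z" shows "0 < growth \<mu> z n0 t"
  unfolding growth_def using assms by (intro prod_pos) (auto intro!: add_pos_nonneg)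

lemma lone_step_mono:
  fixes F G :: "nat \<Rightarrow> real"
  assumes "0 \<le> b" "b \<le> 1" "\<And>m. F m \<le> G m"
  shows "(1 - active e m * b) * F m + (if m = 0 then 0 else b * F (m - 1))
    \<le> (1 - active e m * b) * G m + (if m = 0 then 0 else b * G (m - 1))"
  using assms by (intro add_mono mult_left_mono) (auto simp: active_def intro!: mult_left_mono)

text \<open>An exponential moment bound is a supersolution of the one-vertex recursion, whatever the birth
time and the weight of the vertex.\<close>

lemma growth_super:
  assumes "0 < \<mu>" "1 \<le> z" "n0 \<le> t" "0 \<le> b" "b \<le> 1 / (\<mu> * real t)" "0 \<le> y"
  shows "(1 - active e m * b) * (y * growth \<mu> z n0 t / z ^ m)
      + (if m = 0 then 0 else b * (y * growth \<mu> z n0 t / z ^ (m - 1)))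
    \<le> y * growth \<mu> z n0 (Suc t) / z ^ m"
proof -
  define G where "G = y * growth \<mu> z n0 t / z ^ m"
  have G: "0 \<le> G" unfolding G_def using assms growth_pos[of \<mu> z n0 t] by simp
  have "b * (z - 1) \<le> 1 / (\<mu> * real t) * (z - 1)" using assms by (intro mult_right_mono) auto
  then have b: "b * (z - 1) \<le> (z - 1) / (\<mu> * real t)" by simp
  have q: "0 \<le> (z - 1) / (\<mu> * real t)" using assms by simp
  have eq: "y * growth \<mu> z n0 (Suc t) / z ^ m = G * (1 + (z - 1) / (\<mu> * real t))"
    by (simp add: growth_Suc[OF assms(3)] G_def)
  show ?thesis
  proof (cases "m = 0")
    case True
    have "(1 - active e 0 * b) * G \<le> 1 * G"
      using G assms by (intro mult_right_mono) (auto simp: active_def)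
    also have "\<dots> \<le> G * (1 + (z - 1) / (\<mu> * real t))" using mult_nonneg_nonneg[OF G q]
        by (simp only: distrib_left mult_1_right mult_1_left)
    finally show ?thesis unfolding eq using True by (simp add: G_def)
  next
    case False
    then have "y * growth \<mu> z n0 t / z ^ (m - 1) = z * G"
      unfolding G_def using assms by (cases m) auto
    then have "(1 - active e m * b) * G + b * (y * growth \<mu> z n0 t / z ^ (m - 1)) = G
        * (1 + b * (z - 1))"
      using False by (simp add: active_def algebra_simps)
    also have "\<dots> \<le> G * (1 + (z - 1) / (\<mu> * real t))" using G b by (intro mult_left_mono) auto
    finally show ?thesis unfolding eq using False by (simp add: G_def)
  qed
qed

text \<open>For weight \<open>x\<close>: the mass at \<open>m\<close>, respectively on \<open>[m, \<infinity>)\<close>, of the geometric law with ratio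
\<open>x / (\<mu> + x)\<close>, which is the limiting in-degree law of a uniform vertex.\<close>

definition geo :: "bool \<Rightarrow> real \<Rightarrow> real \<Rightarrow> nat \<Rightarrow> real"
  where "geo e \<mu> x m = (if e then \<mu> / (\<mu> + x) else 1) * (x / (\<mu> + x)) ^ m"

lemma geo_nonneg: "0 < \<mu> \<Longrightarrow> 0 \<le> x \<Longrightarrow> 0 \<le> geo e \<mu> x m"
  by (simp add: geo_def)

text \<open>The sums over the birth times solve the one-vertex recursion with one unit of mass born at
degree \<open>0\<close> in each step; \<open>t\<close> times the geometric law is an exact solution of it. This is why no
integral over birth times has to be approximated.\<close>

lemma geo_fixed_point:
  assumes "0 < \<mu>" "0 < x" "0 < t"
  shows "real (Suc t) * geo e \<mu> x m =
    (1 - active e m * (x / (\<mu> * real t))) * (real t * geo e \<mu> x m)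
    + (if m = 0 then 0 else x / (\<mu> * real t) * (real t * geo e \<mu> x (m - 1)))
    + (if m = 0 then 1 else 0)"
proof (cases m)
  case 0
  show ?thesis
  proof (cases e)
    case True
    then have "(\<mu> + x) * geo e \<mu> x 0 = \<mu>" using assms by (simp add: geo_def)
    then have "geo e \<mu> x 0 = 1 - x / \<mu> * geo e \<mu> x 0" using assms by (simp add: field_simps)
    then show ?thesis using assms True 0 by (simp add: active_def algebra_simps)
  qed (use 0 in \<open>simp add: geo_def active_def\<close>)
next
  case (Suc i)
  have g: "geo e \<mu> x m = x / (\<mu> + x) * geo e \<mu> x i" using Suc by (simp add: geo_def)
  have "(\<mu> + x) * geo e \<mu> x m = x * geo e \<mu> x i" unfolding g using assms by simp
  then have "\<mu> * geo e \<mu> x m + x * geo e \<mu> x m = x * geo e \<mu> x i"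
    by (simp only: distrib_right)
  then have "geo e \<mu> x m = x / \<mu> * geo e \<mu> x i - x / \<mu> * geo e \<mu> x m"
    using assms by (simp add: field_simps)
  then show ?thesis using assms Suc by (simp add: active_def algebra_simps)
qed

lemma lone_sum_Suc:
  assumes "n0 \<le> t"
  shows "(\<Sum>j=n0..Suc t. lone_law e (rate \<mu> x j) (Suc t) m) =
    (1 - active e m * (x / (\<mu> * real t))) * (\<Sum>j=n0..t. lone_law e (rate \<mu> x j) t m)
    + (if m = 0 then 0 else x / (\<mu> * real t) * (\<Sum>j=n0..t. lone_law e (rate \<mu> x j) t (m - 1)))
    + (if m = 0 then 1 else 0)"
proof -
  have "{n0..Suc t} = insert (Suc t) {n0..t}" using assms by auto
  then have "(\<Sum>j=n0..Suc t. lone_law e (rate \<mu> x j) (Suc t) m)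
    = (\<Sum>j=n0..t. lone_law e (rate \<mu> x j) (Suc t) m) + (if m = 0 then 1 else 0)"
    using lone_law_before[of "Suc t" "Suc t"] by (simp del: lone_law.simps)
  moreover have "(\<Sum>j=n0..t. lone_law e (rate \<mu> x j) (Suc t) m) =
    (\<Sum>j=n0..t. (1 - active e m * (x / (\<mu> * real t))) * lone_law e (rate \<mu> x j) t m
    + (if m = 0 then 0 else x / (\<mu> * real t) * lone_law e (rate \<mu> x j) t (m - 1)))"
    by (rule sum.cong) (auto simp: rate_def)
  ultimately show ?thesis
    by (simp add: sum.distrib sum_distrib_left)
qed

lemma lone_sum_le:
  assumes "0 < \<mu>" "0 < x" "x \<le> 1" "\<mu> \<le> 1" "2 \<le> \<mu> * real n0" "n0 \<le> t"
  shows "(\<Sum>j=n0..t. lone_law e (rate \<mu> x j) t m) \<le> real t * geo e \<mu> x m"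
  using assms(6)
proof (induction t arbitrary: m rule: dec_induct)
  case base
  have n0: "1 \<le> real n0" using assms by (cases n0) auto
  have "1 \<le> real n0 * (\<mu> / (\<mu> + x))" using assms by (simp add: field_simps)
  then have "1 \<le> real n0 * geo e \<mu> x 0" using n0 by (simp add: geo_def)
  then show ?case
    using assms geo_nonneg[of \<mu> x e m] by (simp add: lone_law_before)
next
  case (step t)
  have t: "0 < t" using assms step by (cases "n0 = 0") auto
  have "\<mu> * real n0 \<le> \<mu> * real t" using assms step by (intro mult_left_mono) auto
  then have "x \<le> \<mu> * real t" "0 < \<mu> * real t" using assms by linarith+
  then have c: "0 \<le> x / (\<mu> * real t)" "x / (\<mu> * real t) \<le> 1"
    using assms by simp_all
  show ?case
    unfolding lone_sum_Suc[OF step.hyps(1)] geo_fixed_point[OF assms(1,2) t, of e m]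
    using lone_step_mono[OF c step.IH, of e m] by (intro add_right_mono)
qed

lemma geo_le_power:
  assumes "0 < \<mu>" "0 < x" "x \<le> 1" "1 \<le> z" "z \<le> 1 + \<mu>"
  shows "geo e \<mu> x m \<le> 1 / z ^ m"
proof -
  have "x / (\<mu> + x) \<le> 1 / z"
  proof -
    have "x * z \<le> x * (1 + \<mu>)" using assms by (intro mult_left_mono) auto
    also have "\<dots> \<le> \<mu> + x" using assms by (simp add: algebra_simps mult_left_le)
    finally show ?thesis using assms by (simp add: field_simps)
  qed
  then have "(x / (\<mu> + x)) ^ m \<le> (1 / z) ^ m" using assms by (intro power_mono) auto
  then have "geo e \<mu> x m \<le> 1 * (1 / z) ^ m"
    unfolding geo_def using assms by (intro mult_mono) (auto simp: divide_le_eq)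
  then show ?thesis by (simp add: power_one_over)
qed

lemma lone_law_le_growth:
  assumes "0 < \<mu>" "0 < x" "x \<le> 1" "1 \<le> \<mu> * real n0" "n0 \<le> t" "n0 \<le> j" "1 \<le> z"
  shows "lone_law e (rate \<mu> x j) t m \<le> growth \<mu> z n0 t / z ^ m"
  using assms(5)
proof (induction t arbitrary: m rule: dec_induct)
  case base
  then show ?case using assms by (simp add: lone_law_before growth_def)
next
  case (step t)
  define b where "b = rate \<mu> x j t"
  have b: "0 \<le> b" "b \<le> 1" using rate_bounds[of x \<mu> n0 j t] assms by (auto simp: b_def)
  have "b \<le> 1 / (\<mu> * real t)" using assms by (auto simp: b_def rate_def intro!: divide_right_mono)
  from growth_super[OF assms(1) assms(7) step.hyps(1) b(1) this, of 1 e m]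
  have "(1 - active e m * b) * (growth \<mu> z n0 t / z ^ m)
      + (if m = 0 then 0 else b * (growth \<mu> z n0 t / z ^ (m - 1))) \<le> growth \<mu> z n0 (Suc t) / z ^ m"
    by (simp cong: if_cong)
  moreover have "lone_law e (rate \<mu> x j) (Suc t) m \<le> (1 - active e m * b)
      * (growth \<mu> z n0 t / z ^ m)
      + (if m = 0 then 0 else b * (growth \<mu> z n0 t / z ^ (m - 1)))"
    unfolding lone_law.simps b_def[symmetric]
    by (rule lone_step_mono[OF b step.IH])
  ultimately show ?case by linarith
qed

text \<open>The difference of the two solutions is what started at time \<open>n0\<close>; it obeys the recursion without
births and is therefore dominated by an exponential moment.\<close>

lemma lone_sum_ge:
  assumes "0 < \<mu>" "0 < x" "x \<le> 1" "2 \<le> \<mu> * real n0" "n0 \<le> t" "1 \<le> z" "z \<le> 1 + \<mu>"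
  shows "real t * geo True \<mu> x m - real n0 * growth \<mu> z n0 t / z ^ m
    \<le> (\<Sum>j=n0..t. lone_law True (rate \<mu> x j) t m)"
  using assms(5)
proof (induction t arbitrary: m rule: dec_induct)
  case base
  have "real n0 * geo True \<mu> x m \<le> real n0 * (1 / z ^ m)"
    by (intro mult_left_mono geo_le_power assms) simp
  moreover have "(0::real) \<le> (\<Sum>j=n0..n0. lone_law True (rate \<mu> x j) n0 m)"
    by (simp add: lone_law_before)
  ultimately show ?case by (simp add: growth_def)
next
  case (step t)
  have t: "0 < t" using assms step by (cases "n0 = 0") auto
  define b where "b = x / (\<mu> * real t)"
  have "\<mu> * real n0 \<le> \<mu> * real t" using assms step by (intro mult_left_mono) auto
  then have "x \<le> \<mu> * real t" "0 < \<mu> * real t" using assms by linarith+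
  then have b: "0 \<le> b" "b \<le> 1" "b \<le> 1 / (\<mu> * real t)"
    using assms by (simp_all add: b_def divide_right_mono)
  define F where "F m = real n0 * growth \<mu> z n0 t / z ^ m" for m
  define g where "g m = real t * geo True \<mu> x m" for m
  have "(1 - b) * F m + (if m = 0 then 0 else b * F (m - 1)) \<le> real n0 * growth \<mu> z n0 (Suc t)
      / z ^ m"
    using growth_super[OF assms(1,6) step.hyps(1) b(1,3), of "real n0" True m]
    by (simp add: F_def active_def cong: if_cong)
  moreover have "real (Suc t) * geo True \<mu> x m = (1 - b) * g m
      + (if m = 0 then 0 else b * g (m - 1)) + (if m = 0 then 1 else 0)"
    using geo_fixed_point[OF assms(1,2) t, of True m]
        by (simp add: b_def g_def active_def cong: if_cong)
  moreover have "(1 - b) * (g m - F m) + (if m = 0 then 0 else b * (g (m - 1) - F (m - 1)))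
      + (if m = 0 then 1 else 0)
      \<le> (\<Sum>j=n0..Suc t. lone_law True (rate \<mu> x j) (Suc t) m)"
    unfolding lone_sum_Suc[OF step.hyps(1)] b_def[symmetric]
    using lone_step_mono[OF b(1,2), of "\<lambda>m. g m
        - F m" "\<lambda>m. \<Sum>j=n0..t. lone_law True (rate \<mu> x j) t m" True m]
      step.IH by (simp add: active_def F_def g_def cong: if_cong)
  ultimately show ?case by (auto simp: algebra_simps split: if_splits)
qed

text \<open>Upper bound for a vertex \<open>j\<close>: an exponential moment if \<open>j\<close> was born before \<open>n0\<close>, with \<open>y\<close>
accounting for everything that happened before \<open>n0\<close>, and the averaged law otherwise.\<close>

definition vertex_mass :: "bool \<Rightarrow> real \<Rightarrow> real \<Rightarrow> real \<Rightarrow> nat \<Rightarrow> nat \<Rightarrow> nat \<Rightarrow> real \<Rightarrow> nat \<Rightarrow> real"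
  where "vertex_mass e \<mu> z y n0 t j x m =
    (if j < n0 then y * growth \<mu> z n0 t / z ^ m else lone_law e (rate \<mu> x j) t m)"

section \<open>Comparison with independent vertices from above\<close>

text \<open>Independent labels may be hit simultaneously; keeping only the terms with at most one hit gives
a lower bound for their joint step.\<close>

lemma prod_add_ge:
  fixes x y :: "'l \<Rightarrow> real"
  assumes "finite L" "\<And>l. l \<in> L \<Longrightarrow> 0 \<le> x l" "\<And>l. l \<in> L \<Longrightarrow> 0 \<le> y l"
  shows "(\<Prod>l\<in>L. x l) + (\<Sum>l\<in>L. y l * (\<Prod>i\<in>L - {l}. x i)) \<le> (\<Prod>l\<in>L. x l + y l)"
  using assms
proof (induction L rule: finite_induct)
  case (insert k L)
  have *: "(\<Sum>l\<in>L. y l * (\<Prod>i\<in>insert k L - {l}. x i)) = x k * (\<Sum>l\<in>L. y l * (\<Prod>i\<in>L - {l}. x i))"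
    unfolding sum_distrib_left
  proof (rule sum.cong[OF refl])
    fix l assume "l \<in> L"
    then have "insert k L - {l} = insert k (L - {l})" using insert by auto
    then show "y l * (\<Prod>i\<in>insert k L - {l}. x i) = x k * (y l * (\<Prod>i\<in>L - {l}. x i))"
      using insert by simp
  qed
  have "insert k L - {k} = L" using insert by auto
  then have "(\<Prod>l\<in>insert k L. x l) + (\<Sum>l\<in>insert k L. y l * (\<Prod>i\<in>insert k L - {l}. x i))
      = x k * ((\<Prod>l\<in>L. x l) + (\<Sum>l\<in>L. y l * (\<Prod>i\<in>L - {l}. x i))) + y k * (\<Prod>l\<in>L. x l)"
    using insert * by (simp add: algebra_simps)
  also have "\<dots> \<le> x k * (\<Prod>l\<in>L. x l + y l) + y k * (\<Prod>l\<in>L. x l + y l)"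
    using insert by (intro add_mono mult_left_mono prod_mono) auto
  finally show ?case using insert by (simp add: algebra_simps)
qed simp

lemma sum_decrement:
  fixes m :: "'l \<Rightarrow> nat"
  assumes "finite L" "l \<in> L" "m l \<noteq> 0"
  shows "Suc (\<Sum>i\<in>L. (m(l := m l - 1)) i) = (\<Sum>i\<in>L. m i)"
  using assms by (simp add: sum.remove[of L l])

lemma prod_decrement:
  fixes U :: "'l \<Rightarrow> nat \<Rightarrow> real"
  assumes "finite L" "l \<in> L"
  shows "(\<Prod>i\<in>L. U i ((m(l := v)) i)) = U l v * (\<Prod>i\<in>L - {l}. U i (m i))"
  using assms by (subst prod.remove[of L l]) (auto intro!: prod.cong)

text \<open>One step of the domination of the joint law by a product of one-label supersolutions \<open>U l\<close>. The
factor \<open>\<rho>\<close> is paid once per hit, so over all time its cost depends only on the total degree; \<open>\<kappa>\<close>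
is paid in every step and therefore has to be much closer to \<open>1\<close>.\<close>

lemma deg_law_upper_step:
  fixes m :: "'l \<Rightarrow> nat"
  assumes L: "finite L"
    and IH: "\<And>m. deg_law e L a t m \<le> C * \<rho> ^ (\<Sum>l\<in>L. m l) * (\<Prod>l\<in>L. U l (m l))"
    and pos: "\<And>l m. l \<in> L \<Longrightarrow> 0 \<le> U l m" "\<And>l m. l \<in> L \<Longrightarrow> 0 \<le> \<alpha> l m" "\<And>l. l \<in> L \<Longrightarrow> 0 \<le> b l"
      "0 \<le> C" "0 \<le> \<rho>" "0 \<le> \<kappa>"
    and a: "\<And>l. l \<in> L \<Longrightarrow> 0 \<le> a t l" "(\<Sum>l\<in>L. active e (m l) * a t l) \<le> 1"
    and stay: "1 - (\<Sum>l\<in>L. active e (m l) * a t l) \<le> \<kappa> * (\<Prod>l\<in>L. \<alpha> l (m l))"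
    and hit: "\<And>l. l \<in> L \<Longrightarrow> m l \<noteq> 0 \<Longrightarrow> a t l \<le> \<rho> * \<kappa> * b l * (\<Prod>i\<in>L - {l}. \<alpha> i (m i))"
    and super: "\<And>l m. l \<in> L \<Longrightarrow>
      \<alpha> l m * U l m + (if m = 0 then 0 else b l * U l (m - 1)) \<le> V l m"
  shows "deg_law e L a (Suc t) m \<le> (C * \<kappa>) * \<rho> ^ (\<Sum>l\<in>L. m l) * (\<Prod>l\<in>L. V l (m l))"
proof -
  define R where "R = C * \<kappa> * \<rho> ^ (\<Sum>l\<in>L. m l)"
  have R: "0 \<le> R" unfolding R_def using pos by simp
  define x where "x l = \<alpha> l (m l) * U l (m l)" for l
  define y where "y l = (if m l = 0 then 0 else b l * U l (m l - 1))" for l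
  have "(1 - (\<Sum>l\<in>L. active e (m l) * a t l)) * deg_law e L a t m
      \<le> (\<kappa> * (\<Prod>l\<in>L. \<alpha> l (m l))) * (C * \<rho> ^ (\<Sum>l\<in>L. m l) * (\<Prod>l\<in>L. U l (m l)))"
  proof -
    have "(1 - (\<Sum>l\<in>L. active e (m l) * a t l)) * deg_law e L a t m
      \<le> (1 - (\<Sum>l\<in>L. active e (m l) * a t l)) * (C * \<rho> ^ (\<Sum>l\<in>L. m l) * (\<Prod>l\<in>L. U l (m l)))"
      using a by (intro mult_left_mono IH) simp
    also have "\<dots> \<le> (\<kappa> * (\<Prod>l\<in>L. \<alpha> l (m l))) * (C * \<rho> ^ (\<Sum>l\<in>L. m l) * (\<Prod>l\<in>L. U l (m l)))"
      using pos by (intro mult_right_mono stay mult_nonneg_nonneg prod_nonneg) auto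
    finally show ?thesis .
  qed
  also have "\<dots> = R * (\<Prod>l\<in>L. x l)"
    by (simp add: R_def x_def prod.distrib mult_ac)
  finally have 1: "(1 - (\<Sum>l\<in>L. active e (m l) * a t l)) * deg_law e L a t m \<le> R * (\<Prod>l\<in>L. x l)" .
  have 2: "(if m l = 0 then 0 else a t l * deg_law e L a t (m(l := m l - 1)))
      \<le> R * (y l * (\<Prod>i\<in>L - {l}. x i))" if l: "l \<in> L" for l
  proof (cases "m l = 0")
    case True
    then show ?thesis by (simp add: y_def)
  next
    case False
    define N where "N = (\<Sum>i\<in>L. (m(l := m l - 1)) i)"
    have N: "(\<Sum>i\<in>L. m i) = Suc N" using sum_decrement[of L l m, OF L l False] N_def by simp
    have nn: "0 \<le> C * \<rho> ^ N * (U l (m l - 1) * (\<Prod>i\<in>L - {l}. U i (m i)))"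
      using pos l by (intro mult_nonneg_nonneg prod_nonneg zero_le_power) auto
    have "a t l * deg_law e L a t (m(l := m l - 1))
        \<le> a t l * (C * \<rho> ^ N * (U l (m l - 1) * (\<Prod>i\<in>L - {l}. U i (m i))))"
      using IH[of "m(l := m l - 1)"] a(1)[OF l]
      unfolding N_def prod_decrement[OF L l] by (intro mult_left_mono) auto
    also have "\<dots> \<le> (\<rho> * \<kappa> * b l * (\<Prod>i\<in>L - {l}. \<alpha> i (m i)))
        * (C * \<rho> ^ N * (U l (m l - 1) * (\<Prod>i\<in>L - {l}. U i (m i))))"
      by (rule mult_right_mono[OF hit[OF l False] nn])
    also have "\<dots> = R * (y l * (\<Prod>i\<in>L - {l}. x i))"
      using False by (simp add: R_def N y_def x_def prod.distrib mult_ac)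
    finally show ?thesis using False by simp
  qed
  have "deg_law e L a (Suc t) m \<le> R * (\<Prod>l\<in>L. x l) + (\<Sum>l\<in>L. R * (y l * (\<Prod>i\<in>L - {l}. x i)))"
    unfolding deg_law.simps by (intro add_mono 1 sum_mono 2)
  also have "\<dots> = R * ((\<Prod>l\<in>L. x l) + (\<Sum>l\<in>L. y l * (\<Prod>i\<in>L - {l}. x i)))"
    by (simp add: sum_distrib_left algebra_simps)
  also have "\<dots> \<le> R * (\<Prod>l\<in>L. x l + y l)"
    by (intro mult_left_mono[OF _ R] prod_add_ge[OF L]) (use pos in \<open>auto simp: x_def y_def\<close>)
  also have "\<dots> \<le> R * (\<Prod>l\<in>L. V l (m l))"
    by (intro mult_left_mono[OF _ R] prod_mono conjI)
       (use pos super in \<open>auto simp: x_def y_def intro!: add_nonneg_nonneg mult_nonneg_nonneg\<close>)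
  finally show ?thesis by (simp add: R_def)
qed

lemma exp_le_one_minus: fixes d :: real assumes "0 \<le> d" "d \<le> 1/2" shows "exp (- (2 * d)) \<le> 1 - d"
proof -
  have "1 * 1 \<le> (1 + 2 * d) * (1 - d)"
    using assms mult_left_mono[of d "1/2" d] by (simp add: algebra_simps)
  also have "\<dots> \<le> exp (2 * d) * (1 - d)"
    using assms exp_ge_add_one_self[of "2 * d"] by (intro mult_right_mono) auto
  finally show ?thesis by (simp add: exp_minus field_simps)
qed

lemma prod_one_minus_ge:
  fixes b :: "'l \<Rightarrow> real"
  assumes "finite L" "\<And>l. l \<in> L \<Longrightarrow> 0 \<le> b l" "\<And>l. l \<in> L \<Longrightarrow> b l \<le> 1"
  shows "1 - (\<Sum>l\<in>L. b l) \<le> (\<Prod>l\<in>L. 1 - b l)"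
  using assms
proof (induction L rule: finite_induct)
  case (insert k L)
  have p: "(\<Prod>l\<in>L. 1 - b l) \<le> 1" using insert by (intro prod_le_1) auto
  have "1 - (\<Sum>l\<in>L. b l) \<le> (\<Prod>l\<in>L. 1 - b l)" using insert by auto
  moreover have "b k * (\<Prod>l\<in>L. 1 - b l) \<le> b k" using insert p by (intro mult_left_le) auto
  ultimately show ?case using insert by (simp add: algebra_simps)
qed simp

text \<open>Weights and distinct vertices for which, from time \<open>n0\<close> on, the weight sums are within relative
distance \<open>d\<close> of their means. The second condition on \<open>n0\<close> makes the averaged probability that
some label is hit in a given step at most \<open>d\<close>.\<close>

locale chosen_vertices =
  fixes w :: "nat \<Rightarrow> real" and L :: "'l set" and J :: "'l \<Rightarrow> nat" and \<mu> d :: real and n0 n :: nat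
  assumes L: "finite L" "inj_on J L" "J ` L \<subseteq> {1..}"
    and w: "\<And>i. 0 < w i" "\<And>i. w i \<le> 1"
    and mu: "0 < \<mu>" "\<mu> \<le> 1"
    and d: "0 < d" "d \<le> 1/2"
    and n0: "2 \<le> \<mu> * real n0" "real (card L) \<le> d * (\<mu> * real n0)"
    and close: "\<And>t. n0 \<le> t \<Longrightarrow> t < n \<Longrightarrow> \<bar>(\<Sum>i=1..t. w i) - \<mu> * real t\<bar> \<le> d * (\<mu> * real t)"
begin

abbreviation hz :: "nat \<Rightarrow> 'l \<Rightarrow> real" where "hz \<equiv> hazard w J"
abbreviation b :: "nat \<Rightarrow> 'l \<Rightarrow> real" where "b t l \<equiv> rate \<mu> (w (J l)) (J l) t"
abbreviation k :: real where "k \<equiv> real (card L)"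

lemma hz_nonneg: "l \<in> L \<Longrightarrow> 0 \<le> hz t l"
  using L by (intro hazard_nonneg) (auto intro: less_imp_le[OF w(1)])

lemma hz_sum: "(\<Sum>l\<in>L. hz t l) \<le> 1"
  by (rule hazard_sum_le_1[OF _ L]) (auto intro: less_imp_le[OF w(1)])

lemma active_sum_le: "(\<Sum>l\<in>L. active e (m l) * hz t l) \<le> 1"
proof -
  have "(\<Sum>l\<in>L. active e (m l) * hz t l) \<le> (\<Sum>l\<in>L. hz t l)"
    by (rule sum_mono) (auto simp: active_def hz_nonneg)
  then show ?thesis using hz_sum[of t] by linarith
qed

lemma mu_t: assumes "n0 \<le> t" shows "2 \<le> \<mu> * real t" "0 < \<mu> * real t" "\<mu> * real n0 \<le> \<mu> * real t" "k
    / (\<mu> * real t) \<le> d"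
proof -
  show 1: "\<mu> * real n0 \<le> \<mu> * real t" using assms mu by (intro mult_left_mono) auto
  then show 2: "2 \<le> \<mu> * real t" "0 < \<mu> * real t" using n0 by auto
  have "d * (\<mu> * real n0) \<le> d * (\<mu> * real t)" using 1 d by (intro mult_left_mono[OF 1]) simp
  then show "k / (\<mu> * real t) \<le> d" using n0 2 by (simp add: divide_le_eq)
qed

lemma b_bounds:
  assumes "n0 \<le> t" "l \<in> L"
  shows "0 \<le> b t l" "b t l \<le> 1 / (\<mu> * real t)" "b t l \<le> 1/2" "b t l \<le> d"
proof -
  show 0: "0 \<le> b t l" using w(1)[of "J l"] mu by (simp add: rate_def)
  have p: "0 < \<mu> * real t" "2 \<le> \<mu> * real t" using mu_t[OF assms(1)] by auto
  show 1: "b t l \<le> 1 / (\<mu> * real t)" using w(2)[of "J l"] p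
    by (auto simp: rate_def intro!: divide_right_mono)
  have "1 / (\<mu> * real t) \<le> 1/2" using p by (simp add: divide_le_eq)
  with 1 show "b t l \<le> 1/2" by simp
  have "1 \<le> k" using assms(2) L(1) by (cases "card L") auto
  then have "1 / (\<mu> * real t) \<le> k / (\<mu> * real t)" using p by (intro divide_right_mono) auto
  then show "b t l \<le> d" using 1 mu_t(4)[OF assms(1)] by linarith
qed

lemma b_sum: assumes "n0 \<le> t" shows "(\<Sum>l\<in>L. b t l) \<le> k / (\<mu> * real t)" "(\<Sum>l\<in>L. b t l) \<le> d"
proof -
  have "(\<Sum>l\<in>L. b t l) \<le> (\<Sum>l\<in>L. 1 / (\<mu> * real t))"
    using b_bounds(2)[OF assms] by (rule sum_mono)
  then show 1: "(\<Sum>l\<in>L. b t l) \<le> k / (\<mu> * real t)" by simp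
  with mu_t(4)[OF assms] show "(\<Sum>l\<in>L. b t l) \<le> d" by linarith
qed

lemma hz_vs_b:
  assumes "n0 \<le> t" "t < n" "l \<in> L"
  shows "b t l \<le> (1 + d) * hz t l" "(1 - d) * hz t l \<le> b t l"
proof -
  define S where "S = (\<Sum>i=1..t. w i)"
  have p: "0 < \<mu> * real t" using mu_t[OF assms(1)] by auto
  have S: "(1 - d) * (\<mu> * real t) \<le> S" "S \<le> (1 + d) * (\<mu> * real t)"
    using close[OF assms(1,2)] by (auto simp: S_def abs_le_iff algebra_simps)
  have "0 < (1 - d) * (\<mu> * real t)" using p d by (intro mult_pos_pos[of "1 - d"]) simp_all
  then have S0: "0 < S" using S(1) by linarith
  show "b t l \<le> (1 + d) * hz t l"
  proof (cases "J l \<le> t")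
    case True
    have "w (J l) * S \<le> w (J l) * ((1 + d) * (\<mu> * real t))"
      using S(2) less_imp_le[OF w(1)] by (intro mult_left_mono) auto
    moreover have hb: "hz t l = w (J l) / S" "b t l = w (J l) / (\<mu> * real t)"
      using True by (simp_all add: rate_def hazard_def S_def)
    ultimately show ?thesis unfolding hb using S0 p by (simp add: field_simps)
  qed (simp add: rate_def hazard_def)
  show "(1 - d) * hz t l \<le> b t l"
  proof (cases "J l \<le> t")
    case True
    have "w (J l) * ((1 - d) * (\<mu> * real t)) \<le> w (J l) * S"
      using S(1) less_imp_le[OF w(1)] by (intro mult_left_mono) auto
    moreover have hb: "hz t l = w (J l) / S" "b t l = w (J l) / (\<mu> * real t)"
      using True by (simp_all add: rate_def hazard_def S_def)
    ultimately show ?thesis unfolding hb using S0 p by (simp add: field_simps)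
  qed (simp add: rate_def hazard_def)
qed

lemma active_nonneg: "0 \<le> active e i"
  by (simp add: active_def)

lemma active_b:
  assumes "n0 \<le> t" "l \<in> L" shows "0 \<le> active e i * b t l" "active e i * b t l \<le> 1"
  using b_bounds[OF assms] by (auto simp: active_def)

text \<open>The loss is proportional to \<open>d / t\<close> and not to \<open>1 / t\<close>, since \<open>\<Prod> (1 - b)\<close> is at least \<open>1 - \<Sum> b\<close>.
Hence the product of the losses over all steps stays close to \<open>1\<close>.\<close>

lemma stay_upper:
  assumes "n0 \<le> t" "t < n"
  shows "1 - (\<Sum>l\<in>L. active e (m l) * hz t l)
    \<le> (1 + 2 * d * k / (\<mu> * real t)) * (\<Prod>l\<in>L. 1 - active e (m l) * b t l)"
proof -
  define \<sigma> where "\<sigma> = (\<Sum>l\<in>L. active e (m l) * b t l)"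
  have act: "0 \<le> active e i" "active e i \<le> 1" for i by (auto simp: active_def)
  have "\<sigma> \<le> (\<Sum>l\<in>L. b t l)"
    unfolding \<sigma>_def by (rule sum_mono) (use b_bounds[OF assms(1)] in \<open>auto simp: active_def\<close>)
  then have \<sigma>: "\<sigma> \<le> k / (\<mu> * real t)" "\<sigma> \<le> d" using b_sum[OF assms(1)] by auto
  have q: "0 \<le> k / (\<mu> * real t)" using mu_t[OF assms(1)] by auto
  have "(1 - d) * \<sigma> \<le> (\<Sum>l\<in>L. active e (m l) * hz t l)"
    unfolding \<sigma>_def sum_distrib_left
  proof (rule sum_mono)
    fix l assume l: "l \<in> L"
    have "(1 - d) * b t l \<le> (1 - d) * ((1 + d) * hz t l)"
      using hz_vs_b[OF assms l] d by (intro mult_left_mono) auto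
    also have "\<dots> = hz t l - d * d * hz t l" by (simp add: algebra_simps)
    also have "\<dots> \<le> hz t l" using d hz_nonneg[OF l] by simp
    finally show "(1 - d) * (active e (m l) * b t l) \<le> active e (m l) * hz t l"
      by (simp add: active_def)
  qed
  then have "1 - (\<Sum>l\<in>L. active e (m l) * hz t l) \<le> 1 - \<sigma> + d * \<sigma>" by (simp add: algebra_simps)
  also have "\<dots> \<le> 1 - \<sigma> + d * (k / (\<mu> * real t))" using \<sigma> d
      by (intro add_left_mono mult_left_mono) auto
  also have "\<dots> \<le> (1 + 2 * d * k / (\<mu> * real t)) * (1 - \<sigma>)"
  proof -
    have "0 \<le> 2 * d * (k / (\<mu> * real t))" by (rule mult_nonneg_nonneg[OF _ q]) (use d in simp)
    then have "(2 * d * (k / (\<mu> * real t))) * (1/2) \<le> (2 * d * (k / (\<mu> * real t))) * (1 - \<sigma>)"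
      using \<sigma> d by (intro mult_left_mono) simp_all
    then show ?thesis by (simp add: algebra_simps)
  qed
  also have "\<dots> \<le> (1 + 2 * d * k / (\<mu> * real t)) * (\<Prod>l\<in>L. 1 - active e (m l) * b t l)"
  proof (intro mult_left_mono)
    show "1 - \<sigma> \<le> (\<Prod>l\<in>L. 1 - active e (m l) * b t l)"
      unfolding \<sigma>_def by (intro prod_one_minus_ge[OF L(1)] active_b assms(1))
    have "0 \<le> 2 * d * (k / (\<mu> * real t))" by (rule mult_nonneg_nonneg[OF _ q]) (use d in simp)
    then show "0 \<le> 1 + 2 * d * k / (\<mu> * real t)" by simp
  qed
  finally show ?thesis .
qed

lemma hit_upper:
  assumes "n0 \<le> t" "t < n" "l \<in> L"
  shows "hz t l \<le> exp (4 * d) * (1 + 2 * d * k / (\<mu> * real t)) * b t l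
    * (\<Prod>i\<in>L - {l}. 1 - active e (m i) * b t i)"
proof -
  have "1 - (\<Sum>i\<in>L - {l}. active e (m i) * b t i) \<le> (\<Prod>i\<in>L - {l}. 1 - active e (m i) * b t i)"
    using L(1) by (intro prod_one_minus_ge active_b assms(1)) auto
  moreover have "(\<Sum>i\<in>L - {l}. active e (m i) * b t i) \<le> (\<Sum>i\<in>L. b t i)"
  proof -
    have "(\<Sum>i\<in>L - {l}. active e (m i) * b t i) \<le> (\<Sum>i\<in>L - {l}. b t i)"
      by (rule sum_mono) (use b_bounds[OF assms(1)] in \<open>auto simp: active_def\<close>)
    also have "\<dots> \<le> (\<Sum>i\<in>L. b t i)"
      using b_bounds[OF assms(1)] L(1) by (intro sum_mono2) auto
    finally show ?thesis .
  qed
  ultimately have P: "1 - d \<le> (\<Prod>i\<in>L - {l}. 1 - active e (m i) * b t i)"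
    using b_sum(2)[OF assms(1)] by linarith
  have d0: "0 \<le> 1 - d" using d by simp
  have e: "exp (- (2 * d)) \<le> 1 - d" using exp_le_one_minus d by simp
  have k0: "0 \<le> 2 * d * k / (\<mu> * real t)" using d mu_t[OF assms(1)] by simp
  have b0: "0 \<le> b t l" using b_bounds[OF assms(1,3)] by simp
  have h0: "0 \<le> hz t l" using hz_nonneg[OF assms(3)] .
  have "hz t l = exp (4 * d) * (exp (- (2 * d)) * exp (- (2 * d))) * hz t l"
    by (simp add: exp_add[symmetric])
  also have "\<dots> \<le> exp (4 * d) * ((1 - d) * (1 - d)) * hz t l"
    using e h0 d0 by (intro mult_right_mono mult_left_mono mult_mono) auto
  also have "\<dots> = exp (4 * d) * ((1 - d) * ((1 - d) * hz t l))" by simp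
  also have "\<dots> \<le> exp (4 * d) * ((1 - d) * b t l)"
    using hz_vs_b(2)[OF assms] d0 by (intro mult_left_mono) auto
  also have "\<dots> \<le> exp (4 * d) * ((\<Prod>i\<in>L - {l}. 1 - active e (m i) * b t i) * b t l)"
    using P b0 by (intro mult_left_mono mult_right_mono) auto
  also have "\<dots> = exp (4 * d) * 1 * b t l * (\<Prod>i\<in>L - {l}. 1 - active e (m i) * b t i)" by simp
  also have "\<dots> \<le> exp (4 * d) * (1 + 2 * d * k / (\<mu> * real t)) * b t l
    * (\<Prod>i\<in>L - {l}. 1 - active e (m i) * b t i)"
    using P d0 b0 k0 by (intro mult_right_mono mult_left_mono) auto
  finally show ?thesis .
qed

text \<open>Before \<open>n0\<close> the weight sums are not controlled, and only the crude exponential moment with rates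
\<open>xs\<close> is available. Labels that are not yet born have degree \<open>0\<close>.\<close>

lemma early_upper:
  assumes "1 \<le> z" "\<And>t l. l \<in> L \<Longrightarrow> t < n0 \<Longrightarrow> hz t l \<le> xs t" "\<And>t. 0 \<le> xs t" "t \<le> n0"
  shows "deg_law e L hz t m \<le>
    (\<Prod>l\<in>L. if J l < n0 then (\<Prod>s<t. 1 + z * xs s) / z ^ m l else if m l = 0 then 1 else 0)"
proof -
  define U where "U t l i = (if J l < n0 then (\<Prod>s<t. 1 + z * xs s) / z ^ i else if i
      = 0 then 1 else (0::real))"
    for t l i
  have q: "0 \<le> (\<Prod>s<t. 1 + z * xs s)" for t using assms by (intro prod_nonneg) auto
  have "deg_law e L hz t m \<le> 1 * 1 ^ (\<Sum>l\<in>L. m l) * (\<Prod>l\<in>L. U t l (m l))"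
    using assms(4)
  proof (induction t arbitrary: m)
    case 0
    have "deg_law e L hz 0 m = (\<Prod>l\<in>L. if m l = 0 then 1 else 0)"
      using L(1) by (auto intro!: prod.neutral)
    also have "\<dots> \<le> (\<Prod>l\<in>L. U 0 l (m l))"
      using assms by (intro prod_mono) (auto simp: U_def)
    finally show ?case by simp
  next
    case (Suc t)
    have "deg_law e L hz (Suc t) m \<le> (1 * 1) * 1 ^ (\<Sum>l\<in>L. m l) * (\<Prod>l\<in>L. U (Suc t) l (m l))"
    proof (rule deg_law_upper_step[where U = "U t" and \<alpha> = "\<lambda>_ _. 1" and b
        = "\<lambda>l. if J l < n0 then xs t else 0"])
      fix l i assume l: "l \<in> L"
      show "hz t l \<le> 1 * 1 * (if J l < n0 then xs t else 0) * (\<Prod>i\<in>L - {l}. 1)"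
        using assms(2)[OF l, of t] Suc by (auto simp: hazard_def)
      show "1 * U t l i + (if i = 0 then 0 else (if J l < n0 then xs t else 0) * U t l (i - 1))
          \<le> U (Suc t) l i"
      proof (cases "J l < n0 \<and> i \<noteq> 0")
        case True
        then obtain i' where "i = Suc i'" by (cases i) auto
        with True show ?thesis using assms(1) by (simp add: U_def field_simps)
      next
        case False
        have "(\<Prod>s<t. 1 + z * xs s) * 1 \<le> (\<Prod>s<t. 1 + z * xs s) * (1 + z * xs t)"
          using assms q by (intro mult_left_mono) auto
        with False show ?thesis by (auto simp: U_def)
      qed
    qed (use L(1) Suc assms q hz_nonneg in \<open>auto simp: U_def active_sum_le intro!: sum_nonneg
        mult_nonneg_nonneg active_nonneg\<close>)
    then show ?case by simp
  qed
  then show ?thesis by (simp add: U_def)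
qed

theorem deg_law_upper:
  assumes z: "1 \<le> z" and xs: "\<And>t l. l \<in> L \<Longrightarrow> t < n0 \<Longrightarrow> hz t l \<le> xs t" "\<And>t. 0 \<le> xs t"
    and y: "y = (\<Prod>s<n0. 1 + z * xs s)" and t: "n0 \<le> t" "t \<le> n"
  shows "deg_law e L hz t m \<le> (\<Prod>s=n0..<t. 1 + 2 * d * k / (\<mu> * real s))
    * exp (4 * d) ^ (\<Sum>l\<in>L. m l) * (\<Prod>l\<in>L. vertex_mass e \<mu> z y n0 t (J l) (w (J l)) (m l))"
  using t
proof (induction t arbitrary: m rule: dec_induct)
  case base
  have "deg_law e L hz n0 m \<le>
    (\<Prod>l\<in>L. if J l < n0 then (\<Prod>s<n0. 1 + z * xs s) / z ^ m l else if m l = 0 then 1 else 0)"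
    using early_upper[OF z xs] by blast
  also have "\<dots> = (\<Prod>l\<in>L. vertex_mass e \<mu> z y n0 n0 (J l) (w (J l)) (m l))"
    by (intro prod.cong) (auto simp: vertex_mass_def growth_def y lone_law_before)
  also have "\<dots> \<le> exp (4 * d) ^ (\<Sum>l\<in>L. m l) * \<dots>"
  proof -
    have "0 \<le> y" unfolding y using xs z by (intro prod_nonneg) auto
    then have "0 \<le> (\<Prod>l\<in>L. vertex_mass e \<mu> z y n0 n0 (J l) (w (J l)) (m l))"
      using z by (intro prod_nonneg) (auto simp: vertex_mass_def growth_def lone_law_before)
    moreover have "1 \<le> exp (4 * d) ^ (\<Sum>l\<in>L. m l)" using d by (intro one_le_power) auto
    ultimately show ?thesis using mult_right_mono by fastforce
  qed
  finally show ?case by simp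
next
  case (step t)
  let ?C = "\<Prod>s=n0..<t. 1 + 2 * d * k / (\<mu> * real s)"
  have t: "n0 \<le> t" "t < n" using step by auto
  have y0: "0 \<le> y" unfolding y using xs z by (intro prod_nonneg) auto
  have w0: "0 \<le> w i" for i using w(1)[of i] by simp
  have q: "0 \<le> 1 + 2 * d * k / (\<mu> * real s)" if "n0 \<le> s" for s
    using d mu_t[OF that] by simp
  have "deg_law e L hz (Suc t) m \<le> (?C * (1 + 2 * d * k / (\<mu> * real t))) * exp (4 * d) ^ (\<Sum>l\<in>L. m l)
      * (\<Prod>l\<in>L. vertex_mass e \<mu> z y n0 (Suc t) (J l) (w (J l)) (m l))"
  proof (rule deg_law_upper_step[where U = "\<lambda>l. vertex_mass e \<mu> z y n0 t (J l) (w (J l))"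
        and \<alpha> = "\<lambda>l i. 1 - active e i * b t l" and b = "b t"])
    show "deg_law e L hz t m \<le> ?C * exp (4 * d) ^ (\<Sum>l\<in>L. m l)
      * (\<Prod>l\<in>L. vertex_mass e \<mu> z y n0 t (J l) (w (J l)) (m l))" for m
      using step by auto
    show "1 - (\<Sum>l\<in>L. active e (m l) * hz t l)
      \<le> (1 + 2 * d * k / (\<mu> * real t)) * (\<Prod>l\<in>L. 1 - active e (m l) * b t l)"
      by (rule stay_upper[OF t])
    show "(\<Sum>l\<in>L. active e (m l) * hz t l) \<le> 1" by (rule active_sum_le)
    show "0 \<le> ?C" using q by (intro prod_nonneg) auto
    show "0 \<le> 1 + 2 * d * k / (\<mu> * real t)" using q t by auto
    show "finite L" "0 \<le> exp (4 * d)" using L by auto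
  next
    fix l i assume l: "l \<in> L"
    show "hz t l \<le> exp (4 * d) * (1 + 2 * d * k / (\<mu> * real t)) * b t l
      * (\<Prod>i\<in>L - {l}. 1 - active e (m i) * b t i)" by (rule hit_upper[OF t l])
    show "0 \<le> vertex_mass e \<mu> z y n0 t (J l) (w (J l)) i"
    proof (cases "J l < n0")
      case True
      have "0 \<le> y * growth \<mu> z n0 t / z ^ i"
        using y0 growth_pos[OF mu(1) z, of n0 t] z
        by (intro divide_nonneg_nonneg mult_nonneg_nonneg) simp_all
      with True show ?thesis by (simp add: vertex_mass_def)
    next
      case False
      then show ?thesis using rate_bounds[of "w (J l)" \<mu> n0 "J l"] w0 w(2) mu n0
        by (auto simp: vertex_mass_def intro!: lone_law_nonneg)
    qed
    show "0 \<le> 1 - active e i * b t l" using b_bounds[OF t(1) l] by (auto simp: active_def)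
    show "0 \<le> b t l" using b_bounds[OF t(1) l] by simp
    show "0 \<le> hz t l" by (rule hz_nonneg[OF l])
    show "(1 - active e i * b t l) * vertex_mass e \<mu> z y n0 t (J l) (w (J l)) i
      + (if i = 0 then 0 else b t l * vertex_mass e \<mu> z y n0 t (J l) (w (J l)) (i - 1))
      \<le> vertex_mass e \<mu> z y n0 (Suc t) (J l) (w (J l)) i"
    proof (cases "J l < n0")
      case True
      then show ?thesis
        using growth_super[OF mu(1) z t(1) b_bounds(1,2)[OF t(1) l] y0, of e i]
        by (simp add: vertex_mass_def cong: if_cong)
    next
      case False
      then show ?thesis by (simp add: vertex_mass_def)
    qed
  qed
  then show ?case using t by simp
qed

end

section \<open>Comparison with independent vertices from below\<close>

text \<open>Dividing each step by the probability that no label is hit removes the factors for unhit steps: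
\<open>odds_law\<close> is the sum, over disjoint families of time sets of sizes \<open>m l\<close>, of the products of
the odds \<open>x\<close>, and \<open>lone_odds\<close> is an elementary symmetric polynomial.\<close>

primrec odds_law :: "'l set \<Rightarrow> (nat \<Rightarrow> 'l \<Rightarrow> real) \<Rightarrow> nat \<Rightarrow> ('l \<Rightarrow> nat) \<Rightarrow> real"
  where
    "odds_law L x 0 m = (if \<forall>l\<in>L. m l = 0 then 1 else 0)"
  | "odds_law L x (Suc t) m = odds_law L x t m
      + (\<Sum>l\<in>L. if m l = 0 then 0 else x t l * odds_law L x t (m(l := m l - 1)))"

primrec lone_odds :: "(nat \<Rightarrow> real) \<Rightarrow> nat \<Rightarrow> nat \<Rightarrow> real"
  where
    "lone_odds x 0 m = (if m = 0 then 1 else 0)"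
  | "lone_odds x (Suc t) m = lone_odds x t m + (if m = 0 then 0 else x t * lone_odds x t (m - 1))"

definition pred_shift :: "(nat \<Rightarrow> real) \<Rightarrow> nat \<Rightarrow> real"
  where "pred_shift f m = (if m = 0 then 0 else f (m - 1))"

lemma odds_law_nonneg:
  assumes "\<And>t l. l \<in> L \<Longrightarrow> 0 \<le> x t l" shows "0 \<le> odds_law L x t m"
  using assms by (induction t arbitrary: m) (auto intro!: add_nonneg_nonneg sum_nonneg)

lemma lone_odds_nonneg:
  assumes "\<And>t. 0 \<le> x t" shows "0 \<le> lone_odds x t m"
  using assms by (induction t arbitrary: m) (auto intro!: add_nonneg_nonneg)

lemma odds_law_cong:
  assumes "\<And>l. l \<in> L \<Longrightarrow> m l = m' l" shows "odds_law L x t m = odds_law L x t m'"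
  using assms
proof (induction t arbitrary: m m')
  case (Suc t)
  have "odds_law L x t m = odds_law L x t m'" using Suc by blast
  moreover have "(\<Sum>l\<in>L. if m l = 0 then 0 else x t l * odds_law L x t (m(l := m l - 1)))
      = (\<Sum>l\<in>L. if m' l = 0 then 0 else x t l * odds_law L x t (m'(l := m' l - 1)))"
  proof (rule sum.cong[OF refl])
    fix l assume l: "l \<in> L"
    have "odds_law L x t (m(l := m l - 1)) = odds_law L x t (m'(l := m' l - 1))"
      using Suc.prems l by (intro Suc.IH) auto
    then show "(if m l = 0 then 0 else x t l * odds_law L x t (m(l := m l - 1)))
      = (if m' l = 0 then 0 else x t l * odds_law L x t (m'(l := m' l - 1)))"
      using Suc.prems[OF l] by simp
  qed
  ultimately show ?case by simp
qed simp

text \<open>A further label \<open>k\<close> sees all times except those used by the labels in \<open>L\<close>. Deleting one time \<open>s\<close>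
from an elementary symmetric polynomial lowers it by at most \<open>x s k\<close> times the polynomial of one
degree less, and at most \<open>\<Sum> m l\<close> times are deleted. In the induction over time, the term in
which \<open>k\<close> and another label would be hit together is compensated by the drop of \<open>\<Sum> m l\<close> when
that label is hit.\<close>

lemma odds_law_insert:
  assumes L: "finite L" "k \<notin> L" and x: "\<And>t l. l \<in> insert k L \<Longrightarrow> 0 \<le> x t l" and \<eta>: "\<And>t. x t k \<le> \<eta>"
  shows "odds_law L x t m * (lone_odds (\<lambda>t. x t k) t (m k)
      - real (\<Sum>l\<in>L. m l) * \<eta> * pred_shift (lone_odds (\<lambda>t. x t k) t) (m k))
    \<le> odds_law (insert k L) x t m"
proof (induction t arbitrary: m)
  case 0
  show ?case using L by (auto simp: pred_shift_def)
next
  case (Suc t)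
  define e where "e i = lone_odds (\<lambda>t. x t k) t i" for i
  define N where "N = real (\<Sum>l\<in>L. m l)"
  define G where "G = odds_law L x t m"
  define H where "H l = odds_law L x t (m(l := m l - 1))" for l
  define \<xi> where "\<xi> = x t k"
  have e0: "0 \<le> e i" for i unfolding e_def by (rule lone_odds_nonneg) (use x in auto)
  have sh0: "0 \<le> pred_shift f i" if "\<And>i. 0 \<le> f i" for f i using that by (simp add: pred_shift_def)
  have H0: "0 \<le> H l" for l unfolding H_def by (rule odds_law_nonneg) (use x in auto)
  have G0: "0 \<le> G" unfolding G_def by (rule odds_law_nonneg) (use x in auto)
  have \<xi>: "0 \<le> \<xi>" "\<xi> \<le> \<eta>" using x \<eta> by (auto simp: \<xi>_def)
  have N0: "0 \<le> N" unfolding N_def by (rule of_nat_0_le_iff)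
  have e_Suc: "lone_odds (\<lambda>t. x t k) (Suc t) i = e i + \<xi> * pred_shift e i" for i
    by (simp add: e_def \<xi>_def pred_shift_def)
  have sh_Suc: "pred_shift (lone_odds (\<lambda>t. x t k) (Suc t)) i = pred_shift e i + \<xi>
      * pred_shift (pred_shift e) i" for i
  proof -
    have "pred_shift (lone_odds (\<lambda>t. x t k) (Suc t)) i
        = (if i = 0 then 0 else e (i - 1) + \<xi> * pred_shift e (i - 1))"
      unfolding e_Suc[symmetric] by (simp only: pred_shift_def)
    then show ?thesis by (simp add: pred_shift_def)
  qed
  define i where "i = m k"
  have old: "G * (e i - N * \<eta> * pred_shift e i) \<le> odds_law (insert k L) x t m"
    using Suc[of m] by (simp add: G_def e_def[abs_def] N_def i_def)
  have new: "\<xi> * (G * (pred_shift e i - N * \<eta> * pred_shift (pred_shift e) i))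
      \<le> (if m k = 0 then 0 else x t k * odds_law (insert k L) x t (m(k := m k - 1)))"
  proof (cases "m k = 0")
    case True
    then show ?thesis by (simp add: i_def pred_shift_def)
  next
    case False
    \<comment> \<open>Label \<open>k\<close> is not in \<open>L\<close>, so a hit of \<open>k\<close> leaves the degrees counted in \<open>L\<close> unchanged.\<close>
    define m' where "m' = m(k := m k - 1)"
    have "odds_law L x t m' = G" unfolding G_def
      by (rule odds_law_cong) (use L in \<open>auto simp: m'_def\<close>)
    moreover have "(\<Sum>l\<in>L. m' l) = (\<Sum>l\<in>L. m l)"
      by (rule sum.cong) (use L in \<open>auto simp: m'_def\<close>)
    moreover have "m' k = i - 1" by (simp add: m'_def i_def)
    ultimately have "G * (e (i - 1) - N * \<eta> * pred_shift e (i - 1)) \<le> odds_law (insert k L) x t m'"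
      using Suc[of m'] unfolding e_def[abs_def] N_def by simp
    then have "\<xi> * (G * (e (i - 1) - N * \<eta> * pred_shift e (i - 1))) \<le> \<xi>
        * odds_law (insert k L) x t m'"
      using \<xi> by (intro mult_left_mono)
    then show ?thesis using False by (simp add: \<xi>_def i_def pred_shift_def m'_def)
  qed
  have other: "x t l * H l * (e i - (N - 1) * \<eta> * pred_shift e i)
      \<le> x t l * odds_law (insert k L) x t (m(l := m l - 1))" if l: "l \<in> L" "m l \<noteq> 0" for l
  proof -
    define m' where "m' = m(l := m l - 1)"
    have "Suc (\<Sum>j\<in>L. m' j) = (\<Sum>j\<in>L. m j)"
      unfolding m'_def by (rule sum_decrement[of L l m, OF L(1) l])
    then have "real (\<Sum>j\<in>L. m' j) = N - 1" unfolding N_def by linarith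
    moreover have "m' k = i" using l L by (auto simp: i_def m'_def)
    moreover have "H l = odds_law L x t m'" by (simp add: H_def m'_def)
    ultimately have "H l * (e i - (N - 1) * \<eta> * pred_shift e i)
        \<le> odds_law (insert k L) x t (m(l := m l - 1))"
      using Suc[of m'] unfolding e_def[abs_def] m'_def[symmetric] by simp
    then show ?thesis using x[of l t] l by (simp add: mult.assoc mult_left_mono)
  qed
  have gain: "(if m l = 0 then 0 else x t l * H l)
      * ((e i + \<xi> * pred_shift e i) - N * \<eta> * (pred_shift e i + \<xi> * pred_shift (pred_shift e) i))
      \<le> (if m l = 0 then 0 else x t l * odds_law (insert k L) x t (m(l := m l - 1)))" if l: "l
          \<in> L" for l
  proof (cases "m l = 0")
    case False
    \<comment> \<open>A hit of \<open>l\<close> lowers \<open>N\<close> by one; the gain \<open>\<eta> * pred_shift e i\<close> pays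
        for the missing double hit.\<close>
    have "(e i + \<xi> * pred_shift e i) - N * \<eta> * (pred_shift e i + \<xi> * pred_shift (pred_shift e) i)
        \<le> e i - (N - 1) * \<eta> * pred_shift e i"
    proof -
      have "0 \<le> N * \<eta> * (\<xi> * pred_shift (pred_shift e) i)"
        using N0 \<xi> by (intro mult_nonneg_nonneg sh0 e0) auto
      moreover have "\<xi> * pred_shift e i \<le> \<eta> * pred_shift e i"
        using \<xi> by (intro mult_right_mono sh0 e0)
      ultimately show ?thesis by (simp add: algebra_simps)
    qed
    then have "x t l * H l * ((e i + \<xi> * pred_shift e i) - N * \<eta>
        * (pred_shift e i + \<xi> * pred_shift (pred_shift e) i))
        \<le> x t l * H l * (e i - (N - 1) * \<eta> * pred_shift e i)"
      using x[of l t] l H0 by (intro mult_left_mono mult_nonneg_nonneg) auto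
    with other[OF l False] False show ?thesis by simp
  qed simp
  have "odds_law L x (Suc t) m * (lone_odds (\<lambda>t. x t k) (Suc t) (m k)
      - real (\<Sum>l\<in>L. m l) * \<eta> * pred_shift (lone_odds (\<lambda>t. x t k) (Suc t)) (m k))
    = (G + (\<Sum>l\<in>L. if m l = 0 then 0 else x t l * H l))
      * ((e i + \<xi> * pred_shift e i) - N * \<eta> * (pred_shift e i + \<xi> * pred_shift (pred_shift e) i))"
    unfolding e_Suc sh_Suc odds_law.simps G_def H_def N_def i_def by (rule refl)
  also have "\<dots> = G * (e i - N * \<eta> * pred_shift e i) + \<xi>
      * (G * (pred_shift e i - N * \<eta> * pred_shift (pred_shift e) i))
      + (\<Sum>l\<in>L. (if m l = 0 then 0 else x t l * H l)
          * ((e i + \<xi> * pred_shift e i) - N * \<eta>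
          * (pred_shift e i + \<xi> * pred_shift (pred_shift e) i)))"
    unfolding sum_distrib_right[symmetric] by (simp add: algebra_simps)
  also have "\<dots> \<le> odds_law (insert k L) x t m
      + (if m k = 0 then 0 else x t k * odds_law (insert k L) x t (m(k := m k - 1)))
      + (\<Sum>l\<in>L. if m l = 0 then 0 else x t l * odds_law (insert k L) x t (m(l := m l - 1)))"
    by (intro add_mono sum_mono old new gain)
  also have "\<dots> = odds_law (insert k L) x (Suc t) m"
    using L by simp
  finally show ?case .
qed

text \<open>The factors are truncated at \<open>0\<close> because the lower bound for one label may be negative, which
would reverse the inequalities for the others.\<close>

lemma odds_law_ge_prod:
  assumes "finite L" and x: "\<And>t l. l \<in> L \<Longrightarrow> 0 \<le> x t l" and \<eta>: "\<And>t l. l \<in> L \<Longrightarrow> x t l \<le> \<eta> l"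
    and "real (\<Sum>l\<in>L. m l) \<le> N"
  shows "(\<Prod>l\<in>L. max 0 (lone_odds (\<lambda>t. x t l) t (m l) - N * \<eta> l
      * pred_shift (lone_odds (\<lambda>t. x t l) t) (m l)))
    \<le> odds_law L x t m"
  using assms
proof (induction L rule: finite_induct)
  case empty
  then show ?case by (induction t) auto
next
  case (insert k L)
  let ?e = "lone_odds (\<lambda>t. x t k) t"
  have sh0: "0 \<le> pred_shift ?e (m k)"
    unfolding pred_shift_def using lone_odds_nonneg[of "\<lambda>t. x t k" t] insert.prems by auto
  have \<eta>0: "0 \<le> \<eta> k" using insert.prems(1,2)[of k 0] by simp
  have N: "real (\<Sum>l\<in>L. m l) \<le> N" using insert by simp
  have G0: "0 \<le> odds_law L x t m" by (rule odds_law_nonneg) (use insert in auto)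
  have "0 \<le> odds_law (insert k L) x t m" by (rule odds_law_nonneg) (use insert in auto)
  moreover have "odds_law L x t m * (?e (m k) - N * \<eta> k * pred_shift ?e (m k))
      \<le> odds_law (insert k L) x t m"
  proof -
    have "odds_law L x t m * (?e (m k) - N * \<eta> k * pred_shift ?e (m k))
        \<le> odds_law L x t m * (?e (m k) - real (\<Sum>l\<in>L. m l) * \<eta> k * pred_shift ?e (m k))"
      using N G0 \<eta>0 sh0 by (intro mult_left_mono diff_left_mono mult_right_mono) auto
    also have "\<dots> \<le> odds_law (insert k L) x t m"
      using insert by (intro odds_law_insert) auto
    finally show ?thesis .
  qed
  ultimately have "odds_law L x t m * max 0 (?e (m k) - N * \<eta> k * pred_shift ?e (m k))
      \<le> odds_law (insert k L) x t m"
    by (simp add: max_def)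
  moreover have "(\<Prod>l\<in>L. max 0 (lone_odds (\<lambda>t. x t l) t (m l) - N * \<eta> l
      * pred_shift (lone_odds (\<lambda>t. x t l) t) (m l)))
     * max 0 (?e (m k) - N * \<eta> k * pred_shift ?e (m k)) \<le> odds_law L x t m
         * max 0 (?e (m k) - N * \<eta> k * pred_shift ?e (m k))"
    using insert N by (intro mult_right_mono) auto
  ultimately show ?case using insert by (simp add: mult.commute)
qed

lemma lone_law_eq_odds:
  assumes "\<And>s. b s < 1"
  shows "lone_law True b t m = (\<Prod>s<t. 1 - b s) * lone_odds (\<lambda>s. b s / (1 - b s)) t m"
proof (induction t arbitrary: m)
  case (Suc t)
  define r where "r = b t / (1 - b t)"
  define Q where "Q = (\<Prod>s<t. 1 - b s)"
  define E where "E = lone_odds (\<lambda>s. b s / (1 - b s)) t"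
  have r: "(1 - b t) * r = b t" using assms[of t] by (simp add: r_def)
  have "lone_law True b (Suc t) m = (1 - b t) * (Q * E m) + ((1 - b t) * r)
      * (if m = 0 then 0 else Q * E (m - 1))"
    unfolding r by (simp add: Suc Q_def E_def active_def)
  also have "\<dots> = (Q * (1 - b t)) * (E m + (if m = 0 then 0 else r * E (m - 1)))"
    by (simp add: algebra_simps)
  finally show ?case by (simp add: Q_def E_def r_def)
qed simp

lemma deg_law_ge_odds:
  assumes "finite L" and a: "\<And>t l. l \<in> L \<Longrightarrow> 0 \<le> a t l" "\<And>t. (\<Sum>l\<in>L. a t l) \<le> 1"
    and x: "\<And>t l. l \<in> L \<Longrightarrow> 0 \<le> x t l" "\<And>s l. l \<in> L \<Longrightarrow> s < t \<Longrightarrow> \<rho> * x s l \<le> a s l"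
        and \<rho>: "0 \<le> \<rho>" "\<rho> \<le> 1"
  shows "(\<Prod>s<t. 1 - (\<Sum>l\<in>L. a s l)) * \<rho> ^ (\<Sum>l\<in>L. m l) * odds_law L x t m \<le> deg_law True L a t m"
  using x(2)
proof (induction t arbitrary: m)
  case 0
  then show ?case by (auto simp: )
next
  case (Suc t)
  define s where "s = (\<Sum>l\<in>L. a t l)"
  define Q where "Q = (\<Prod>s<t. 1 - (\<Sum>l\<in>L. a s l))"
  have s: "0 \<le> s" "s \<le> 1" using a assms(1) by (auto simp: s_def intro!: sum_nonneg)
  have Q: "0 \<le> Q" unfolding Q_def using a by (intro prod_nonneg) auto
  have IH: "Q * \<rho> ^ (\<Sum>l\<in>L. m l) * odds_law L x t m \<le> deg_law True L a t m" for m
    using Suc by (simp add: Q_def)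
  have hit: "(Q * (1 - s)) * \<rho> ^ (\<Sum>l\<in>L. m l) *
      (if m l = 0 then 0 else x t l * odds_law L x t (m(l := m l - 1)))
      \<le> (if m l = 0 then 0 else a t l * deg_law True L a t (m(l := m l - 1)))" if l: "l \<in> L" for l
  proof (cases "m l = 0")
    case False
    define R where "R = \<rho> ^ (\<Sum>j\<in>L. (m(l := m l - 1)) j) * odds_law L x t (m(l := m l - 1))"
    have R: "0 \<le> R" unfolding R_def using \<rho> by (intro mult_nonneg_nonneg odds_law_nonneg x(1)) auto
    have M: "\<rho> ^ (\<Sum>j\<in>L. m j) = \<rho> * \<rho> ^ (\<Sum>j\<in>L. (m(l := m l - 1)) j)"
      by (subst sum_decrement[of L l m, OF assms(1) l False, symmetric]) simp
    have "(Q * (1 - s)) * \<rho> ^ (\<Sum>j\<in>L. m j) * (x t l * odds_law L x t (m(l := m l - 1)))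
        = (Q * (1 - s)) * (\<rho> * x t l) * R"
      unfolding M R_def by (simp add: mult_ac)
    also have "\<dots> \<le> (Q * 1) * a t l * R"
      using Q s R Suc.prems[OF l, of t] \<rho> x(1)[OF l]
          by (intro mult_mono mult_right_mono mult_left_mono mult_nonneg_nonneg) auto
    also have "\<dots> = a t l * (Q * R)" by simp
    also have "\<dots> \<le> a t l * deg_law True L a t (m(l := m l - 1))"
      using IH[of "m(l := m l - 1)"] a(1)[OF l]
          by (intro mult_left_mono) (simp_all add: R_def mult.assoc)
    finally show ?thesis using False by simp
  qed simp
  have "(\<Prod>s<Suc t. 1 - (\<Sum>l\<in>L. a s l)) * \<rho> ^ (\<Sum>l\<in>L. m l) * odds_law L x (Suc t) m
      = (1 - s) * (Q * \<rho> ^ (\<Sum>l\<in>L. m l) * odds_law L x t m)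
      + (\<Sum>l\<in>L. (Q * (1 - s)) * \<rho> ^ (\<Sum>l\<in>L. m l)
          * (if m l = 0 then 0 else x t l * odds_law L x t (m(l := m l - 1))))"
    unfolding sum_distrib_left[symmetric] by (simp add: Q_def s_def algebra_simps)
  also have "\<dots> \<le> (1 - s) * deg_law True L a t m
      + (\<Sum>l\<in>L. if m l = 0 then 0 else a t l * deg_law True L a t (m(l := m l - 1)))"
    using s by (intro add_mono mult_left_mono IH sum_mono hit) auto
  also have "\<dots> = deg_law True L a (Suc t) m" by (simp add: s_def active_def)
  finally show ?case .
qed

context chosen_vertices
begin

text \<open>Here \<open>\<Prod> (1 - b) \<le> 1 / (1 + \<Sum> b)\<close> bounds the second-order term by \<open>d\<close> times the first-order one.\<close>

lemma stay_lower:
  assumes "n0 \<le> t" "t < n"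
  shows "(1 - 4 * d * k / (\<mu> * real t)) * (\<Prod>l\<in>L. 1 - b t l) \<le> 1 - (\<Sum>l\<in>L. hz t l)"
proof -
  define \<sigma> where "\<sigma> = (\<Sum>l\<in>L. b t l)"
  have \<sigma>: "0 \<le> \<sigma>" "\<sigma> \<le> k / (\<mu> * real t)" "\<sigma> \<le> d"
    using b_sum[OF assms(1)] b_bounds[OF assms(1)] by (auto simp: \<sigma>_def intro!: sum_nonneg)
  have hz: "(\<Sum>l\<in>L. hz t l) \<le> (1 + 2 * d) * \<sigma>"
    unfolding \<sigma>_def sum_distrib_left
  proof (rule sum_mono)
    fix l assume l: "l \<in> L"
    have "1 * hz t l \<le> ((1 + 2 * d) * (1 - d)) * hz t l"
      using d hz_nonneg[OF l] mult_left_mono[of d "1/2" d]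
          by (intro mult_right_mono) (auto simp: algebra_simps)
    also have "\<dots> = (1 + 2 * d) * ((1 - d) * hz t l)" by simp
    also have "\<dots> \<le> (1 + 2 * d) * b t l"
      using hz_vs_b(2)[OF assms l] d by (intro mult_left_mono) auto
    finally show "hz t l \<le> (1 + 2 * d) * b t l" by simp
  qed
  have P: "(\<Prod>l\<in>L. 1 - b t l) \<le> 1 / (1 + \<sigma>)"
  proof -
    have "(\<Prod>l\<in>L. 1 - b t l) \<le> (\<Prod>l\<in>L. exp (- b t l))"
      using b_bounds[OF assms(1)] exp_ge_add_one_self[of "- b t l" for l]
      by (intro prod_mono) (auto simp: algebra_simps intro: order_trans[of _ "1/2"])
    also have "\<dots> = exp (- \<sigma>)" using L(1) by (simp add: \<sigma>_def exp_sum sum_negf[symmetric])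
    also have "\<dots> \<le> 1 / (1 + \<sigma>)" using exp_ge_add_one_self[of \<sigma>] \<sigma>
        by (simp add: exp_minus field_simps)
    finally show ?thesis .
  qed
  have P0: "0 \<le> (\<Prod>l\<in>L. 1 - b t l)"
    using b_bounds(3)[OF assms(1)] by (intro prod_nonneg) (auto intro: order_trans[of _ "1/2"])
  have "(1 - 4 * d * k / (\<mu> * real t)) * (\<Prod>l\<in>L. 1 - b t l) \<le> (1 - 4 * d * \<sigma>) * (\<Prod>l\<in>L. 1 - b t l)"
  proof (rule mult_right_mono[OF _ P0])
    have "4 * d * \<sigma> \<le> 4 * d * (k / (\<mu> * real t))" using \<sigma> d by (intro mult_left_mono) auto
    then show "1 - 4 * d * k / (\<mu> * real t) \<le> 1 - 4 * d * \<sigma>" by simp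
  qed
  also have "\<dots> \<le> (1 - 4 * d * \<sigma>) * (1 / (1 + \<sigma>))"
  proof (rule mult_left_mono[OF P])
    have "d * \<sigma> \<le> (1/2) * (1/2)" using \<sigma> d by (intro mult_mono) auto
    then show "0 \<le> 1 - 4 * d * \<sigma>" by simp
  qed
  also have "\<dots> \<le> 1 - (1 + 2 * d) * \<sigma>"
  proof -
    have "\<sigma> * \<sigma> \<le> d * \<sigma>" using \<sigma> by (intro mult_right_mono) auto
    moreover have "(2 * \<sigma>) * (d * \<sigma>) \<le> 1 * (d * \<sigma>)" using \<sigma> d by (intro mult_right_mono) auto
    ultimately have "1 - 4 * d * \<sigma> \<le> (1 - (1 + 2 * d) * \<sigma>) * (1 + \<sigma>)" by (simp add: algebra_simps)
    then show ?thesis using \<sigma> by (simp add: divide_le_eq)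
  qed
  also have "\<dots> \<le> 1 - (\<Sum>l\<in>L. hz t l)" using hz by simp
  finally show ?thesis .
qed

lemma odds_hit:
  assumes "n0 \<le> t" "t < n" "l \<in> L"
  shows "exp (- (4 * d)) * (b t l / (1 - b t l)) \<le> hz t l"
proof -
  have b: "0 \<le> b t l" "b t l \<le> d" using b_bounds[OF assms(1,3)] by auto
  have e: "exp (- (2 * d)) \<le> 1 - d" using exp_le_one_minus d by simp
  have "exp (- (2 * d)) \<le> 1 / (1 + d)"
  proof -
    have "1 - d \<le> 1 / (1 + d)" using d by (simp add: field_simps)
    with e show ?thesis by linarith
  qed
  then have "exp (- (2 * d)) * exp (- (2 * d)) \<le> (1 - d) * (1 / (1 + d))"
    using e d by (intro mult_mono) auto
  then have ex: "exp (- (4 * d)) \<le> (1 - d) / (1 + d)" by (simp add: exp_add[symmetric])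
  have "exp (- (4 * d)) * (b t l / (1 - b t l)) \<le> (1 - d) / (1 + d) * (b t l / (1 - d))"
    using ex b d by (intro mult_mono divide_left_mono mult_pos_pos divide_nonneg_nonneg) auto
  also have "\<dots> = b t l / (1 + d)" using d by simp
  also have "\<dots> \<le> hz t l" using hz_vs_b(1)[OF assms] d by (simp add: divide_le_eq mult.commute)
  finally show ?thesis .
qed

theorem deg_law_lower:
  assumes late: "\<And>l. l \<in> L \<Longrightarrow> n0 \<le> J l" and t: "n0 \<le> t" "t \<le> n" and N: "real (\<Sum>l\<in>L. m l) \<le> N"
    and small: "\<And>s. n0 \<le> s \<Longrightarrow> s < n \<Longrightarrow> 4 * d * k / (\<mu> * real s) \<le> 1"
  shows "(\<Prod>s=n0..<t. 1 - 4 * d * k / (\<mu> * real s)) * exp (- (4 * d)) ^ (\<Sum>l\<in>L. m l) *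
    (\<Prod>l\<in>L. max 0 (lone_law True (rate \<mu> (w (J l)) (J l)) t (m l)
      - N * (2 * w (J l) / (\<mu> * real n0)) * pred_shift (lone_law True (rate \<mu> (w (J l)) (J l)) t)
          (m l)))
    \<le> deg_law True L hz t m"
proof -
  let ?x = "\<lambda>t l. b t l / (1 - b t l)"
  let ?\<eta> = "\<lambda>l. 2 * w (J l) / (\<mu> * real n0)"
  have b0: "b s l = 0" if "l \<in> L" "s < n0" for s l using late[OF that(1)] that
      by (simp add: rate_def)
  have h0: "hz s l = 0" if "l \<in> L" "s < n0" for s l using late[OF that(1)] that
      by (simp add: hazard_def)
  have bb: "0 \<le> b s l" "b s l \<le> 1/2" if "l \<in> L" for s l
    using b_bounds[of s l] b0[of l s] that by (cases "s < n0"; auto)+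
  have x0: "0 \<le> ?x s l" if "l \<in> L" for s l using bb[OF that, of s] by auto
  have x\<eta>: "?x s l \<le> ?\<eta> l" if l: "l \<in> L" for s l
  proof (cases "J l \<le> s")
    case True
    have s: "n0 \<le> s" using late[OF l] True by simp
    have "?x s l \<le> b s l / (1/2)" using bb[OF l, of s] by (intro divide_left_mono) auto
    also have "\<dots> = 2 * w (J l) / (\<mu> * real s)" using True by (simp add: rate_def)
    also have "\<dots> \<le> ?\<eta> l" using mu_t[OF s] n0 less_imp_le[OF w(1)] by (intro divide_left_mono) auto
    finally show ?thesis .
  next
    case False
    then show ?thesis using less_imp_le[OF w(1)] mu by (simp add: rate_def)
  qed
  have odds: "(\<Prod>l\<in>L. max 0 (lone_odds (\<lambda>t. ?x t l) t (m l) - N * ?\<eta> l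
      * pred_shift (lone_odds (\<lambda>t. ?x t l) t) (m l)))
    \<le> odds_law L ?x t m"
    by (rule odds_law_ge_prod[OF L(1) x0 x\<eta> N])
  define Pl where "Pl l = (\<Prod>s<t. 1 - b s l)" for l
  have Pl0: "0 \<le> Pl l" if "l \<in> L" for l
    unfolding Pl_def using bb(2)[OF that] by (intro prod_nonneg)
        (auto intro: order_trans[of _ "1/2"])
  have lone: "lone_law True (rate \<mu> (w (J l)) (J l)) t i = Pl l * lone_odds (\<lambda>t. ?x t l) t i"
      if l: "l \<in> L" for l i
    unfolding Pl_def by (rule lone_law_eq_odds)
        (use bb(2)[OF l] in \<open>auto intro: le_less_trans[of _ "1/2"]\<close>)
  have "(\<Prod>l\<in>L. max 0 (lone_law True (rate \<mu> (w (J l)) (J l)) t (m l)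
      - N * ?\<eta> l * pred_shift (lone_law True (rate \<mu> (w (J l)) (J l)) t) (m l)))
    = (\<Prod>l\<in>L. Pl l * max 0 (lone_odds (\<lambda>t. ?x t l) t (m l) - N * ?\<eta> l
        * pred_shift (lone_odds (\<lambda>t. ?x t l) t) (m l)))"
  proof (rule prod.cong[OF refl])
    fix l assume l: "l \<in> L"
    have mx: "max 0 (Pl l * u - N * ?\<eta> l * (Pl l * v)) = Pl l * max 0 (u - N * ?\<eta> l * v)" for u v
    proof -
      have "Pl l * u - N * ?\<eta> l * (Pl l * v) = Pl l * (u - N * ?\<eta> l * v)"
        by (simp add: right_diff_distrib)
      then show ?thesis using Pl0[OF l] by (simp only: max_mult_distrib_left) simp
    qed
    moreover have "pred_shift (lone_law True (rate \<mu> (w (J l)) (J l)) t) (m l) = Pl l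
        * pred_shift (lone_odds (\<lambda>t. ?x t l) t) (m l)"
      by (simp add: pred_shift_def lone[OF l])
    ultimately show "max 0 (lone_law True (rate \<mu> (w (J l)) (J l)) t (m l)
      - N * ?\<eta> l * pred_shift (lone_law True (rate \<mu> (w (J l)) (J l)) t) (m l))
      = Pl l * max 0 (lone_odds (\<lambda>t. ?x t l) t (m l) - N * ?\<eta> l
          * pred_shift (lone_odds (\<lambda>t. ?x t l) t) (m l))"
      unfolding lone[OF l] by (simp only: mx)
  qed
  also have "\<dots> \<le> (\<Prod>l\<in>L. Pl l) * odds_law L ?x t m"
    unfolding prod.distrib using odds Pl0 by (intro mult_left_mono prod_nonneg) auto
  finally have 1: "(\<Prod>l\<in>L. max 0 (lone_law True (rate \<mu> (w (J l)) (J l)) t (m l)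
      - N * ?\<eta> l * pred_shift (lone_law True (rate \<mu> (w (J l)) (J l)) t) (m l))) \<le> (\<Prod>l\<in>L. Pl l)
          * odds_law L ?x t m" .
  have 2: "(\<Prod>s=n0..<t. 1 - 4 * d * k / (\<mu> * real s)) * (\<Prod>l\<in>L. Pl l) \<le> (\<Prod>s<t. 1 - (\<Sum>l\<in>L. hz s l))"
  proof -
    have "(\<Prod>l\<in>L. Pl l) = (\<Prod>s<t. \<Prod>l\<in>L. 1 - b s l)" unfolding Pl_def by (rule prod.swap)
    also have "\<dots> = (\<Prod>s=n0..<t. \<Prod>l\<in>L. 1 - b s l)"
      by (rule prod.mono_neutral_right) (use b0 in \<open>auto simp: not_le intro!: prod.neutral\<close>)
    finally have "(\<Prod>s=n0..<t. 1 - 4 * d * k / (\<mu> * real s)) * (\<Prod>l\<in>L. Pl l)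
        = (\<Prod>s=n0..<t. (1 - 4 * d * k / (\<mu> * real s)) * (\<Prod>l\<in>L. 1 - b s l))"
      by (simp add: prod.distrib)
    also have "\<dots> \<le> (\<Prod>s=n0..<t. 1 - (\<Sum>l\<in>L. hz s l))"
    proof (rule prod_mono, rule conjI)
      fix s assume s: "s \<in> {n0..<t}"
      show "(1 - 4 * d * k / (\<mu> * real s)) * (\<Prod>l\<in>L. 1 - b s l) \<le> 1 - (\<Sum>l\<in>L. hz s l)"
        using s t by (intro stay_lower) auto
      show "0 \<le> (1 - 4 * d * k / (\<mu> * real s)) * (\<Prod>l\<in>L. 1 - b s l)"
        using small[of s] s t bb(2) by (intro mult_nonneg_nonneg prod_nonneg)
            (auto intro: order_trans[of _ "1/2"])
    qed
    also have "\<dots> = (\<Prod>s<t. 1 - (\<Sum>l\<in>L. hz s l))"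
      by (rule prod.mono_neutral_left) (use h0 in \<open>auto simp: not_le\<close>)
    finally show ?thesis .
  qed
  have o0: "0 \<le> odds_law L ?x t m" by (rule odds_law_nonneg) (rule x0)
  have q0: "0 \<le> (\<Prod>s=n0..<t. 1 - 4 * d * k / (\<mu> * real s))"
    using small t by (intro prod_nonneg) auto
  have "(\<Prod>s=n0..<t. 1 - 4 * d * k / (\<mu> * real s)) * exp (- (4 * d)) ^ (\<Sum>l\<in>L. m l) *
    (\<Prod>l\<in>L. max 0 (lone_law True (rate \<mu> (w (J l)) (J l)) t (m l)
      - N * ?\<eta> l * pred_shift (lone_law True (rate \<mu> (w (J l)) (J l)) t) (m l)))
    \<le> (\<Prod>s=n0..<t. 1 - 4 * d * k / (\<mu> * real s)) * exp (- (4 * d)) ^ (\<Sum>l\<in>L. m l) *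
      ((\<Prod>l\<in>L. Pl l) * odds_law L ?x t m)"
    using q0 by (intro mult_left_mono 1) auto
  also have "\<dots> = ((\<Prod>s=n0..<t. 1 - 4 * d * k / (\<mu> * real s)) * (\<Prod>l\<in>L. Pl l))
      * (exp (- (4 * d)) ^ (\<Sum>l\<in>L. m l) * odds_law L ?x t m)" by simp
  also have "\<dots> \<le> (\<Prod>s<t. 1 - (\<Sum>l\<in>L. hz s l)) * (exp (- (4 * d)) ^ (\<Sum>l\<in>L. m l) * odds_law L ?x t m)"
    using o0 by (intro mult_right_mono 2) auto
  also have "\<dots> = (\<Prod>s<t. 1 - (\<Sum>l\<in>L. hz s l)) * exp (- (4 * d)) ^ (\<Sum>l\<in>L. m l) * odds_law L ?x t m"
      by simp
  also have "\<dots> \<le> deg_law True L hz t m"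
  proof (rule deg_law_ge_odds[OF L(1)])
    show "exp (- (4 * d)) * ?x s l \<le> hz s l" if "l \<in> L" "s < t" for s l
      using odds_hit[of s l] that t h0[of l s] b0[of l s] by (cases "n0 \<le> s") auto
  qed (use hz_nonneg hz_sum x0 d in auto)
  finally show ?thesis .
qed

end

section \<open>Sums over distinct vertices and averages over the weights\<close>

definition injections :: "'l set \<Rightarrow> nat set \<Rightarrow> ('l \<Rightarrow> nat) set"
  where "injections L A = {f \<in> L \<rightarrow>\<^sub>E A. inj_on f L}"

lemma finite_injections: "finite L \<Longrightarrow> finite A \<Longrightarrow> finite (injections L A)"
  unfolding injections_def by (rule finite_subset[of _ "L \<rightarrow>\<^sub>E A"]) (auto intro: finite_PiE)

lemma sum_injections_le:
  fixes \<phi> :: "'l \<Rightarrow> nat \<Rightarrow> real"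
  assumes "finite L" "finite A" "\<And>l j. l \<in> L \<Longrightarrow> j \<in> A \<Longrightarrow> 0 \<le> \<phi> l j"
  shows "(\<Sum>J\<in>injections L A. \<Prod>l\<in>L. \<phi> l (J l)) \<le> (\<Prod>l\<in>L. \<Sum>j\<in>A. \<phi> l j)"
proof -
  have "(\<Sum>J\<in>injections L A. \<Prod>l\<in>L. \<phi> l (J l)) \<le> (\<Sum>J\<in>L \<rightarrow>\<^sub>E A. \<Prod>l\<in>L. \<phi> l (J l))"
    using assms by (intro sum_mono2) (auto simp: injections_def intro!: finite_PiE prod_nonneg)
  also have "\<dots> = (\<Prod>l\<in>L. \<Sum>j\<in>A. \<phi> l j)"
    using assms by (intro prod_sum_PiE[symmetric]) auto
  finally show ?thesis .
qed

lemma sum_injections_insert: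
  fixes \<phi> :: "'l \<Rightarrow> nat \<Rightarrow> real"
  assumes "finite L" "k \<notin> L" "finite A"
  shows "(\<Sum>J\<in>injections (insert k L) A. \<Prod>l\<in>insert k L. \<phi> l (J l))
    = (\<Sum>J\<in>injections L A. (\<Prod>l\<in>L. \<phi> l (J l)) * (\<Sum>j\<in>A - J ` L. \<phi> k j))"
proof -
  have "(\<Sum>J\<in>injections L A. (\<Prod>l\<in>L. \<phi> l (J l)) * (\<Sum>j\<in>A - J ` L. \<phi> k j))
    = (\<Sum>(J, j)\<in>(SIGMA J:injections L A. A - J ` L). (\<Prod>l\<in>L. \<phi> l (J l)) * \<phi> k j)"
    unfolding sum_distrib_left
    by (rule sum.Sigma) (use assms in \<open>auto simp: finite_injections\<close>)
  also have "\<dots> = (\<Sum>J\<in>injections (insert k L) A. \<Prod>l\<in>insert k L. \<phi> l (J l))"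
  proof (rule sum.reindex_bij_witness[where i = "\<lambda>J. (J(k := undefined), J k)" and j
      = "\<lambda>(J, j). J(k := j)"])
    fix a assume a: "a \<in> (SIGMA J:injections L A. A - J ` L)"
    obtain J j where J: "a = (J, j)" by (cases a)
    have *: "J \<in> L \<rightarrow>\<^sub>E A" "inj_on J L" "j \<in> A" "j \<notin> J ` L" using a J by (auto simp: injections_def)
    have Jk: "J k = undefined" using * assms by (auto simp: PiE_def extensional_def)
    then show "(\<lambda>J. (J(k := undefined), J k)) ((\<lambda>(J, j). J(k := j)) a) = a"
      using J by (auto simp: fun_eq_iff)
    have "J(k := j) \<in> insert k L \<rightarrow>\<^sub>E A" using * by (auto simp: PiE_def Pi_def extensional_def)
    moreover have "inj_on (J(k := j)) (insert k L)"
      using * assms by (auto simp: inj_on_def)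
    ultimately show "(\<lambda>(J, j). J(k := j)) a \<in> injections (insert k L) A"
      using J by (simp add: injections_def)
    have "(\<Prod>l\<in>L. \<phi> l ((J(k := j)) l)) = (\<Prod>l\<in>L. \<phi> l (J l))"
      by (rule prod.cong) (use assms in auto)
    then show "(\<Prod>l\<in>insert k L. \<phi> l (((\<lambda>(J, j). J(k := j)) a) l))
        = (case a of (J, j) \<Rightarrow> (\<Prod>l\<in>L. \<phi> l (J l)) * \<phi> k j)"
      using assms J by simp
  next
    fix J assume J: "J \<in> injections (insert k L) A"
    then have *: "J \<in> insert k L \<rightarrow>\<^sub>E A" "inj_on J (insert k L)" by (auto simp: injections_def)
    show "(\<lambda>(J, j). J(k := j)) (J(k := undefined), J k) = J" by (auto simp: fun_eq_iff)
    have "J(k := undefined) \<in> L \<rightarrow>\<^sub>E A" using * assms by (auto simp: PiE_def extensional_def Pi_def)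
    moreover have "inj_on (J(k := undefined)) L" using * assms by (auto simp: inj_on_def)
    moreover have "(J(k := undefined)) ` L = J ` L" using assms by auto
    moreover have "J k \<in> A" "J k \<notin> J ` L" using * assms by (auto simp: PiE_def Pi_def inj_on_def)
    ultimately show "(J(k := undefined), J k) \<in> (SIGMA J:injections L A. A - J ` L)"
      by (auto simp: injections_def)
  qed
  finally show ?thesis by simp
qed

text \<open>Choosing the vertices one after the other, each choice avoids at most \<open>K\<close> earlier ones and thus
loses at most \<open>K * s l\<close>.\<close>

lemma sum_injections_ge:
  fixes \<phi> :: "'l \<Rightarrow> nat \<Rightarrow> real"
  assumes "finite L" "finite A" and \<phi>: "\<And>l j. l \<in> L \<Longrightarrow> j \<in> A \<Longrightarrow> 0 \<le> \<phi> l j" "\<And>l j. l \<in> L \<Longrightarrow> j \<in> A \<Longrightarrow>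
      \<phi> l j \<le> s l"
    and s: "\<And>l. l \<in> L \<Longrightarrow> 0 \<le> s l" and K: "real (card L) \<le> K"
  shows "(\<Prod>l\<in>L. max 0 ((\<Sum>j\<in>A. \<phi> l j) - K * s l)) \<le> (\<Sum>J\<in>injections L A. \<Prod>l\<in>L. \<phi> l (J l))"
  using assms(1) \<phi> s K
proof (induction L rule: finite_induct)
  case empty
  have "injections ({} :: 'l set) A = {\<lambda>_. undefined}" by (auto simp: injections_def)
  then show ?case by simp
next
  case (insert k L)
  let ?m = "max 0 ((\<Sum>j\<in>A. \<phi> k j) - K * s k)"
  have IH: "(\<Prod>l\<in>L. max 0 ((\<Sum>j\<in>A. \<phi> l j) - K * s l)) \<le> (\<Sum>J\<in>injections L A. \<Prod>l\<in>L. \<phi> l (J l))"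
    using insert by (intro insert.IH) auto
  have rest: "?m \<le> (\<Sum>j\<in>A - J ` L. \<phi> k j)" if J: "J \<in> injections L A" for J
  proof -
    have sub: "J ` L \<subseteq> A" using J by (auto simp: injections_def)
    have "(\<Sum>j\<in>J ` L. \<phi> k j) \<le> real (card (J ` L)) * s k"
      using insert.prems sub by (intro sum_bounded_above) auto
    also have "\<dots> \<le> K * s k"
      using insert.prems card_image_le[OF insert.hyps(1), of J] insert.hyps
      by (intro mult_right_mono) auto
    finally have "(\<Sum>j\<in>A. \<phi> k j) - K * s k \<le> (\<Sum>j\<in>A - J ` L. \<phi> k j)"
      using sub assms(2) by (simp add: sum_diff)
    moreover have "0 \<le> (\<Sum>j\<in>A - J ` L. \<phi> k j)" using insert.prems by (intro sum_nonneg) auto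
    ultimately show ?thesis by simp
  qed
  have pos: "0 \<le> (\<Prod>l\<in>L. \<phi> l (J l))" if "J \<in> injections L A" for J
    using that insert.prems by (intro prod_nonneg) (auto simp: injections_def PiE_def Pi_def)
  have "(\<Prod>l\<in>insert k L. max 0 ((\<Sum>j\<in>A. \<phi> l j) - K * s l)) = (\<Prod>l\<in>L. max 0 ((\<Sum>j\<in>A. \<phi> l j) - K * s l))
      * ?m"
    using insert.hyps by simp
  also have "\<dots> \<le> (\<Sum>J\<in>injections L A. \<Prod>l\<in>L. \<phi> l (J l)) * ?m"
    using IH by (intro mult_right_mono) auto
  also have "\<dots> \<le> (\<Sum>J\<in>injections L A. (\<Prod>l\<in>L. \<phi> l (J l)) * (\<Sum>j\<in>A - J ` L. \<phi> k j))"
    unfolding sum_distrib_right using rest pos by (intro sum_mono mult_left_mono) auto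
  also have "\<dots> = (\<Sum>J\<in>injections (insert k L) A. \<Prod>l\<in>insert k L. \<phi> l (J l))"
    by (rule sum_injections_insert[symmetric]) (use insert assms in auto)
  finally show ?case .
qed

lemma card_injections_le:
  assumes "finite L" "finite A" shows "real (card (injections L A)) \<le> real (card A) ^ card L"
  using sum_injections_le[OF assms, of "\<lambda>_ _. 1"] by simp

lemma card_injections_ge:
  assumes "finite L" "finite A" "card L \<le> card A"
  shows "(real (card A) - real (card L)) ^ card L \<le> real (card (injections L A))"
  using sum_injections_ge[OF assms(1,2), of "\<lambda>_ _. 1" "\<lambda>_. 1" "real (card L)"] assms(3)
  by (simp add: max_def)

lemma lone_law_measurable: "(\<lambda>x. lone_law e (rate \<mu> x j) t m) \<in> borel_measurable borel"
proof (induction t arbitrary: m)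
  case (Suc t)
  have [measurable]: "(\<lambda>x. rate \<mu> x j t) \<in> borel_measurable borel" unfolding rate_def by measurable
  note Suc[measurable]
  show ?case unfolding lone_law.simps by measurable
qed simp

lemma geo_measurable: "(\<lambda>x. geo e \<mu> x m) \<in> borel_measurable borel"
  unfolding geo_def by measurable

context bounded_wrt
begin

lemma W_integrable:
  fixes f :: "real \<Rightarrow> real"
  assumes "f \<in> borel_measurable borel" "\<And>x. 0 < x \<Longrightarrow> x \<le> 1 \<Longrightarrow> \<bar>f x\<bar> \<le> C"
  shows "integrable P (\<lambda>x. f (W x))"
proof (rule weight.integrable_const_bound[where B = C])
  show "AE x in P. norm (f (W x)) \<le> C" using weight_range by eventually_elim (use assms in auto)
  show "(\<lambda>x. f (W x)) \<in> borel_measurable P" using weight_measurable assms(1) by measurable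
qed

lemma W_integral_mono:
  fixes f :: "real \<Rightarrow> real"
  assumes "f \<in> borel_measurable borel" "\<And>x. 0 < x \<Longrightarrow> x \<le> 1 \<Longrightarrow> \<bar>f x\<bar> \<le> C"
    and "g \<in> borel_measurable borel" "\<And>x. 0 < x \<Longrightarrow> x \<le> 1 \<Longrightarrow> \<bar>g x\<bar> \<le> D"
    and "\<And>x. 0 < x \<Longrightarrow> x \<le> 1 \<Longrightarrow> f x \<le> g x"
  shows "(\<integral>x. f (W x) \<partial>P) \<le> (\<integral>x. g (W x) \<partial>P)"
proof (rule integral_mono_AE)
  show "AE x in P. f (W x) \<le> g (W x)" using weight_range by eventually_elim (use assms in auto)
qed (rule W_integrable[OF assms(1,2)] W_integrable[OF assms(3,4)]; assumption)+

lemma W_integral_const_bounds: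
  fixes f :: "real \<Rightarrow> real"
  assumes "f \<in> borel_measurable borel" "\<And>x. 0 < x \<Longrightarrow> x \<le> 1 \<Longrightarrow> a \<le> f x" "\<And>x. 0 < x \<Longrightarrow> x \<le> 1 \<Longrightarrow> f x \<le> c"
  shows "a \<le> (\<integral>x. f (W x) \<partial>P)" "(\<integral>x. f (W x) \<partial>P) \<le> c"
proof -
  have b: "\<bar>f x\<bar> \<le> \<bar>a\<bar> + \<bar>c\<bar>" if "0 < x" "x \<le> 1" for x using assms(2,3)[OF that] by linarith
  show "a \<le> (\<integral>x. f (W x) \<partial>P)"
    using W_integral_mono[of "\<lambda>_. a" "\<bar>a\<bar>" f "\<bar>a\<bar> + \<bar>c\<bar>"] assms b by (simp add: weight.prob_space)
  show "(\<integral>x. f (W x) \<partial>P) \<le> c"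
    using W_integral_mono[of f "\<bar>a\<bar> + \<bar>c\<bar>" "\<lambda>_. c" "\<bar>c\<bar>"] assms b by (simp add: weight.prob_space)
qed

text \<open>From \<open>n0\<close> on the weight sums are close to their means; between \<open>t1\<close> and \<open>n0\<close> they are only
required to grow linearly with some small slope \<open>\<delta>\<close>, which has far higher probability.\<close>

definition good_event :: "real \<Rightarrow> real \<Rightarrow> real \<Rightarrow> nat \<Rightarrow> nat \<Rightarrow> nat \<Rightarrow> 'a set"
  where "good_event \<mu> d \<delta> t1 n0 n = {\<omega> \<in> space M.
    (\<forall>t\<in>{t1..<n0}. \<delta> * real t \<le> (\<Sum>i=1..t. wt i \<omega>)) \<and>
    (\<forall>t\<in>{n0..<n}. \<bar>(\<Sum>i=1..t. wt i \<omega>) - \<mu> * real t\<bar> \<le> d * (\<mu> * real t))}"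

lemma good_event_info: "good_event \<mu> d \<delta> t1 n0 n \<in> sets (info s)"
proof -
  have S: "(\<lambda>\<omega>. \<Sum>i=1..t. wt i \<omega>) \<in> borel_measurable (info s)" for t
    by (intro borel_measurable_sum info_wt) auto
  note S[measurable]
  have "good_event \<mu> d \<delta> t1 n0 n = {\<omega> \<in> space (info s).
    (\<forall>t\<in>{t1..<n0}. \<delta> * real t \<le> (\<Sum>i=1..t. wt i \<omega>)) \<and>
    (\<forall>t\<in>{n0..<n}. \<bar>(\<Sum>i=1..t. wt i \<omega>) - \<mu> * real t\<bar> \<le> d * (\<mu> * real t))}"
    by (simp add: good_event_def)
  also have "\<dots> \<in> sets (info s)" by measurable
  finally show ?thesis .
qed

lemma good_event_M: "good_event \<mu> d \<delta> t1 n0 n \<in> sets M"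
  using good_event_info[of \<mu> d \<delta> t1 n0 n 1] info_subalgebra by (auto simp: subalgebra_def)

abbreviation mean_geo :: "bool \<Rightarrow> real \<Rightarrow> nat \<Rightarrow> real"
  where "mean_geo e \<mu> m \<equiv> \<integral>x. geo e \<mu> (W x) m \<partial>P"

lemma deg_event_M: "finite L \<Longrightarrow> deg_event e L J t m \<in> sets M"
  using deg_event_history[of L e J t m] history_subalgebra by (auto simp: subalgebra_def)

lemma deg_event_good:
  assumes "finite L" "inj_on J L" "J ` L \<subseteq> {1..}" "1 \<le> t"
  shows "prob (deg_event e L J t m \<inter> good_event \<mu> d \<delta> t1 n0 n)
    = (\<integral>\<omega>. indicator (good_event \<mu> d \<delta> t1 n0 n) \<omega> * deg_law e L (path_hazard J \<omega>) t m \<partial>M)"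
proof -
  let ?G = "good_event \<mu> d \<delta> t1 n0 n"
  have "(\<integral>\<omega>. indicator ?G \<omega> * indicator (deg_event e L J t m) \<omega> \<partial>M)
    = (\<integral>\<omega>. indicator ?G \<omega> * deg_law e L (path_hazard J \<omega>) t m \<partial>M)"
    using good_event_info
    by (intro quenched_law[OF assms, where C = 1]) (auto simp: indicator_def)
  moreover have "(\<integral>\<omega>. indicator ?G \<omega> * indicator (deg_event e L J t m) \<omega> \<partial>M)
      = prob (?G \<inter> deg_event e L J t m)"
    using good_event_M deg_event_M[OF assms(1)] by (simp add: indicator_inter_arith[symmetric])
  ultimately show ?thesis by (simp add: Int_commute)
qed

definition admissible :: "real \<Rightarrow> real \<Rightarrow> real \<Rightarrow> nat \<Rightarrow> nat \<Rightarrow> nat \<Rightarrow> bool"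
  where "admissible \<mu> d \<delta> t1 n0 k \<longleftrightarrow> 0 < \<mu> \<and> \<mu> \<le> 1 \<and> 0 < d \<and> d \<le> 1/2 \<and> 0 < \<delta> \<and> 1 \<le> t1
    \<and> 2 \<le> \<mu> * real n0 \<and> real k \<le> d * (\<mu> * real n0)"

lemma admissible_small:
  assumes "admissible \<mu> d \<delta> t1 n0 k" "n0 \<le> s"
  shows "4 * d * real k / (\<mu> * real s) \<le> 1"
proof -
  have a: "0 < \<mu>" "0 < d" "d \<le> 1/2" "2 \<le> \<mu> * real n0" "real k \<le> d * (\<mu> * real n0)"
    using assms(1) by (auto simp: admissible_def)
  have s: "\<mu> * real n0 \<le> \<mu> * real s" using a assms(2) by (intro mult_left_mono) auto
  then have s0: "0 < \<mu> * real s" using a by linarith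
  have "d * (\<mu> * real n0) \<le> d * (\<mu> * real s)" using s a by (intro mult_left_mono) auto
  then have "real k \<le> d * (\<mu> * real s)" using a(5) by linarith
  then have "4 * d * real k \<le> 4 * d * (d * (\<mu> * real s))"
    using a(2) by (intro mult_left_mono) simp_all
  also have "\<dots> = (4 * (d * d)) * (\<mu> * real s)" by simp
  also have "\<dots> \<le> 1 * (\<mu> * real s)"
  proof (rule mult_right_mono)
    have "d * d \<le> (1/2) * (1/2)" using a by (intro mult_mono) auto
    then show "4 * (d * d) \<le> 1" by simp
  qed (use s0 in simp)
  finally show ?thesis using s0 by (simp only: pos_divide_le_eq)
qed

lemma chosen_vertices_good:
  assumes "admissible \<mu> d \<delta> t1 n0 (card L)" "finite L" "inj_on J L" "J ` L \<subseteq> {1..}"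
    and "\<omega> \<in> good_event \<mu> d \<delta> t1 n0 n"
  shows "chosen_vertices (\<lambda>i. wt i \<omega>) L J \<mu> d n0 n"
  using assms wt_pos by unfold_locales (auto simp: admissible_def good_event_def)

definition early_rate :: "real \<Rightarrow> nat \<Rightarrow> nat \<Rightarrow> real"
  where "early_rate \<delta> t1 t = (if t < t1 then 1 else 1 / (\<delta> * real t))"

text \<open>A bound for the exponential moment accumulated before \<open>n0\<close>: hitting probabilities are bounded by
\<open>1\<close> up to time \<open>t1\<close> and by \<open>1 / (\<delta> t)\<close> afterwards.\<close>

definition early_mass :: "real \<Rightarrow> real \<Rightarrow> nat \<Rightarrow> nat \<Rightarrow> real"
  where "early_mass z \<delta> t1 n0 = (\<Prod>s<n0. 1 + z * early_rate \<delta> t1 s)"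

lemma early_rate_bound:
  assumes "admissible \<mu> d \<delta> t1 n0 (card L)" "finite L" "inj_on J L" "J ` L \<subseteq> {1..}"
    and "\<omega> \<in> good_event \<mu> d \<delta> t1 n0 n" "l \<in> L" "t < n0"
  shows "path_hazard J \<omega> t l \<le> early_rate \<delta> t1 t"
proof (cases "t < t1")
  case True
  then show ?thesis using path_hazard_bounds(3)[OF assms(2-4,6)] by (simp add: early_rate_def)
next
  case False
  then have t: "0 < \<delta> * real t" using assms(1) by (simp add: admissible_def)
  have S: "\<delta> * real t \<le> (\<Sum>i=1..t. wt i \<omega>)"
    using assms(5,7) False by (auto simp: good_event_def)
  show ?thesis
  proof (cases "J l \<le> t")
    case True
    have "wt (J l) \<omega> / (\<Sum>i=1..t. wt i \<omega>) \<le> 1 / (\<delta> * real t)"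
      using S t wt_pos by (intro frac_le) auto
    then show ?thesis using True False by (simp add: early_rate_def hazard_def)
  next
    case False
    then show ?thesis using t by (simp add: early_rate_def hazard_def)
  qed
qed

lemma early_rate_nonneg: "0 < \<delta> \<Longrightarrow> 0 \<le> early_rate \<delta> t1 t"
  by (simp add: early_rate_def)

lemma early_mass_ge_1: assumes "0 < \<delta>" "1 \<le> z" shows "1 \<le> early_mass z \<delta> t1 n0"
  unfolding early_mass_def using assms early_rate_nonneg[of \<delta> t1]
  by (intro prod_ge_1) auto

lemma vertex_mass_measurable: "(\<lambda>x. vertex_mass e \<mu> z y n0 t j x m) \<in> borel_measurable borel"
  unfolding vertex_mass_def using lone_law_measurable by simp

lemma vertex_mass_bounds:
  assumes "0 < \<mu>" "2 \<le> \<mu> * real n0" "1 \<le> z" "1 \<le> y" "n0 \<le> t" "0 < x" "x \<le> 1"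
  shows "0 \<le> vertex_mass e \<mu> z y n0 t j x m" "vertex_mass e \<mu> z y n0 t j x m \<le> y * growth \<mu> z n0 t
      / z ^ m"
proof -
  have g: "0 \<le> growth \<mu> z n0 t / z ^ m" using growth_pos[OF assms(1,3), of n0 t] assms by simp
  then have yg: "growth \<mu> z n0 t / z ^ m \<le> y * growth \<mu> z n0 t / z ^ m"
    using mult_right_mono[OF assms(4) g] by simp
  show "0 \<le> vertex_mass e \<mu> z y n0 t j x m"
    using yg g rate_bounds[of x \<mu> n0 j] assms
    by (auto simp: vertex_mass_def intro!: lone_law_nonneg)
  show "vertex_mass e \<mu> z y n0 t j x m \<le> y * growth \<mu> z n0 t / z ^ m"
    using yg lone_law_le_growth[of \<mu> x n0 t j z e m] assms by (auto simp: vertex_mass_def)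
qed

lemma growth_div_le:
  assumes "0 < \<mu>" "1 \<le> z" "0 \<le> y" shows "y * growth \<mu> z n0 t / z ^ m \<le> y * growth \<mu> z n0 t"
proof -
  have "0 \<le> y * growth \<mu> z n0 t" using growth_pos[OF assms(1,2), of n0 t] assms by simp
  moreover have "1 \<le> z ^ m" using assms by simp
  ultimately show ?thesis by (simp add: divide_le_eq mult_left_mono[of 1 "z ^ m", simplified])
qed

text \<open>On the good event the quenched law is dominated by a product in which the factor of each label
depends on the weight of its own vertex alone; the weights being independent, the expectation
factorises.\<close>

lemma deg_event_prob_le:
  assumes adm: "admissible \<mu> d \<delta> t1 n0 (card L)" and J: "finite L" "inj_on J L" "J ` L \<subseteq> {1..}"
    and z: "1 \<le> z" and n: "n0 \<le> n"
  shows "prob (deg_event e L J n m) \<le> (\<Prod>s=n0..<n. 1 + 2 * d * real (card L) / (\<mu> * real s))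
      * exp (4 * d) ^ (\<Sum>l\<in>L. m l)
      * (\<Prod>l\<in>L. \<integral>x. vertex_mass e \<mu> z (early_mass z \<delta> t1 n0) n0 n (J l) (W x) (m l) \<partial>P)
    + prob (space M - good_event \<mu> d \<delta> t1 n0 n)"
proof -
  let ?G = "good_event \<mu> d \<delta> t1 n0 n" and ?y = "early_mass z \<delta> t1 n0"
  let ?C = "(\<Prod>s=n0..<n. 1 + 2 * d * real (card L) / (\<mu> * real s)) * exp (4 * d) ^ (\<Sum>l\<in>L. m l)"
  let ?f = "\<lambda>l x. vertex_mass e \<mu> z ?y n0 n (J l) x (m l)"
  have a: "0 < \<mu>" "0 < d" "0 < \<delta>" "2 \<le> \<mu> * real n0" using adm by (auto simp: admissible_def)
  have n1: "1 \<le> n" using n a by (cases n0) auto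
  have y: "1 \<le> ?y" using early_mass_ge_1[OF a(3) z] .
  have C0: "0 \<le> ?C" using a by (intro mult_nonneg_nonneg prod_nonneg) auto
  have f: "0 \<le> ?f l x" "?f l x \<le> ?y * growth \<mu> z n0 n" if "0 < x" "x \<le> 1" for l x
    using vertex_mass_bounds[OF a(1,4) z y n that, of e "J l" "m l"]
        growth_div_le[OF a(1) z, of ?y n0 n "m l"] y
    by linarith+
  have fw: "0 \<le> ?f l (wt i \<omega>)" "?f l (wt i \<omega>) \<le> ?y * growth \<mu> z n0 n" for l i \<omega>
    using f wt_pos by auto
  have prod_meas: "(\<lambda>\<omega>. \<Prod>l\<in>L. ?f l (wt (J l) \<omega>)) \<in> borel_measurable M"
    using J by (intro borel_measurable_prod measurable_compose[OF wt_measurable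
        vertex_mass_measurable]) auto
  have prod_bd: "0 \<le> (\<Prod>l\<in>L. ?f l (wt (J l) \<omega>))"
    "(\<Prod>l\<in>L. ?f l (wt (J l) \<omega>)) \<le> (\<Prod>l\<in>L. ?y * growth \<mu> z n0 n)" for \<omega>
    by (rule prod_nonneg, use fw in simp) (rule prod_mono, use fw in simp)
  have prod_int: "integrable M (\<lambda>\<omega>. \<Prod>l\<in>L. ?f l (wt (J l) \<omega>))"
    using prod_bd by (intro bounded_integrable[OF prod_meas, where C
        = "\<Prod>l\<in>L. ?y * growth \<mu> z n0 n"]) (simp add: abs_le_iff order_trans[of _ 0])
  have D_bd: "0 \<le> deg_law e L (path_hazard J \<omega>) n m" "deg_law e L (path_hazard J \<omega>) n m \<le> 1" for \<omega>
    using deg_law_bounds[OF J(1), of "path_hazard J \<omega>" e n m] path_hazard_bounds[OF J] by auto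
  have D_meas: "(\<lambda>\<omega>. deg_law e L (path_hazard J \<omega>) n m) \<in> borel_measurable M"
    by (rule measurable_from_subalg[OF info_subalgebra path_law_info[OF J(1,3)]])
  have "prob (deg_event e L J n m \<inter> ?G) \<le> (\<integral>\<omega>. ?C * (\<Prod>l\<in>L. ?f l (wt (J l) \<omega>)) \<partial>M)"
    unfolding deg_event_good[OF J n1]
  proof (rule integral_mono)
    show "integrable M (\<lambda>\<omega>. indicator ?G \<omega> * deg_law e L (path_hazard J \<omega>) n m)"
      using D_bd D_meas good_event_M by (intro bounded_integrable[where C = 1])
          (auto simp: indicator_def)
    show "integrable M (\<lambda>\<omega>. ?C * (\<Prod>l\<in>L. ?f l (wt (J l) \<omega>)))" using prod_int by simp
    fix \<omega>
    show "indicator ?G \<omega> * deg_law e L (path_hazard J \<omega>) n m \<le> ?C * (\<Prod>l\<in>L. ?f l (wt (J l) \<omega>))"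
    proof (cases "\<omega> \<in> ?G")
      case True
      interpret chosen_vertices "\<lambda>i. wt i \<omega>" L J \<mu> d n0 n
        by (rule chosen_vertices_good[OF adm J True])
      have "deg_law e L (path_hazard J \<omega>) n m \<le> ?C * (\<Prod>l\<in>L. ?f l (wt (J l) \<omega>))"
        by (rule deg_law_upper[OF z early_rate_bound[OF adm J True] early_rate_nonneg[OF a(3)] _ n
            order_refl])
           (auto simp: early_mass_def)
      then show ?thesis using True by simp
    next
      case False
      then show ?thesis using C0 prod_bd by simp
    qed
  qed
  also have "\<dots> = ?C * (\<Prod>l\<in>L. \<integral>x. ?f l (W x) \<partial>P)"
  proof -
    have "(\<integral>\<omega>. (\<Prod>l\<in>L. ?f l (wt (J l) \<omega>)) \<partial>M) = (\<Prod>l\<in>L. \<integral>x. ?f l (W x) \<partial>P)"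
      using f by (intro wt_prod_integral[OF J vertex_mass_measurable, where C
          = "?y * growth \<mu> z n0 n"]) (simp add: abs_le_iff order_trans[of _ 0])
    then show ?thesis by simp
  qed
  finally have "prob (deg_event e L J n m \<inter> ?G) \<le> ?C * (\<Prod>l\<in>L. \<integral>x. ?f l (W x) \<partial>P)" .
  moreover have "prob (deg_event e L J n m) \<le> prob (deg_event e L J n m \<inter> ?G) + prob (space M - ?G)"
  proof -
    have "deg_event e L J n m \<subseteq> (deg_event e L J n m \<inter> ?G) \<union> (space M - ?G)"
      by (auto simp: deg_event_def)
    then have "prob (deg_event e L J n m) \<le> prob ((deg_event e L J n m \<inter> ?G) \<union> (space M - ?G))"
      using deg_event_M[OF J(1)] good_event_M by (intro finite_measure_mono) auto
    also have "\<dots> \<le> prob (deg_event e L J n m \<inter> ?G) + prob (space M - ?G)"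
      using deg_event_M[OF J(1)] good_event_M by (intro measure_Un_le) auto
    finally show ?thesis .
  qed
  ultimately show ?thesis by simp
qed

lemma mean_geo_bounds:
  assumes "0 < \<mu>" shows "0 \<le> mean_geo e \<mu> m" "mean_geo e \<mu> m \<le> 1"
proof -
  have g: "0 \<le> geo e \<mu> x m" "geo e \<mu> x m \<le> 1" if "0 < x" "x \<le> 1" for x
    using geo_nonneg[of \<mu> x e m] geo_le_power[of \<mu> x 1 e m] assms that by auto
  show "0 \<le> mean_geo e \<mu> m" "mean_geo e \<mu> m \<le> 1"
    using W_integral_const_bounds[OF geo_measurable, of 0 e \<mu> m 1] g by auto
qed

lemma lone_mean_sum:
  assumes "0 < \<mu>" "\<mu> \<le> 1" "2 \<le> \<mu> * real n0" "n0 \<le> n"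
  shows "(\<Sum>j=n0..n. \<integral>x. lone_law e (rate \<mu> (W x) j) n m \<partial>P) \<le> real n * mean_geo e \<mu> m"
proof -
  have b: "0 \<le> lone_law e (rate \<mu> x j) n m" "lone_law e (rate \<mu> x j) n m \<le> 1"
      if "0 < x" "x \<le> 1" "n0 \<le> j" for x j
    using rate_bounds[of x \<mu> n0 j] lone_law_le_growth[of \<mu> x n0 n j 1 e m] assms that
    by (auto simp: growth_def intro!: lone_law_nonneg)
  have i: "integrable P (\<lambda>x. lone_law e (rate \<mu> (W x) j) n m)" if "j \<in> {n0..n}" for j
    using b[of _ j] that by (intro W_integrable[OF lone_law_measurable, where C = 1]) auto
  have g: "0 \<le> geo e \<mu> x m" "geo e \<mu> x m \<le> 1" if "0 < x" "x \<le> 1" for x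
    using geo_nonneg[of \<mu> x e m] geo_le_power[of \<mu> x 1 e m] assms that by auto
  have "(\<Sum>j=n0..n. \<integral>x. lone_law e (rate \<mu> (W x) j) n m \<partial>P)
      = (\<integral>x. (\<Sum>j=n0..n. lone_law e (rate \<mu> (W x) j) n m) \<partial>P)"
    using i by (intro Bochner_Integration.integral_sum[symmetric])
  also have "\<dots> \<le> (\<integral>x. real n * geo e \<mu> (W x) m \<partial>P)"
  proof (rule W_integral_mono[where f = "\<lambda>x. \<Sum>j=n0..n. lone_law e (rate \<mu> x j) n m"
        and g = "\<lambda>x. real n * geo e \<mu> x m" and C = "\<Sum>j=n0..n. 1" and D = "real n"])
    show "\<bar>\<Sum>j=n0..n. lone_law e (rate \<mu> x j) n m\<bar> \<le> (\<Sum>j=n0..n. 1)" if "0 < x" "x \<le> 1" for x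
      using b[OF that] by (intro order_trans[OF sum_abs] sum_mono)
          (auto simp: abs_le_iff order_trans[of _ 0])
    show "\<bar>real n * geo e \<mu> x m\<bar> \<le> real n" if "0 < x" "x \<le> 1" for x
      using g[OF that] by (auto simp: abs_mult mult_left_le)
    show "(\<Sum>j=n0..n. lone_law e (rate \<mu> x j) n m) \<le> real n * geo e \<mu> x m" if "0 < x" "x \<le> 1" for x
      using assms that by (intro lone_sum_le) auto
  qed (use lone_law_measurable geo_measurable in \<open>auto intro!: borel_measurable_sum
      borel_measurable_times\<close>)
  finally show ?thesis by simp
qed

theorem degree_sum_upper:
  assumes adm: "admissible \<mu> d \<delta> t1 n0 (card L)" and L: "finite L" and z: "1 \<le> z" and n: "n0 \<le> n"
  shows "(\<Sum>J\<in>injections L {1..n}. prob (deg_event e L J n m)) \<le>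
      (\<Prod>s=n0..<n. 1 + 2 * d * real (card L) / (\<mu> * real s)) * exp (4 * d) ^ (\<Sum>l\<in>L. m l)
      * (\<Prod>l\<in>L. real n * mean_geo e \<mu> (m l) + real n0
          * (early_mass z \<delta> t1 n0 * growth \<mu> z n0 n / z ^ m l))
    + real n ^ card L * prob (space M - good_event \<mu> d \<delta> t1 n0 n)"
proof -
  let ?y = "early_mass z \<delta> t1 n0" and ?bad = "prob (space M - good_event \<mu> d \<delta> t1 n0 n)"
  let ?C = "(\<Prod>s=n0..<n. 1 + 2 * d * real (card L) / (\<mu> * real s)) * exp (4 * d) ^ (\<Sum>l\<in>L. m l)"
  let ?\<phi> = "\<lambda>l j. \<integral>x. vertex_mass e \<mu> z ?y n0 n j (W x) (m l) \<partial>P"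
  have a: "0 < \<mu>" "\<mu> \<le> 1" "0 < d" "0 < \<delta>" "2 \<le> \<mu> * real n0" using adm by (auto simp: admissible_def)
  have y: "1 \<le> ?y" using early_mass_ge_1[OF a(4) z] .
  have C0: "0 \<le> ?C" using a by (intro mult_nonneg_nonneg prod_nonneg) auto
  have \<phi>0: "0 \<le> ?\<phi> l j" for l j
    using vertex_mass_bounds[OF a(1,5) z y n]
    by (intro W_integral_const_bounds[OF vertex_mass_measurable]) auto
  have "(\<Sum>J\<in>injections L {1..n}. prob (deg_event e L J n m))
      \<le> (\<Sum>J\<in>injections L {1..n}. ?C * (\<Prod>l\<in>L. ?\<phi> l (J l)) + ?bad)"
    by (intro sum_mono deg_event_prob_le[OF adm L _ _ z n]) (auto simp: injections_def)
  also have "\<dots> = ?C * (\<Sum>J\<in>injections L {1..n}. \<Prod>l\<in>L. ?\<phi> l (J l)) + real (card (injections L {1..n}))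
      * ?bad"
    by (simp add: sum.distrib sum_distrib_left)
  also have "\<dots> \<le> ?C * (\<Prod>l\<in>L. \<Sum>j=1..n. ?\<phi> l j) + real n ^ card L * ?bad"
    using card_injections_le[OF L, of "{1..n}"] C0 \<phi>0 L
    by (intro add_mono mult_left_mono mult_right_mono sum_injections_le) auto
  also have "\<dots> \<le> ?C * (\<Prod>l\<in>L. real n * mean_geo e \<mu> (m l) + real n0
      * (?y * growth \<mu> z n0 n / z ^ m l)) + real n ^ card L * ?bad"
  proof (intro add_right_mono mult_left_mono[OF _ C0] prod_mono conjI)
    fix l
    show "0 \<le> (\<Sum>j=1..n. ?\<phi> l j)" using \<phi>0 by (intro sum_nonneg)
    let ?E = "?y * growth \<mu> z n0 n / z ^ m l"
    have E0: "0 \<le> ?E" using y growth_pos[OF a(1) z, of n0 n] z by simp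
    have n0: "1 \<le> n0" using a by (cases n0) auto
    then have "{1..n} = {1..<n0} \<union> {n0..n}" using n by auto
    then have "(\<Sum>j=1..n. ?\<phi> l j) = (\<Sum>j=1..<n0. ?\<phi> l j) + (\<Sum>j=n0..n. ?\<phi> l j)"
      by (simp add: sum.union_disjoint ivl_disj_int)
    also have "(\<Sum>j=1..<n0. ?\<phi> l j) \<le> (\<Sum>j=1..<n0. ?E)"
      by (intro sum_mono) (simp add: vertex_mass_def weight.prob_space)
    also have "(\<Sum>j=1..<n0. ?E) = (real n0 - 1) * ?E" using n0 by (simp add: of_nat_diff)
    also have "\<dots> \<le> real n0 * ?E" by (rule mult_right_mono[OF _ E0]) simp
    also have "(\<Sum>j=n0..n. ?\<phi> l j) = (\<Sum>j=n0..n. \<integral>x. lone_law e (rate \<mu> (W x) j) n (m l) \<partial>P)"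
      by (intro sum.cong) (auto simp: vertex_mass_def)
    also have "\<dots> \<le> real n * mean_geo e \<mu> (m l)" by (rule lone_mean_sum[OF a(1,2,5) n])
    finally show "(\<Sum>j=1..n. ?\<phi> l j) \<le> real n * mean_geo e \<mu> (m l) + real n0 * ?E" by simp
  qed
  finally show ?thesis .
qed

text \<open>Lower bound for a vertex born after \<open>n0\<close>, including the correction for the times at which other
labels are hit; \<open>N\<close> bounds the total degree.\<close>

definition late_mass :: "real \<Rightarrow> nat \<Rightarrow> real \<Rightarrow> nat \<Rightarrow> nat \<Rightarrow> nat \<Rightarrow> real \<Rightarrow> real"
  where "late_mass \<mu> n0 N t j m x = max 0 (lone_law True (rate \<mu> x j) t m
    - N * (2 * x / (\<mu> * real n0)) * pred_shift (lone_law True (rate \<mu> x j) t) m)"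

lemma pred_shift_lone_measurable: "(\<lambda>x. pred_shift (lone_law e (rate \<mu> x j) t) m)
    \<in> borel_measurable borel"
  using lone_law_measurable[of e \<mu> j t "m - 1"] by (cases "m = 0") (auto simp: pred_shift_def)

lemma late_mass_measurable: "late_mass \<mu> n0 N t j m \<in> borel_measurable borel"
proof -
  note pred_shift_lone_measurable[measurable] lone_law_measurable[measurable]
  show ?thesis unfolding late_mass_def by measurable
qed

lemma late_mass_bounds:
  assumes "0 < \<mu>" "2 \<le> \<mu> * real n0" "1 \<le> z" "n0 \<le> t" "0 < x" "x \<le> 1" "0 \<le> N" "n0 \<le> j"
  shows "0 \<le> late_mass \<mu> n0 N t j m x" "late_mass \<mu> n0 N t j m x \<le> growth \<mu> z n0 t / z ^ m"
    "late_mass \<mu> n0 N t j m x \<le> 1"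
proof -
  have lone: "0 \<le> lone_law True (rate \<mu> x j) t i" for i
    using rate_bounds[of x \<mu> n0 j] assms by (intro lone_law_nonneg) auto
  have "0 \<le> N * (2 * x / (\<mu> * real n0)) * pred_shift (lone_law True (rate \<mu> x j) t) m"
    using assms lone by (intro mult_nonneg_nonneg) (auto simp: pred_shift_def)
  then have le: "late_mass \<mu> n0 N t j m x \<le> lone_law True (rate \<mu> x j) t m"
    using lone[of m] by (simp add: late_mass_def)
  show "0 \<le> late_mass \<mu> n0 N t j m x" by (simp add: late_mass_def)
  show "late_mass \<mu> n0 N t j m x \<le> growth \<mu> z n0 t / z ^ m"
    using le lone_law_le_growth[of \<mu> x n0 t j z True m] assms by auto
  show "late_mass \<mu> n0 N t j m x \<le> 1"
    using le lone_law_le_growth[of \<mu> x n0 t j 1 True m] assms by (auto simp: growth_def)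
qed

lemma deg_event_prob_ge:
  assumes adm: "admissible \<mu> d \<delta> t1 n0 (card L)"
      and J: "finite L" "inj_on J L" "\<And>l. l \<in> L \<Longrightarrow> n0 \<le> J l"
    and n: "n0 \<le> n" and N: "real (\<Sum>l\<in>L. m l) \<le> N"
  shows "(\<Prod>s=n0..<n. 1 - 4 * d * real (card L) / (\<mu> * real s)) * exp (- (4 * d)) ^ (\<Sum>l\<in>L. m l)
      * ((\<Prod>l\<in>L. \<integral>x. late_mass \<mu> n0 N n (J l) (m l) (W x) \<partial>P)
         - prob (space M - good_event \<mu> d \<delta> t1 n0 n))
    \<le> prob (deg_event True L J n m)"
proof -
  let ?G = "good_event \<mu> d \<delta> t1 n0 n"
  let ?C = "(\<Prod>s=n0..<n. 1 - 4 * d * real (card L) / (\<mu> * real s)) * exp (- (4 * d)) ^ (\<Sum>l\<in>L. m l)"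
  let ?f = "\<lambda>l. late_mass \<mu> n0 N n (J l) (m l)"
  have a: "0 < \<mu>" "0 < d" "d \<le> 1/2" "0 < \<delta>" "2 \<le> \<mu> * real n0" "real (card L) \<le> d * (\<mu> * real n0)"
    using adm by (auto simp: admissible_def)
  have n0: "1 \<le> n0" using a by (cases n0) auto
  have n1: "1 \<le> n" using n n0 by simp
  have J1: "J ` L \<subseteq> {1..}" using J(3) n0 by force
  have N0: "0 \<le> N" using N by (meson of_nat_0_le_iff order_trans)
  note small = admissible_small[OF adm]
  have C0: "0 \<le> ?C" using small by (intro mult_nonneg_nonneg prod_nonneg) auto
  have f: "0 \<le> ?f l x" "?f l x \<le> 1" if "0 < x" "x \<le> 1" "l \<in> L" for l x
    using late_mass_bounds[OF a(1,5) order_refl n that(1,2) N0 J(3)[OF that(3)]] by auto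
  have fw: "0 \<le> ?f l (wt i \<omega>)" "?f l (wt i \<omega>) \<le> 1" if "l \<in> L" for l i \<omega>
    using f wt_pos that by auto
  have prod_meas: "(\<lambda>\<omega>. \<Prod>l\<in>L. ?f l (wt (J l) \<omega>)) \<in> borel_measurable M"
    using J1 by (intro borel_measurable_prod measurable_compose[OF wt_measurable
        late_mass_measurable]) auto
  have prod_bd: "0 \<le> (\<Prod>l\<in>L. ?f l (wt (J l) \<omega>))" "(\<Prod>l\<in>L. ?f l (wt (J l) \<omega>)) \<le> 1" for \<omega>
    by (rule prod_nonneg, use fw in simp) (rule prod_le_1, use fw in simp)
  have prod_int: "integrable M (\<lambda>\<omega>. \<Prod>l\<in>L. ?f l (wt (J l) \<omega>))"
    using prod_bd by (intro bounded_integrable[OF prod_meas, where C = 1])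
        (simp add: abs_le_iff order_trans[of _ 0])
  have D_bd: "0 \<le> deg_law True L (path_hazard J \<omega>) n m" "deg_law True L (path_hazard J \<omega>) n m \<le> 1"
      for \<omega>
    using deg_law_bounds[OF J(1), of "path_hazard J \<omega>" True n m] path_hazard_bounds[OF J(1,2) J1]
        by auto
  have D_meas: "(\<lambda>\<omega>. deg_law True L (path_hazard J \<omega>) n m) \<in> borel_measurable M"
    by (rule measurable_from_subalg[OF info_subalgebra path_law_info[OF J(1) J1]])
  have "?C * ((\<Prod>l\<in>L. \<integral>x. ?f l (W x) \<partial>P) - prob (space M - ?G))
      = (\<integral>\<omega>. ?C * ((\<Prod>l\<in>L. ?f l (wt (J l) \<omega>)) - indicator (space M - ?G) \<omega>) \<partial>M)"
  proof -
    have "(\<integral>\<omega>. (\<Prod>l\<in>L. ?f l (wt (J l) \<omega>)) \<partial>M) = (\<Prod>l\<in>L. \<integral>x. ?f l (W x) \<partial>P)"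
      using f by (intro wt_prod_integral[OF J(1,2) J1 late_mass_measurable, where C = 1])
          (simp add: abs_le_iff order_trans[of _ 0])
    moreover have "integrable M (indicator (space M - ?G) :: 'a \<Rightarrow> real)"
      using good_event_M by (intro bounded_integrable[where C = 1]) (auto simp: indicator_def)
    ultimately show ?thesis using prod_int good_event_M by simp
  qed
  also have "\<dots> \<le> (\<integral>\<omega>. indicator ?G \<omega> * deg_law True L (path_hazard J \<omega>) n m \<partial>M)"
  proof (rule integral_mono_AE)
    show "integrable M (\<lambda>\<omega>. indicator ?G \<omega> * deg_law True L (path_hazard J \<omega>) n m)"
      using D_bd D_meas good_event_M by (intro bounded_integrable[where C = 1])
          (auto simp: indicator_def)
    show "integrable M (\<lambda>\<omega>. ?C * ((\<Prod>l\<in>L. ?f l (wt (J l) \<omega>)) - indicator (space M - ?G) \<omega>))"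
    proof (intro integrable_mult_right Bochner_Integration.integrable_diff prod_int)
      show "integrable M (indicator (space M - ?G) :: 'a \<Rightarrow> real)"
        using good_event_M by (intro bounded_integrable[where C = 1]) (auto simp: indicator_def)
    qed
    show "AE \<omega> in M. ?C * ((\<Prod>l\<in>L. ?f l (wt (J l) \<omega>)) - indicator (space M - ?G) \<omega>)
        \<le> indicator ?G \<omega> * deg_law True L (path_hazard J \<omega>) n m"
    proof (rule AE_I2)
      fix \<omega> assume \<omega>: "\<omega> \<in> space M"
      show "?C * ((\<Prod>l\<in>L. ?f l (wt (J l) \<omega>)) - indicator (space M - ?G) \<omega>)
        \<le> indicator ?G \<omega> * deg_law True L (path_hazard J \<omega>) n m"
      proof (cases "\<omega> \<in> ?G")
        case True
        interpret chosen_vertices "\<lambda>i. wt i \<omega>" L J \<mu> d n0 n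
          by (rule chosen_vertices_good[OF adm J(1,2) J1 True])
        have "?C * (\<Prod>l\<in>L. ?f l (wt (J l) \<omega>)) \<le> deg_law True L (path_hazard J \<omega>) n m"
          using deg_law_lower[OF J(3) n order_refl N small] by (simp add: late_mass_def)
        then show ?thesis using True by simp
      next
        case False
        then show ?thesis using C0 prod_bd(2)[of \<omega>] \<omega> by (simp add: mult_nonneg_nonpos)
      qed
    qed
  qed
  also have "\<dots> = prob (deg_event True L J n m \<inter> ?G)"
      by (rule deg_event_good[OF J(1,2) J1 n1, symmetric])
  also have "\<dots> \<le> prob (deg_event True L J n m)"
    using deg_event_M[OF J(1)] by (intro finite_measure_mono) auto
  finally show ?thesis .
qed

text \<open>The correction contains the degree \<open>m - 1\<close> together with a factor \<open>x\<close>. Since \<open>x\<close> times the limit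
at \<open>m - 1\<close> is \<open>\<mu> + x\<close> times the limit at \<open>m\<close>, it is small relative to the main term even for
weights near \<open>0\<close>.\<close>

lemma late_mean_sum:
  assumes a: "0 < \<mu>" "\<mu> \<le> 1" "2 \<le> \<mu> * real n0" "n0 \<le> n" and z: "1 \<le> z" "z \<le> 1 + \<mu>" and N: "0 \<le> N"
  shows "real n * mean_geo True \<mu> m * (1 - 4 * N / (\<mu> * real n0)) - real n0
      * (growth \<mu> z n0 n / z ^ m)
    \<le> (\<Sum>j=n0..n. \<integral>x. late_mass \<mu> n0 N n j m (W x) \<partial>P)"
proof -
  let ?E = "real n0 * (growth \<mu> z n0 n / z ^ m)" and ?q = "1 - 4 * N / (\<mu> * real n0)"
  have bd: "0 \<le> late_mass \<mu> n0 N n j m x" "late_mass \<mu> n0 N n j m x \<le> 1"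
      if "0 < x" "x \<le> 1" "j \<in> {n0..n}" for x j
    using late_mass_bounds[OF a(1,3) order_refl a(4) that(1,2) N] that(3) by auto
  have int: "integrable P (\<lambda>x. late_mass \<mu> n0 N n j m (W x))" if "j \<in> {n0..n}" for j
    using bd[OF _ _ that] by (intro W_integrable[OF late_mass_measurable, where C = 1]) auto
  have g: "0 \<le> geo True \<mu> x m" "geo True \<mu> x m \<le> 1" if "0 < x" "x \<le> 1" for x
    using geo_nonneg[of \<mu> x True m] geo_le_power[of \<mu> x 1 True m] a that by auto
  have E0: "0 \<le> ?E" using growth_pos[OF a(1) z(1), of n0 n] z by simp
  have gint: "integrable P (\<lambda>x. geo True \<mu> (W x) m)"
    using g by (intro W_integrable[OF geo_measurable, where C = 1]) auto
  have "real n * mean_geo True \<mu> m * ?q - ?E = (\<integral>x. real n * geo True \<mu> (W x) m * ?q - ?E \<partial>P)"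
    using gint by (simp add: weight.prob_space)
  also have "\<dots> \<le> (\<integral>x. (\<Sum>j=n0..n. late_mass \<mu> n0 N n j m (W x)) \<partial>P)"
  proof (rule W_integral_mono[where f = "\<lambda>x. real n * geo True \<mu> x m * ?q - ?E" and C
      = "real n * \<bar>?q\<bar> + ?E"
        and g = "\<lambda>x. \<Sum>j=n0..n. late_mass \<mu> n0 N n j m x" and D = "\<Sum>j=n0..n. 1"])
    show "(\<lambda>x. real n * geo True \<mu> x m * ?q - ?E) \<in> borel_measurable borel"
      using geo_measurable[of True \<mu> m] by measurable
    show "(\<lambda>x. \<Sum>j=n0..n. late_mass \<mu> n0 N n j m x) \<in> borel_measurable borel"
      by (intro borel_measurable_sum late_mass_measurable)
    fix x :: real assume x: "0 < x" "x \<le> 1"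
    show "\<bar>real n * geo True \<mu> x m * ?q - ?E\<bar> \<le> real n * \<bar>?q\<bar> + ?E"
    proof -
      have "\<bar>real n * geo True \<mu> x m * ?q\<bar> \<le> real n * 1 * \<bar>?q\<bar>"
        unfolding abs_mult using g[OF x] by (intro mult_mono) auto
      then show ?thesis using E0 by linarith
    qed
    show "\<bar>\<Sum>j=n0..n. late_mass \<mu> n0 N n j m x\<bar> \<le> (\<Sum>j=n0..n. 1)"
      using bd[OF x] by (intro order_trans[OF sum_abs] sum_mono)
          (auto simp: abs_le_iff order_trans[of _ 0])
    define H where "H i = (\<Sum>j=n0..n. lone_law True (rate \<mu> x j) n i)" for i
    have H: "real n * geo True \<mu> x m - ?E \<le> H m"
      using lone_sum_ge[of \<mu> x n0 n z m] a z x by (simp add: H_def)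
    have shH: "x * pred_shift H m \<le> real n * (2 * geo True \<mu> x m)"
    proof (cases m)
      case 0
      then show ?thesis using g[OF x] by (simp add: pred_shift_def)
    next
      case (Suc i)
      have "x * H i \<le> x * (real n * geo True \<mu> x i)"
        using lone_sum_le[of \<mu> x n0 n True i] a x by (intro mult_left_mono) (auto simp: H_def)
      also have "\<dots> = real n * ((\<mu> + x) * geo True \<mu> x m)"
        using Suc a x by (simp add: geo_def)
      also have "\<dots> \<le> real n * (2 * geo True \<mu> x m)"
        using g[OF x] a x by (intro mult_left_mono mult_right_mono) auto
      finally show ?thesis using Suc by (simp add: pred_shift_def)
    qed
    have "real n * geo True \<mu> x m * ?q - ?E
        = (real n * geo True \<mu> x m - ?E) - N * 2 / (\<mu> * real n0) * (real n * (2 * geo True \<mu> x m))"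
      by (simp add: algebra_simps)
    also have "\<dots> \<le> H m - N * 2 / (\<mu> * real n0) * (x * pred_shift H m)"
      using H shH N a by (intro diff_mono mult_left_mono) auto
    also have "\<dots> = (\<Sum>j=n0..n. lone_law True (rate \<mu> x j) n m
        - N * (2 * x / (\<mu> * real n0)) * pred_shift (lone_law True (rate \<mu> x j) n) m)"
    proof -
      have "pred_shift H m = (\<Sum>j=n0..n. pred_shift (lone_law True (rate \<mu> x j) n) m)"
        by (simp add: pred_shift_def H_def)
      then show ?thesis by (simp add: H_def sum_subtractf sum_distrib_left mult_ac)
    qed
    also have "\<dots> \<le> (\<Sum>j=n0..n. late_mass \<mu> n0 N n j m x)"
      by (intro sum_mono) (simp add: late_mass_def)
    finally show "real n * geo True \<mu> x m * ?q - ?E \<le> (\<Sum>j=n0..n. late_mass \<mu> n0 N n j m x)" .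
  qed
  also have "\<dots> = (\<Sum>j=n0..n. \<integral>x. late_mass \<mu> n0 N n j m (W x) \<partial>P)"
    using int by (intro Bochner_Integration.integral_sum)
  finally show ?thesis .
qed

theorem degree_sum_lower:
  assumes adm: "admissible \<mu> d \<delta> t1 n0 (card L)" and L: "finite L" and z: "1 \<le> z" "z \<le> 1 + \<mu>"
    and n: "n0 \<le> n" and N: "real (\<Sum>l\<in>L. m l) \<le> N"
  shows "(\<Prod>s=n0..<n. 1 - 4 * d * real (card L) / (\<mu> * real s)) * exp (- (4 * d)) ^ (\<Sum>l\<in>L. m l)
      * ((\<Prod>l\<in>L. max 0 (real n * mean_geo True \<mu> (m l) * (1 - 4 * N / (\<mu> * real n0))
             - (real n0 + real (card L)) * (growth \<mu> z n0 n / z ^ m l)))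
         - real n ^ card L * prob (space M - good_event \<mu> d \<delta> t1 n0 n))
    \<le> (\<Sum>J\<in>injections L {1..n}. prob (deg_event True L J n m))"
proof -
  let ?bad = "prob (space M - good_event \<mu> d \<delta> t1 n0 n)"
  let ?C = "(\<Prod>s=n0..<n. 1 - 4 * d * real (card L) / (\<mu> * real s)) * exp (- (4 * d)) ^ (\<Sum>l\<in>L. m l)"
  let ?\<phi> = "\<lambda>l j. \<integral>x. late_mass \<mu> n0 N n j (m l) (W x) \<partial>P"
  let ?s = "\<lambda>l. growth \<mu> z n0 n / z ^ m l"
  have a: "0 < \<mu>" "\<mu> \<le> 1" "0 < d" "d \<le> 1/2" "0 < \<delta>" "2 \<le> \<mu> * real n0" "real (card L) \<le> d
      * (\<mu> * real n0)"
    using adm by (auto simp: admissible_def)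
  have n0: "1 \<le> n0" using a by (cases n0) auto
  have N0: "0 \<le> N" using N by (meson of_nat_0_le_iff order_trans)
  have s0: "0 \<le> ?s l" for l using growth_pos[OF a(1) z(1), of n0 n] z by simp
  have C0: "0 \<le> ?C"
    using admissible_small[OF adm] by (intro mult_nonneg_nonneg prod_nonneg) auto
  have \<phi>: "0 \<le> ?\<phi> l j" "?\<phi> l j \<le> ?s l" if "j \<in> {n0..n}" for l j
    using late_mass_bounds[OF a(1,6) z(1) n _ _ N0, of _ j "m l"] that
    by (auto intro!: W_integral_const_bounds[OF late_mass_measurable])
  have sub: "injections L {n0..n} \<subseteq> injections L {1..n}"
    using n0 by (auto simp: injections_def PiE_def Pi_def)
  have "?C * ((\<Prod>l\<in>L. max 0 (real n * mean_geo True \<mu> (m l) * (1 - 4 * N / (\<mu> * real n0))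
             - (real n0 + real (card L)) * ?s l)) - real n ^ card L * ?bad)
      \<le> ?C * ((\<Prod>l\<in>L. max 0 ((\<Sum>j=n0..n. ?\<phi> l j) - real (card L) * ?s l)) - real n ^ card L * ?bad)"
  proof (intro mult_left_mono[OF _ C0] diff_right_mono prod_mono conjI max.mono order_refl)
    fix l
    show "real n * mean_geo True \<mu> (m l) * (1 - 4 * N / (\<mu> * real n0)) - (real n0 + real (card L))
        * ?s l
        \<le> (\<Sum>j=n0..n. ?\<phi> l j) - real (card L) * ?s l"
      using late_mean_sum[OF a(1,2,6) n z N0, of "m l"] unfolding distrib_right by linarith
  qed simp
  also have "\<dots> \<le> ?C * ((\<Sum>J\<in>injections L {n0..n}. \<Prod>l\<in>L. ?\<phi> l (J l))
      - real (card (injections L {n0..n})) * ?bad)"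
  proof (intro mult_left_mono[OF _ C0] diff_mono mult_right_mono)
    show "(\<Prod>l\<in>L. max 0 ((\<Sum>j=n0..n. ?\<phi> l j) - real (card L) * ?s l))
        \<le> (\<Sum>J\<in>injections L {n0..n}. \<Prod>l\<in>L. ?\<phi> l (J l))"
      using \<phi> s0 by (intro sum_injections_ge[OF L]) auto
    have "real (card {n0..n}) ^ card L \<le> real n ^ card L"
      using n0 by (intro power_mono) auto
    then show "real (card (injections L {n0..n})) \<le> real n ^ card L"
      by (rule order_trans[OF card_injections_le[OF L finite_atLeastAtMost]])
  qed simp
  also have "\<dots> = (\<Sum>J\<in>injections L {n0..n}. ?C * ((\<Prod>l\<in>L. ?\<phi> l (J l)) - ?bad))"
    by (simp add: sum_distrib_left[symmetric] sum_subtractf)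
  also have "\<dots> \<le> (\<Sum>J\<in>injections L {n0..n}. prob (deg_event True L J n m))"
    by (intro sum_mono deg_event_prob_ge[OF adm L _ _ n N]) (auto simp: injections_def)
  also have "\<dots> \<le> (\<Sum>J\<in>injections L {1..n}. prob (deg_event True L J n m))"
    using sub finite_injections[OF L] by (intro sum_mono2) auto
  finally show ?thesis .
qed

end

section \<open>Uniform vertices, good weights and the limiting law\<close>

lemma in_degree_eq_card:
  "wrt_degree par n i \<omega> = card {s \<in> {2..n}. par s \<omega> = i}"
proof -
  have "in_arcs (wrt_digraph par n \<omega>) i = (\<lambda>s. (s, par s \<omega>)) ` {s \<in> {2..n}. par s \<omega> = i}"
    by (auto simp: in_arcs_def wrt_digraph_def)
  then show ?thesis
    unfolding wrt_degree_def in_degree_def by (simp add: card_image inj_on_def)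
qed

lemma tendsto_at_top_exists:
  fixes f :: "real \<Rightarrow> real"
  assumes "(f \<longlongrightarrow> 0) at_top" "0 < \<epsilon>" shows "\<exists>x>0. f x < \<epsilon>"
proof -
  have "eventually (\<lambda>x. f x < \<epsilon> \<and> 0 < x) at_top"
    using order_tendstoD(2)[OF assms] eventually_gt_at_top[of 0] by (rule eventually_conj)
  then show ?thesis by (auto simp: eventually_at_top_linorder)
qed

context bounded_wrt
begin

lemma wrt_degree_eq: "wrt_degree par n i \<omega> = indeg n i \<omega>"
  by (simp add: in_degree_eq_card indeg_def)

text \<open>The vertices are chosen independently of the tree, so the probability is the mean over all
choices of distinct vertices.\<close>

lemma uniform_degree_prob:
  assumes kn: "k \<le> n" and U: "uniform_without_replacement M k n v"
    and I: "indep_set (sets (vimage_algebra (space M) (\<lambda>\<omega>. \<lambda>l\<in>{1..k}. v l \<omega>) (count_space UNIV)))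
            (sets (history n))"
  shows "real (card (injections {1..k} {1..n}))
      * prob {\<omega> \<in> space M. \<forall>l\<in>{1..k}. attains e (wrt_degree par n (v l \<omega>) \<omega>) (m l)}
    = (\<Sum>J\<in>injections {1..k} {1..n}. prob (deg_event e {1..k} J n m))"
proof -
  define V where "V = (\<lambda>\<omega>. \<lambda>l\<in>{1..k}. v l \<omega>)"
  let ?I = "injections {1..k} {1..n}"
  let ?E = "{\<omega> \<in> space M. \<forall>l\<in>{1..k}. attains e (wrt_degree par n (v l \<omega>) \<omega>) (m l)}"
  let ?D = "\<lambda>J. deg_event e {1..k} J n m"
  have I_eq: "?I = {f \<in> {1..k} \<rightarrow>\<^sub>E {1..n}. inj_on f {1..k}}" by (simp add: injections_def)
  have fin: "finite ?I" by (rule finite_injections) auto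
  have "(\<lambda>l\<in>{1..k}. l) \<in> ?I" using kn by (auto simp: injections_def inj_on_def)
  then have ne: "?I \<noteq> {}" by blast
  have V: "V \<in> measurable M (count_space UNIV)" "distr M (count_space UNIV) V
      = measure_pmf (pmf_of_set ?I)"
    using U unfolding uniform_without_replacement_def V_def I_eq by blast+
  have V_sets: "V -` B \<inter> space M \<in> sets M" for B
    using measurable_sets[OF V(1), of B] by simp
  have V_prob: "prob (V -` B \<inter> space M) = measure_pmf.prob (pmf_of_set ?I) B" for B
    using measure_distr[OF V(1), of B] V(2) by simp
  have V_J: "prob (V -` {J} \<inter> space M) = 1 / real (card ?I)" if "J \<in> ?I" for J
    using that fin ne by (simp add: V_prob measure_pmf_of_set)
  have V_out: "prob (V -` (- ?I) \<inter> space M) = 0"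
    using fin ne by (simp add: V_prob measure_pmf_of_set)
  have ev: "V \<omega> = J \<Longrightarrow> \<omega> \<in> ?E \<longleftrightarrow> \<omega> \<in> ?D J" for \<omega> J
    by (auto simp: V_def deg_event_def wrt_degree_eq)
  have D_M: "?D J \<in> sets M" for J by (rule deg_event_M) simp
  have joint: "prob ((V -` {J} \<inter> space M) \<inter> ?D J) = prob (V -` {J} \<inter> space M) * prob (?D J)" for J
  proof (rule indep_setD[OF I])
    show "V -` {J} \<inter> space M \<in> sets (vimage_algebra (space M) (\<lambda>\<omega>. \<lambda>l\<in>{1..k}. v l \<omega>)
        (count_space UNIV))"
      unfolding V_def[symmetric] by (rule in_vimage_algebra) simp
    show "?D J \<in> sets (history n)" by (rule deg_event_history) simp
  qed
  have E_in: "?E \<inter> (V -` ?I \<inter> space M) = (\<Union>J\<in>?I. (V -` {J} \<inter> space M) \<inter> ?D J)"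
    using ev by blast
  have E_out: "?E - (V -` ?I \<inter> space M) \<in> sets M"
  proof -
    have "?E - (V -` ?I \<inter> space M) = (\<Union>J\<in>({1..k} \<rightarrow>\<^sub>E UNIV) - ?I. (V -` {J} \<inter> space M) \<inter> ?D J)"
    proof -
      have "V \<omega> \<in> {1..k} \<rightarrow>\<^sub>E UNIV" for \<omega> by (simp add: V_def)
      then show ?thesis using ev by blast
    qed
    also have "\<dots> \<in> sets M"
      using V_sets D_M by (intro sets.countable_UN' countable_Diff countable_PiE) auto
    finally show ?thesis .
  qed
  have E_in_M: "?E \<inter> (V -` ?I \<inter> space M) \<in> sets M"
    unfolding E_in using V_sets D_M fin by (intro sets.finite_UN) auto
  have "prob (?E - (V -` ?I \<inter> space M)) \<le> prob (V -` (- ?I) \<inter> space M)"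
    using V_sets by (intro finite_measure_mono) auto
  then have out0: "prob (?E - (V -` ?I \<inter> space M)) = 0" using V_out by (simp add: measure_le_0_iff)
  have "prob ((?E \<inter> (V -` ?I \<inter> space M)) \<union> (?E - (V -` ?I \<inter> space M)))
      = prob (?E \<inter> (V -` ?I \<inter> space M)) + prob (?E - (V -` ?I \<inter> space M))"
    by (rule finite_measure_Union[OF E_in_M E_out]) blast
  then have "prob ?E = prob (?E \<inter> (V -` ?I \<inter> space M)) + prob (?E - (V -` ?I \<inter> space M))"
    by (simp only: Int_Diff_Un)
  also have "\<dots> = prob (\<Union>J\<in>?I. (V -` {J} \<inter> space M) \<inter> ?D J)" using out0 E_in by simp
  also have "\<dots> = (\<Sum>J\<in>?I. prob ((V -` {J} \<inter> space M) \<inter> ?D J))"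
    using V_sets D_M fin by (intro finite_measure_finite_Union) (auto simp: disjoint_family_on_def)
  also have "\<dots> = (\<Sum>J\<in>?I. 1 / real (card ?I) * prob (?D J))"
    by (intro sum.cong refl) (simp only: joint V_J)
  finally have "prob ?E = (\<Sum>J\<in>?I. prob (?D J)) / real (card ?I)"
    by (simp add: sum_divide_distrib)
  moreover have "0 < card ?I" using fin ne by (simp add: card_gt_0_iff)
  ultimately show ?thesis by simp
qed

lemma wt_sum_measurable: "(\<lambda>\<omega>. \<Sum>i=1..t. wt i \<omega>) \<in> borel_measurable M"
  by (intro borel_measurable_sum wt_measurable) auto

lemma laplace_vanishes: "((\<lambda>r. \<integral>x. exp (- (r * W x)) \<partial>P) \<longlongrightarrow> 0) at_top"
proof -
  have "((\<lambda>r. \<integral>x. exp (- (r * W x)) \<partial>P) \<longlongrightarrow> (\<integral>x. 0 \<partial>P)) at_top"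
  proof (rule integral_dominated_convergence_at_top[where w = "\<lambda>_. 1"])
    show "AE x in P. ((\<lambda>r. exp (- (r * W x))) \<longlongrightarrow> 0) at_top"
      using weight_range
    proof eventually_elim
      case (elim x)
      then have "filterlim (\<lambda>r. r * W x) at_top at_top"
        by (subst mult.commute)
           (intro filterlim_tendsto_pos_mult_at_top[OF tendsto_const] filterlim_ident; simp)
      then show ?case
        by (intro filterlim_compose[OF exp_at_bot]
            filterlim_compose[OF filterlim_uminus_at_bot_at_top])
    qed
    show "\<forall>\<^sub>F r in at_top. AE x in P. norm (exp (- (r * W x))) \<le> 1"
      using eventually_ge_at_top[of 0]
    proof eventually_elim
      case (elim r)
      show ?case using weight_range by eventually_elim (use elim in simp)
    qed
  qed (use weight_measurable in auto)
  then show ?thesis by simp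
qed

text \<open>Chernoff bound with a large parameter \<open>r\<close>: since the weight is positive, its Laplace transform
at \<open>r\<close> tends to \<open>0\<close>, so the probability of a small slope decays at any prescribed exponential
rate.\<close>

lemma small_sum_prob:
  assumes "0 < K"
  obtains \<delta> where "0 < \<delta>" "\<And>t. prob {\<omega> \<in> space M. (\<Sum>i=1..t. wt i \<omega>) < \<delta> * real t}
      \<le> exp (- K * real t)"
proof -
  obtain r where r: "0 < r" "(\<integral>x. exp (- (r * W x)) \<partial>P) < exp (- K - 1)"
    using tendsto_at_top_exists[OF laplace_vanishes, of "exp (- K - 1)"] by auto
  let ?\<Phi> = "\<integral>x. exp (- (r * W x)) \<partial>P"
  have b: "\<bar>exp (- (r * x))\<bar> \<le> 1" if "0 < x" for x using that r by simp
  have m: "(\<lambda>x. exp (- (r * x))) \<in> borel_measurable borel" by measurable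
  show thesis
  proof (rule that[of "1 / r"])
    show "0 < 1 / r" using r by simp
    fix t
    let ?X = "\<lambda>\<omega>. \<Prod>i\<in>{1..t}. exp (- (r * wt i \<omega>))"
    have X: "?X \<omega> = exp (- (r * (\<Sum>i=1..t. wt i \<omega>)))" for \<omega>
      by (simp add: exp_sum[symmetric] sum_negf sum_distrib_left)
    have E: "(\<integral>\<omega>. ?X \<omega> \<partial>M) = ?\<Phi> ^ t"
      using wt_prod_integral[of "{1..t}" "\<lambda>i. i" "\<lambda>_ x. exp (- (r * x))" 1] b m by simp
    have X_meas: "?X \<in> borel_measurable M"
      by (intro borel_measurable_prod measurable_compose[OF wt_measurable m]) auto
    have X01: "0 \<le> ?X \<omega>" "?X \<omega> \<le> 1" for \<omega>
    proof -
      show "0 \<le> ?X \<omega>" by (intro prod_nonneg) auto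
      show "?X \<omega> \<le> 1" by (rule prod_le_1) (use wt_pos r in auto)
    qed
    have X_int: "integrable M ?X"
      using X01 by (intro bounded_integrable[OF X_meas, where C = 1])
          (simp add: abs_le_iff order_trans[of _ 0])
    have "{\<omega> \<in> space M. (\<Sum>i=1..t. wt i \<omega>) < 1 / r * real t} \<subseteq> {\<omega> \<in> space M. exp (- real t) \<le> ?X \<omega>}"
    proof safe
      fix \<omega> assume "(\<Sum>i=1..t. wt i \<omega>) < 1 / r * real t"
      then have "r * (\<Sum>i=1..t. wt i \<omega>) \<le> real t" using r by (simp add: field_simps)
      then show "exp (- real t) \<le> ?X \<omega>" unfolding X by simp
    qed
    then have "prob {\<omega> \<in> space M. (\<Sum>i=1..t. wt i \<omega>) < 1 / r * real t}
        \<le> prob {\<omega> \<in> space M. exp (- real t) \<le> ?X \<omega>}"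
      by (intro finite_measure_mono borel_measurable_le borel_measurable_const X_meas)
    also have "\<dots> \<le> (\<integral>\<omega>. ?X \<omega> \<partial>M) / exp (- real t)"
      using X01 by (intro integral_Markov_inequality_measure[OF X_int, where A = "{}"]) auto
    also have "\<dots> = ?\<Phi> ^ t * exp (real t)" unfolding E by (simp add: exp_minus field_simps)
    also have "\<dots> \<le> exp (- K - 1) ^ t * exp (real t)"
      using r W_integral_const_bounds(1)[OF m, of 0 1] b
      by (intro mult_right_mono power_mono) (auto simp: less_imp_le)
    also have "\<dots> = exp (- K * real t)"
      by (simp add: exp_of_nat_mult[symmetric] exp_add[symmetric] algebra_simps)
    finally show "prob {\<omega> \<in> space M. (\<Sum>i=1..t. wt i \<omega>) < 1 / r * real t} \<le> exp (- K * real t)" .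
  qed
qed

lemma sum_concentration:
  assumes \<mu>: "\<mu> = (\<integral>x. W x \<partial>P)" "0 < \<mu>" and "0 < d" "1 \<le> t"
  shows "prob {\<omega> \<in> space M. d * (\<mu> * real t) \<le> \<bar>(\<Sum>i=1..t. wt i \<omega>) - \<mu> * real t\<bar>} \<le> 2
      * exp (- 2 * (d * \<mu>)\<^sup>2 * real t)"
proof -
  have m: "expectation (wt i) = \<mu>" if "i \<ge> 1" for i
    using wt_integral[OF that, of "\<lambda>x. x"] \<mu> by simp
  interpret H: Hoeffding_ineq M "{1..t}" wt "\<lambda>_. 0" "\<lambda>_. 1" "\<mu> * real t"
  proof unfold_locales
    show "indep_vars (\<lambda>_. borel) wt {1..t}" by (rule indep_vars_subset[OF wt_indep]) auto
    show "AE x in M. wt i x \<in> {0..1}" for i using wt_pos by auto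
    show "\<mu> * real t \<equiv> \<Sum>i=1..t. expectation (wt i)"
      using m by (intro eq_reflection) simp
  qed auto
  have "prob {\<omega> \<in> space M. d * (\<mu> * real t) \<le> \<bar>(\<Sum>i=1..t. wt i \<omega>) - \<mu> * real t\<bar>}
      \<le> 2 * exp (- 2 * (d * (\<mu> * real t))\<^sup>2 / (\<Sum>i=1..t. (1 - 0)\<^sup>2))"
    using assms by (intro H.Hoeffding_ineq_abs_ge) auto
  also have "\<dots> = 2 * exp (- 2 * (d * \<mu>)\<^sup>2 * real t)"
    using assms by (simp add: power2_eq_square)
  finally show ?thesis .
qed

lemma bad_event_prob:
  assumes \<mu>: "\<mu> = (\<integral>x. W x \<partial>P)" "0 < \<mu>" and d: "0 < d" and n0: "1 \<le> n0" "n0 \<le> n" and K: "0 \<le> K"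
    and \<delta>: "\<And>t. prob {\<omega> \<in> space M. (\<Sum>i=1..t. wt i \<omega>) < \<delta> * real t} \<le> exp (- K * real t)"
  shows "prob (space M - good_event \<mu> d \<delta> t1 n0 n) \<le> real n * exp (- K * real t1) + 2 * real n
      * exp (- 2 * (d * \<mu>)\<^sup>2 * real n0)"
proof -
  let ?A = "\<lambda>t. {\<omega> \<in> space M. (\<Sum>i=1..t. wt i \<omega>) < \<delta> * real t}"
  let ?B = "\<lambda>t. {\<omega> \<in> space M. d * (\<mu> * real t) \<le> \<bar>(\<Sum>i=1..t. wt i \<omega>) - \<mu> * real t\<bar>}"
  have AM: "?A t \<in> sets M" for t
    by (intro borel_measurable_less wt_sum_measurable borel_measurable_const)
  have BM: "?B t \<in> sets M" for t
    by (intro borel_measurable_le borel_measurable_const borel_measurable_abs borel_measurable_diff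
        wt_sum_measurable)
  have "space M - good_event \<mu> d \<delta> t1 n0 n \<subseteq> (\<Union>t\<in>{t1..<n0}. ?A t) \<union> (\<Union>t\<in>{n0..<n}. ?B t)"
    by (auto simp: good_event_def not_le intro: less_imp_le)
  then have "prob (space M - good_event \<mu> d \<delta> t1 n0 n)
      \<le> prob ((\<Union>t\<in>{t1..<n0}. ?A t) \<union> (\<Union>t\<in>{n0..<n}. ?B t))"
    using AM BM by (intro finite_measure_mono) auto
  also have "\<dots> \<le> prob (\<Union>t\<in>{t1..<n0}. ?A t) + prob (\<Union>t\<in>{n0..<n}. ?B t)"
    using AM BM by (intro measure_Un_le) auto
  also have "\<dots> \<le> (\<Sum>t=t1..<n0. prob (?A t)) + (\<Sum>t=n0..<n. prob (?B t))"
    using AM BM by (intro add_mono finite_measure_subadditive_finite) auto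
  also have "\<dots> \<le> (\<Sum>t=t1..<n0. exp (- K * real t1))
      + (\<Sum>t=n0..<n. 2 * exp (- 2 * (d * \<mu>)\<^sup>2 * real n0))"
  proof (intro add_mono sum_mono)
    fix t assume t: "t \<in> {t1..<n0}"
    have "exp (- K * real t) \<le> exp (- K * real t1)" using t K by (simp add: mult_left_mono)
    then show "prob (?A t) \<le> exp (- K * real t1)" using \<delta>[of t] by linarith
  next
    fix t assume t: "t \<in> {n0..<n}"
    have "(d * \<mu>)\<^sup>2 * real n0 \<le> (d * \<mu>)\<^sup>2 * real t" using t by (intro mult_left_mono) auto
    then have e: "exp (- 2 * (d * \<mu>)\<^sup>2 * real t) \<le> exp (- 2 * (d * \<mu>)\<^sup>2 * real n0)" by simp
    have "1 \<le> t" using t n0 by simp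
    from sum_concentration[OF \<mu> d this] e show "prob (?B t) \<le> 2 * exp (- 2 * (d * \<mu>)\<^sup>2 * real n0)"
      by linarith
  qed
  also have "\<dots> \<le> real n * exp (- K * real t1) + real n * (2 * exp (- 2 * (d * \<mu>)\<^sup>2 * real n0))"
    unfolding sum_constant using n0 by (intro add_mono mult_right_mono) auto
  finally show ?thesis by simp
qed

text \<open>Weights close to \<open>1\<close> have positive probability, and for them the ratio \<open>x / (\<mu> + x)\<close> is close to
its maximal value \<open>1 / (1 + \<mu>)\<close>.\<close>

lemma mean_geo_lower:
  assumes \<mu>: "0 < \<mu>" and sup: "Sup {x::real. weight.prob {\<omega> \<in> space P. W \<omega> \<le> x} < 1} = 1"
      and "0 < \<xi>"
  obtains c where "0 < c" "\<And>m. c * exp (- \<xi> * real m) / (1 + \<mu>) ^ m \<le> mean_geo True \<mu> m"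
proof -
  have "((\<lambda>x. x * (1 + \<mu>) / (\<mu> + x)) \<longlongrightarrow> 1 * (1 + \<mu>) / (\<mu> + 1)) (at_left 1)"
    using \<mu> by (intro tendsto_intros) auto
  then have "((\<lambda>x. x * (1 + \<mu>) / (\<mu> + x)) \<longlongrightarrow> 1) (at_left 1)" using \<mu> by (simp add: add.commute)
  moreover have "exp (- \<xi>) < 1" using assms by simp
  ultimately have "eventually (\<lambda>x. exp (- \<xi>) < x * (1 + \<mu>) / (\<mu> + x)) (at_left 1)"
      by (rule order_tendstoD)
  moreover have "eventually (\<lambda>x. x \<in> {0<..<1}) (at_left (1::real))"
      by (rule eventually_at_left_real) simp
  ultimately have "eventually (\<lambda>x. exp (- \<xi>) < x * (1 + \<mu>) / (\<mu> + x) \<and> x \<in> {0<..<1}) (at_left 1)"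
    by (rule eventually_conj)
  then obtain x where x: "exp (- \<xi>) < x * (1 + \<mu>) / (\<mu> + x)" "0 < x" "x < 1"
    using eventually_happens'[of "at_left (1::real)"] by (auto simp: trivial_limit_at_left_real)
  let ?S = "{x::real. weight.prob {\<omega> \<in> space P. W \<omega> \<le> x} < 1}"
  have WM [measurable]: "W \<in> borel_measurable P" by (rule weight_measurable)
  \<comment> \<open>Otherwise the supremum, which is \<open>1\<close>, would be at most \<open>x\<close>; the set contains \<open>0\<close>
      and so is not empty.\<close>
  have "\<exists>y\<in>?S. x < y"
  proof (rule ccontr)
    assume "\<not> ?thesis"
    then have le: "\<And>y. y \<in> ?S \<Longrightarrow> y \<le> x" by force
    have "weight.prob {\<omega> \<in> space P. W \<omega> \<le> 0} = weight.prob {}"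
      by (rule weight.finite_measure_eq_AE) (use weight_range in \<open>auto elim: eventually_mono\<close>)
    then have "0 \<in> ?S" by simp
    then have "Sup ?S \<le> x" using le by (intro cSup_least) blast+
    then show False using sup x by simp
  qed
  then obtain y where y: "x < y" "weight.prob {\<omega> \<in> space P. W \<omega> \<le> y} < 1" by auto
  define p where "p = weight.prob {\<omega> \<in> space P. x < W \<omega>}"
  have "weight.prob {\<omega> \<in> space P. W \<omega> \<le> x} \<le> weight.prob {\<omega> \<in> space P. W \<omega> \<le> y}"
    using y by (intro weight.finite_measure_mono) auto
  moreover have "p = 1 - weight.prob {\<omega> \<in> space P. W \<omega> \<le> x}"
  proof -
    have "{\<omega> \<in> space P. x < W \<omega>} = space P - {\<omega> \<in> space P. W \<omega> \<le> x}" by auto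
    then show ?thesis unfolding p_def by (simp add: weight.prob_compl)
  qed
  ultimately have p: "0 < p" using y by linarith
  show thesis
  proof (rule that[of "p * (\<mu> / (\<mu> + 1))"])
    show "0 < p * (\<mu> / (\<mu> + 1))" using p \<mu> by simp
    fix m
    let ?v = "\<mu> / (\<mu> + 1) * (exp (- \<xi> * real m) / (1 + \<mu>) ^ m)"
    have v0: "0 \<le> ?v" using \<mu> by simp
    have le: "(\<integral>\<omega>. indicator {\<omega> \<in> space P. x < W \<omega>} \<omega> * ?v \<partial>P) \<le> mean_geo True \<mu> m"
    proof (rule integral_mono_AE)
      show "integrable P (\<lambda>\<omega>. indicator {\<omega> \<in> space P. x < W \<omega>} \<omega> * ?v)"
        by (rule integrable_mult_left) (auto intro!: integrable_real_indicator simp: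
            weight.emeasure_eq_measure)
      show "integrable P (\<lambda>\<omega>. geo True \<mu> (W \<omega>) m)"
        using geo_nonneg[of \<mu> _ True m] geo_le_power[of \<mu> _ 1 True m] \<mu>
        by (intro W_integrable[OF geo_measurable, where C = 1]) auto
      show "AE \<omega> in P. indicator {\<omega> \<in> space P. x < W \<omega>} \<omega> * ?v \<le> geo True \<mu> (W \<omega>) m"
        using weight_range
      proof eventually_elim
        case (elim \<omega>)
        show ?case
        proof (cases "x < W \<omega>")
          case True
          have "exp (- \<xi>) / (1 + \<mu>) \<le> W \<omega> / (\<mu> + W \<omega>)"
          proof -
            have "exp (- \<xi>) / (1 + \<mu>) \<le> x / (\<mu> + x)"
              using x \<mu> by (simp add: field_simps)
            also have "\<dots> \<le> W \<omega> / (\<mu> + W \<omega>)" using x True \<mu> by (simp add: field_simps)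
            finally show ?thesis .
          qed
          then have "(exp (- \<xi>) / (1 + \<mu>)) ^ m \<le> (W \<omega> / (\<mu> + W \<omega>)) ^ m"
            using \<mu> by (intro power_mono) auto
          moreover have "\<mu> / (\<mu> + 1) \<le> \<mu> / (\<mu> + W \<omega>)" using elim \<mu> by (intro divide_left_mono) auto
          ultimately have "\<mu> / (\<mu> + 1) * (exp (- \<xi>) / (1 + \<mu>)) ^ m
              \<le> \<mu> / (\<mu> + W \<omega>) * (W \<omega> / (\<mu> + W \<omega>)) ^ m"
            using \<mu> elim by (intro mult_mono) simp_all
          then have "\<mu> / (\<mu> + 1) * (exp (- \<xi>) / (1 + \<mu>)) ^ m \<le> geo True \<mu> (W \<omega>) m"
            by (simp add: geo_def)
          moreover have "exp (- \<xi> * real m) = exp (- \<xi>) ^ m"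
            by (simp add: exp_of_nat_mult[symmetric] mult.commute)
          ultimately show ?thesis using v0 by (auto simp: indicator_def power_divide)
        next
          case False
          then show ?thesis using geo_nonneg[of \<mu> "W \<omega>" True m] \<mu> elim by simp
        qed
      qed
    qed
    have "(\<integral>\<omega>. indicator {\<omega> \<in> space P. x < W \<omega>} \<omega> * ?v \<partial>P) = p * ?v"
      unfolding p_def by simp
    then have "p * ?v \<le> mean_geo True \<mu> m"
      using le by (simp only:)
    then show "p * (\<mu> / (\<mu> + 1)) * exp (- \<xi> * real m) / (1 + \<mu>) ^ m \<le> mean_geo True \<mu> m"
      by simp
  qed
qed

lemma mean_geo_True_le_False:
  assumes "0 < \<mu>" shows "mean_geo True \<mu> m \<le> mean_geo False \<mu> m"
proof (rule W_integral_mono[OF geo_measurable _ geo_measurable, where C = 1 and D = 1])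
  fix x :: real assume x: "0 < x" "x \<le> 1"
  show "\<bar>geo True \<mu> x m\<bar> \<le> 1" "\<bar>geo False \<mu> x m\<bar> \<le> 1"
    using geo_nonneg[of \<mu> x _ m] geo_le_power[of \<mu> x 1 _ m] assms x by auto
  have "0 \<le> (x / (\<mu> + x)) ^ m" using assms x by simp
  moreover have "\<mu> / (\<mu> + x) \<le> 1" using assms x by simp
  ultimately have "\<mu> / (\<mu> + x) * (x / (\<mu> + x)) ^ m \<le> 1 * (x / (\<mu> + x)) ^ m"
    by (intro mult_right_mono)
  then show "geo True \<mu> x m \<le> geo False \<mu> x m" by (simp add: geo_def)
qed

end

section \<open>Errors of polynomial order\<close>

text \<open>Errors that are \<open>O(n\<^bsup>- \<tau>\<^esup>)\<close> for some \<open>\<tau> > 0\<close>; this class is closed under the operations needed to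
combine the estimates without tracking exponents.\<close>

definition poly_small :: "(nat \<Rightarrow> real) \<Rightarrow> bool"
  where "poly_small f \<longleftrightarrow>
    (\<exists>\<tau>>0. \<exists>C. eventually (\<lambda>n. \<bar>f n\<bar> \<le> C * real n powr - \<tau>) sequentially)"

abbreviation near_one :: "(nat \<Rightarrow> real) \<Rightarrow> bool"
  where "near_one f \<equiv> poly_small (\<lambda>n. f n - 1)"

lemma poly_smallI:
  assumes "0 < \<tau>" "eventually (\<lambda>n. \<bar>f n\<bar> \<le> C * real n powr - \<tau>) sequentially"
  shows "poly_small f"
  using assms unfolding poly_small_def by blast

lemma poly_small_mono:
  assumes "poly_small g" "eventually (\<lambda>n. \<bar>f n\<bar> \<le> D * \<bar>g n\<bar>) sequentially"
  shows "poly_small f"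
proof -
  obtain \<tau> C where \<tau>: "0 < \<tau>" "eventually (\<lambda>n. \<bar>g n\<bar> \<le> C * real n powr - \<tau>) sequentially"
    using assms(1) unfolding poly_small_def by blast
  show ?thesis
  proof (rule poly_smallI[OF \<tau>(1), where C = "\<bar>D\<bar> * C"])
    show "eventually (\<lambda>n. \<bar>f n\<bar> \<le> \<bar>D\<bar> * C * real n powr - \<tau>) sequentially"
      using assms(2) \<tau>(2)
    proof eventually_elim
      case (elim n)
      have "\<bar>f n\<bar> \<le> D * \<bar>g n\<bar>" using elim by simp
      also have "\<dots> \<le> \<bar>D\<bar> * \<bar>g n\<bar>" by (intro mult_right_mono) auto
      also have "\<dots> \<le> \<bar>D\<bar> * (C * real n powr - \<tau>)" using elim by (intro mult_left_mono) auto
      finally show ?case by simp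
    qed
  qed
qed

lemma poly_small_add:
  assumes "poly_small f" "poly_small g" shows "poly_small (\<lambda>n. f n + g n)"
proof -
  obtain s C where s: "0 < s" "eventually (\<lambda>n. \<bar>f n\<bar> \<le> C * real n powr - s) sequentially"
    using assms(1) unfolding poly_small_def by blast
  obtain t D where t: "0 < t" "eventually (\<lambda>n. \<bar>g n\<bar> \<le> D * real n powr - t) sequentially"
    using assms(2) unfolding poly_small_def by blast
  show ?thesis
  proof (rule poly_smallI[where \<tau> = "min s t" and C = "\<bar>C\<bar> + \<bar>D\<bar>"])
    show "0 < min s t" using s t by simp
    show "eventually (\<lambda>n. \<bar>f n + g n\<bar> \<le> (\<bar>C\<bar> + \<bar>D\<bar>) * real n powr - min s t) sequentially"
      using s(2) t(2) eventually_ge_at_top[of 1]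
    proof eventually_elim
      case (elim n)
      have "C * real n powr - s \<le> \<bar>C\<bar> * real n powr - min s t"
        using elim by (intro mult_mono powr_mono) auto
      moreover have "D * real n powr - t \<le> \<bar>D\<bar> * real n powr - min s t"
        using elim by (intro mult_mono powr_mono) auto
      ultimately show ?case using elim abs_triangle_ineq[of "f n" "g n"]
          by (simp add: distrib_right)
    qed
  qed
qed

lemma poly_small_cmult: "poly_small f \<Longrightarrow> poly_small (\<lambda>n. c * f n)"
  by (erule poly_small_mono[where D = "\<bar>c\<bar>"]) (simp add: abs_mult)

lemma poly_small_minus: "poly_small f \<Longrightarrow> poly_small (\<lambda>n. - f n)"
  using poly_small_cmult[of f "- 1"] by simp

lemma poly_small_tendsto:
  assumes "poly_small f" shows "f \<longlonglongrightarrow> 0"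
proof -
  obtain \<tau> C where \<tau>: "0 < \<tau>" "eventually (\<lambda>n. \<bar>f n\<bar> \<le> C * real n powr - \<tau>) sequentially"
    using assms unfolding poly_small_def by blast
  have lim: "(\<lambda>n. C * real n powr - \<tau>) \<longlonglongrightarrow> 0"
    using \<tau>(1) by real_asymp
  have "eventually (\<lambda>n. norm (f n) \<le> C * real n powr - \<tau>) sequentially" using \<tau>(2) by simp
  from Lim_null_comparison[OF this lim] show ?thesis .
qed

lemma poly_small_lt: "poly_small f \<Longrightarrow> 0 < a \<Longrightarrow> eventually (\<lambda>n. \<bar>f n\<bar> < a) sequentially"
  using order_tendstoD(2)[OF tendsto_rabs_zero[OF poly_small_tendsto], of f a] by simp

lemma poly_small_mult:
  assumes "poly_small f" "poly_small g" shows "poly_small (\<lambda>n. f n * g n)"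
proof (rule poly_small_mono[OF assms(1), where D = 1])
  show "eventually (\<lambda>n. \<bar>f n * g n\<bar> \<le> 1 * \<bar>f n\<bar>) sequentially"
    using poly_small_lt[OF assms(2), of 1]
    by (auto elim!: eventually_mono simp: abs_mult mult_left_le)
qed

lemma near_one_mult:
  assumes "near_one f" "near_one g" shows "near_one (\<lambda>n. f n * g n)"
proof -
  have "poly_small (\<lambda>n. (f n - 1) * (g n - 1) + (f n - 1) + (g n - 1))"
    by (intro poly_small_add poly_small_mult assms)
  then show ?thesis by (simp add: algebra_simps)
qed

lemma poly_small_zero: "poly_small (\<lambda>n. 0)"
  by (rule poly_smallI[of 1 _ 0]) auto

lemma near_one_power:
  assumes "near_one f" shows "near_one (\<lambda>n. f n ^ i)"
proof (induction i)
  case (Suc i)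
  show ?case using near_one_mult[OF assms Suc] by simp
qed (simp add: poly_small_zero)

lemma near_one_add: "near_one f \<Longrightarrow> poly_small g \<Longrightarrow> near_one (\<lambda>n. f n + g n)"
  using poly_small_add[of "\<lambda>n. f n - 1" g] by (simp add: algebra_simps)

lemma near_one_diff: "near_one f \<Longrightarrow> poly_small g \<Longrightarrow> near_one (\<lambda>n. f n - g n)"
  using near_one_add[OF _ poly_small_minus] by simp

lemma near_one_one_plus: "poly_small g \<Longrightarrow> near_one (\<lambda>n. 1 + g n)"
  by simp

lemma near_one_one_minus: "poly_small g \<Longrightarrow> near_one (\<lambda>n. 1 - g n)"
  using poly_small_minus[of g] by simp

lemma near_one_gt_half:
  assumes "near_one f" shows "eventually (\<lambda>n. 1/2 < f n) sequentially"
proof -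
  have "eventually (\<lambda>n. \<bar>f n - 1\<bar> < 1/2) sequentially" by (rule poly_small_lt[OF assms]) simp
  then show ?thesis by eventually_elim linarith
qed

lemma near_one_inverse:
  assumes "near_one f" shows "near_one (\<lambda>n. 1 / f n)"
proof (rule poly_small_mono[OF assms, where D = 2])
  show "eventually (\<lambda>n. \<bar>1 / f n - 1\<bar> \<le> 2 * \<bar>f n - 1\<bar>) sequentially"
    using near_one_gt_half[OF assms]
  proof eventually_elim
    case (elim n)
    have "1 / f n - 1 = - ((f n - 1) / f n)" using elim by (simp add: field_simps)
    then have "\<bar>1 / f n - 1\<bar> = \<bar>f n - 1\<bar> / f n" using elim by (simp add: abs_divide)
    also have "\<dots> \<le> \<bar>f n - 1\<bar> / (1/2)" using elim by (intro divide_left_mono) auto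
    finally show ?case by simp
  qed
qed

lemma near_one_divide: "near_one f \<Longrightarrow> near_one g \<Longrightarrow> near_one (\<lambda>n. f n / g n)"
  using near_one_mult[OF _ near_one_inverse] by simp

lemma near_one_exp:
  assumes "poly_small f" shows "near_one (\<lambda>n. exp (f n))"
proof (rule poly_small_mono[OF assms, where D = 2])
  have "eventually (\<lambda>n. \<bar>f n\<bar> < 1/2) sequentially" by (rule poly_small_lt[OF assms]) simp
  then show "eventually (\<lambda>n. \<bar>exp (f n) - 1\<bar> \<le> 2 * \<bar>f n\<bar>) sequentially"
  proof eventually_elim
    case (elim n)
    define x where "x = f n"
    have "\<bar>x\<bar> < 1/2" using elim by (simp add: x_def)
    then have x: "1/2 < 1 - x" by linarith
    have "exp x \<le> 1 / (1 - x)"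
      using exp_ge_add_one_self[of "- x"] x by (simp add: exp_minus field_simps)
    moreover have "1 / (1 - x) - 1 = x / (1 - x)" using x by (simp add: field_simps)
    moreover have "x / (1 - x) \<le> \<bar>x\<bar> / (1/2)" using x by (intro frac_le) auto
    ultimately have "exp x - 1 \<le> 2 * \<bar>x\<bar>" by simp
    moreover have "x \<le> exp x - 1" using exp_ge_add_one_self[of x] by linarith
    ultimately show ?case unfolding x_def[symmetric] by linarith
  qed
qed

lemma poly_small_const_over_n: "poly_small (\<lambda>n. c / real n)"
proof (rule poly_smallI[of 1 _ "\<bar>c\<bar>"])
  show "eventually (\<lambda>n. \<bar>c / real n\<bar> \<le> \<bar>c\<bar> * real n powr - 1) sequentially"
    using eventually_gt_at_top[of 0]
    by eventually_elim (simp add: powr_minus divide_inverse abs_mult)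
qed simp

lemma poly_small_powr_ln:
  assumes "0 < a" shows "poly_small (\<lambda>n. real n powr - a * (1 + ln (real n)))"
proof (rule poly_smallI[of "a / 2" _ 1])
  have "(\<lambda>n. real n powr - a * (1 + ln (real n))) \<in> o(\<lambda>n. real n powr - (a / 2))"
    using assms by real_asymp
  from landau_o.smallD[OF this, of 1]
  show "eventually (\<lambda>n. \<bar>real n powr - a * (1 + ln (real n))\<bar> \<le> 1 * real n powr - (a / 2))
      sequentially"
    by simp
qed (use assms in simp)

lemma poly_small_stretched:
  assumes "0 < a" "0 < b" shows "poly_small (\<lambda>n. real n powr D * exp (- (a * real n powr b)))"
proof (rule poly_smallI[of 1 _ 1])
  have "(\<lambda>n. real n powr D * exp (- (a * real n powr b))) \<in> o(\<lambda>n. real n powr - 1)"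
    using assms by real_asymp
  from landau_o.smallD[OF this, of 1]
  show "eventually (\<lambda>n. \<bar>real n powr D * exp (- (a * real n powr b))\<bar> \<le> 1 * real n powr - 1)
      sequentially"
    by simp
qed simp

lemma poly_small_small_o:
  assumes "poly_small f"
  obtains \<beta> r where "0 < \<beta>" "r \<in> o(\<lambda>n. real n powr - \<beta>)" "eventually (\<lambda>n. \<bar>f n\<bar> \<le> r n) sequentially"
proof -
  obtain \<tau> C where \<tau>: "0 < \<tau>" "eventually (\<lambda>n. \<bar>f n\<bar> \<le> C * real n powr - \<tau>) sequentially"
    using assms unfolding poly_small_def by blast
  have "(\<lambda>n. C * real n powr - \<tau>) \<in> o(\<lambda>n. real n powr - (\<tau> / 2))"
    using \<tau>(1) by real_asymp
  with \<tau> that[of "\<tau> / 2" "\<lambda>n. C * real n powr - \<tau>"] show thesis by simp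
qed

lemma harmonic_le:
  assumes "1 \<le> a" "a \<le> n" shows "(\<Sum>s=a..<n. 1 / real s) \<le> 1 + ln (real n) - ln (real a)"
proof -
  have "(\<Sum>s=a..n. 1 / real s) \<le> 1 + ln (real n) - ln (real a)"
    using assms(2)
  proof (induction n rule: dec_induct)
    case base
    then show ?case using assms(1) by (simp add: divide_le_eq)
  next
    case (step n)
    have n: "0 < real n" using step assms by simp
    have "ln (real n / real (Suc n)) \<le> real n / real (Suc n) - 1"
      using n by (intro ln_le_minus_one) simp
    also have "\<dots> = - (1 / real (Suc n))" by (simp add: field_simps)
    finally have "1 / real (Suc n) \<le> ln (real (Suc n)) - ln (real n)" using n by (simp add: ln_div)
    moreover have "{a..Suc n} = insert (Suc n) {a..n}" using step by auto
    ultimately show ?case using step.IH by simp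
  qed
  moreover have "(\<Sum>s=a..<n. 1 / real s) \<le> (\<Sum>s=a..n. 1 / real s)"
    by (intro sum_mono2) auto
  ultimately show ?thesis by simp
qed

lemma prod_one_plus_le:
  assumes "1 \<le> a" "a \<le> n" "0 \<le> q"
  shows "(\<Prod>s=a..<n. 1 + q / real s) \<le> exp (q * (1 + ln (real n) - ln (real a)))"
proof -
  have "(\<Prod>s=a..<n. 1 + q / real s) \<le> (\<Prod>s=a..<n. exp (q / real s))"
    using assms exp_ge_add_one_self by (intro prod_mono conjI add_nonneg_nonneg) auto
  also have "\<dots> = exp (q * (\<Sum>s=a..<n. 1 / real s))"
    by (simp add: exp_sum[symmetric] sum_distrib_left)
  also have "\<dots> \<le> exp (q * (1 + ln (real n) - ln (real a)))"
    using mult_left_mono[OF harmonic_le[OF assms(1,2)] assms(3)] by simp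
  finally show ?thesis .
qed

lemma growth_le:
  assumes "0 < \<mu>" "1 \<le> z" "1 \<le> n0" "n0 \<le> n"
  shows "growth \<mu> z n0 n \<le> exp ((z - 1) / \<mu>) * (real n / real n0) powr ((z - 1) / \<mu>)"
proof -
  have "growth \<mu> z n0 n = (\<Prod>s=n0..<n. 1 + ((z - 1) / \<mu>) / real s)" by (simp add: growth_def)
  also have "\<dots> \<le> exp ((z - 1) / \<mu> * (1 + ln (real n) - ln (real n0)))"
    using assms by (intro prod_one_plus_le) auto
  also have "\<dots> = exp ((z - 1) / \<mu> + (z - 1) / \<mu> * ln (real n / real n0))"
    using assms by (simp add: ln_div distrib_left right_diff_distrib)
  also have "\<dots> = exp ((z - 1) / \<mu>) * (real n / real n0) powr ((z - 1) / \<mu>)"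
    using assms by (simp add: powr_def exp_add)
  finally show ?thesis .
qed

context bounded_wrt
begin

lemma early_mass_le:
  assumes "0 < \<delta>" "1 \<le> z" "1 \<le> t1" "1 \<le> n0"
  shows "early_mass z \<delta> t1 n0 \<le> (1 + z) ^ t1 * exp (z / \<delta> * (1 + ln (real n0)))"
proof (cases "t1 \<le> n0")
  case True
  have "{..<n0} = {..<t1} \<union> {t1..<n0}" using True by auto
  then have "early_mass z \<delta> t1 n0 = (\<Prod>s<t1. 1 + z * early_rate \<delta> t1 s)
      * (\<Prod>s=t1..<n0. 1 + z * early_rate \<delta> t1 s)"
    unfolding early_mass_def by (simp add: prod.union_disjoint ivl_disj_int)
  also have "(\<Prod>s<t1. 1 + z * early_rate \<delta> t1 s) = (1 + z) ^ t1"
    by (simp add: early_rate_def)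
  also have "(\<Prod>s=t1..<n0. 1 + z * early_rate \<delta> t1 s) = (\<Prod>s=t1..<n0. 1 + (z / \<delta>) / real s)"
    by (intro prod.cong) (auto simp: early_rate_def)
  also have "(1 + z) ^ t1 * \<dots> \<le> (1 + z) ^ t1 * exp (z / \<delta> * (1 + ln (real n0)))"
  proof (rule mult_left_mono)
    have "(\<Prod>s=t1..<n0. 1 + (z / \<delta>) / real s) \<le> exp (z / \<delta> * (1 + ln (real n0) - ln (real t1)))"
      using assms True by (intro prod_one_plus_le) auto
    also have "\<dots> \<le> exp (z / \<delta> * (1 + ln (real n0)))"
      unfolding exp_le_cancel_iff using assms by (intro mult_left_mono) auto
    finally show "(\<Prod>s=t1..<n0. 1 + (z / \<delta>) / real s) \<le> exp (z / \<delta> * (1 + ln (real n0)))" .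
  qed (use assms in simp)
  finally show ?thesis .
next
  case False
  have "early_mass z \<delta> t1 n0 = (1 + z) ^ n0"
    unfolding early_mass_def using False by (simp add: early_rate_def)
  also have "\<dots> \<le> (1 + z) ^ t1 * 1" using False assms by (simp add: power_increasing)
  also have "\<dots> \<le> (1 + z) ^ t1 * exp (z / \<delta> * (1 + ln (real n0)))"
    using assms by (intro mult_left_mono) auto
  finally show ?thesis .
qed

end

section \<open>Choice of the parameters\<close>

text \<open>The function \<open>s \<mapsto> (1 + \<mu>) (1 - e\<^bsup>- s\<^esup>) / \<mu>\<close> vanishes at \<open>0\<close> with slope \<open>(1 + \<mu>) / \<mu> > c\<close>.\<close>

lemma choose_tilt:
  fixes \<mu> c :: real
  assumes "0 < \<mu>" "0 < c" "c < (1 + \<mu>) / \<mu>"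
  obtains s z where "0 < s" "z = (1 + \<mu>) * exp (- s)" "1 \<le> z" "z \<le> 1 + \<mu>" "c * s < (1 + \<mu> - z) / \<mu>"
proof -
  define q where "q = (1 + \<mu>) / \<mu>"
  \<comment> \<open>The first bound gives \<open>z \<ge> 1\<close>, the second \<open>c (1 + s) < q\<close>; then \<open>1 - e\<^bsup>- s\<^esup> \<ge> s
      / (1 + s)\<close> suffices.\<close>
  define s where "s = min (ln (1 + \<mu>)) ((q / c - 1) / 2)"
  have q: "0 < q" "c < q" using assms by (auto simp: q_def)
  have s: "0 < s" unfolding s_def using assms q by simp
  have "s \<le> (q / c - 1) / 2" unfolding s_def by (rule min.cobounded2)
  then have "c * (1 + s) \<le> c * (1 + (q / c - 1) / 2)" using assms by (intro mult_left_mono) auto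
  also have "\<dots> = (c + q) / 2" using assms by (simp add: field_simps)
  also have "\<dots> < q" using q by simp
  finally have cq: "c * (1 + s) < q" .
  have "exp s \<le> 1 + \<mu>" using s_def assms by (metis add_pos_pos exp_le_cancel_iff exp_ln
      min.cobounded1 zero_less_one)
  then have 1: "1 \<le> (1 + \<mu>) * exp (- s)" by (simp add: exp_minus field_simps)
  have 2: "(1 + \<mu>) * exp (- s) \<le> 1 + \<mu>" using s assms by (simp add: mult_left_le)
  have "exp (- s) \<le> 1 / (1 + s)" using exp_ge_add_one_self[of s] s
      by (simp add: exp_minus field_simps)
  then have "s / (1 + s) \<le> 1 - exp (- s)" using s by (simp add: field_simps)
  then have "q * (s / (1 + s)) \<le> q * (1 - exp (- s))" using q by (intro mult_left_mono) auto
  moreover have "c * s < q * (s / (1 + s))"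
    using mult_strict_right_mono[OF cq s] s by (simp add: field_simps)
  ultimately have "c * s < q * (1 - exp (- s))" by simp
  also have "\<dots> = (1 + \<mu> - (1 + \<mu>) * exp (- s)) / \<mu>" by (simp add: q_def field_simps)
  finally show thesis using that[OF s refl 1 2] by simp
qed

context bounded_wrt
begin

text \<open>All parameters as functions of \<open>n\<close>. The error \<open>E\<close> bounds the share of the vertices born before
\<open>n0\<close>, and \<open>B\<close> the probability of untypical weights, both relative to the limiting probabilities.

The constants are fixed in the following order. The tilt leaves the exponent \<open>\<Delta>\<close> as room. One
eighth of it each goes to \<open>\<xi>\<close> (lower bound for the limit), to \<open>\<gamma>\<close> (times up to \<open>t1\<close>, about
\<open>\<gamma> log n\<close>) and to \<open>\<epsilon>\<close> (times between \<open>t1\<close> and \<open>n0\<close>), which leaves more than \<open>\<Delta> / 2\<close>. The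
limiting probabilities are at least of order \<open>n\<^bsup>- D\<^esup>\<close>; the rate \<open>K\<close>, and with it the slope \<open>\<delta>\<close>, is
chosen so that the weight sums are too small after \<open>t1\<close> with probability \<open>O(n\<^bsup>- D - 1\<^esup>)\<close>. Only
then can \<open>\<epsilon>\<close> be chosen, since it depends on \<open>\<delta>\<close>.\<close>

lemma asymptotic_frame:
  fixes \<mu> c :: real and k :: nat
  assumes mean: "\<mu> = (\<integral>x. W x \<partial>P)" and \<mu>: "0 < \<mu>" "\<mu> \<le> 1"
    and sup: "Sup {x::real. weight.prob {\<omega> \<in> space P. W \<omega> \<le> x} < 1} = 1"
    and c: "0 < c" "c < (1 + \<mu>) / \<mu>"
  obtains z \<delta> n0 t1 d E B where "1 \<le> z" "z \<le> 1 + \<mu>" "0 < \<delta>"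
    "eventually (\<lambda>n. admissible \<mu> (d n) \<delta> (t1 n) (n0 n) k \<and> n0 n \<le> n) sequentially"
    "poly_small (\<lambda>n. d n * (1 + ln (real n)))" "\<And>n. 0 \<le> d n"
    "poly_small (\<lambda>n. (1 + ln (real n)) / real (n0 n))"
    "poly_small E" "\<And>n. 0 \<le> E n" "poly_small B" "\<And>n. 0 \<le> B n"
    "eventually (\<lambda>n. \<forall>e. \<forall>m::nat. real m < c * ln (real n) \<longrightarrow>
      (real (n0 n) + real k) * (early_mass z \<delta> (t1 n) (n0 n) * growth \<mu> z (n0 n) n / z ^ m)
        \<le> E n * (real n * mean_geo e \<mu> m)) sequentially"
    "eventually (\<lambda>n. \<forall>e. \<forall>m::nat \<Rightarrow> nat. (\<forall>l\<in>{1..k}. real (m l) < c * ln (real n)) \<longrightarrow>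
      prob (space M - good_event \<mu> (d n) \<delta> (t1 n) (n0 n) n) \<le> B n * (\<Prod>l=1..k. mean_geo e \<mu> (m l)))
          sequentially"
proof -
  obtain s z where s: "0 < s" and zs: "z = (1 + \<mu>) * exp (- s)" and z: "1 \<le> z" "z \<le> 1 + \<mu>"
    and gap: "c * s < (1 + \<mu> - z) / \<mu>"
    by (rule choose_tilt[OF \<mu>(1) c]) blast
  have z2: "z \<le> 2" using z(2) \<mu>(2) by linarith
  define b where "b = (z - 1) / \<mu>"
  define \<Delta> where "\<Delta> = 1 - b - c * s"
  have b: "0 \<le> b" "b \<le> 1" using z \<mu> by (simp_all add: b_def divide_le_eq)
  have \<Delta>: "0 < \<Delta>" using gap \<mu> by (simp add: \<Delta>_def b_def field_simps)
  define \<xi> where "\<xi> = \<Delta> / (8 * c)"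
  have \<xi>: "0 < \<xi>" using \<Delta> c by (simp add: \<xi>_def)
  obtain g where g: "0 < g" "\<And>m. g * exp (- \<xi> * real m) / (1 + \<mu>) ^ m \<le> mean_geo True \<mu> m"
    by (rule mean_geo_lower[OF \<mu>(1) sup \<xi>]) blast
  have geo_ge: "g * exp (- (\<xi> + ln (1 + \<mu>)) * real m) \<le> mean_geo e \<mu> m" for e m
  proof -
    have "(1 + \<mu>) ^ m = exp (ln (1 + \<mu>) * real m)"
      using \<mu> by (simp add: exp_of_nat_mult mult.commute)
    then have "g * exp (- (\<xi> + ln (1 + \<mu>)) * real m) = g * exp (- \<xi> * real m) / (1 + \<mu>) ^ m"
    proof -
      have "exp (- (\<xi> + ln (1 + \<mu>)) * real m) = exp (- \<xi> * real m) * exp (- (ln (1 + \<mu>) * real m))"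
        unfolding mult_exp_exp by (simp add: algebra_simps)
      then show ?thesis unfolding \<open>(1 + \<mu>) ^ m = exp (ln (1 + \<mu>) * real m)\<close>
        by (simp only: exp_minus divide_inverse mult.assoc)
    qed
    also have "\<dots> \<le> mean_geo True \<mu> m" by (rule g(2))
    also have "\<dots> \<le> mean_geo e \<mu> m" using mean_geo_True_le_False[OF \<mu>(1)] by (cases e) auto
    finally show ?thesis .
  qed
  define \<gamma> where "\<gamma> = \<Delta> / 16"
  have \<gamma>: "0 < \<gamma>" using \<Delta> by (simp add: \<gamma>_def)
  define D where "D = real k * (c * (\<xi> + ln (1 + \<mu>)))"
  have D: "0 \<le> D" using c \<xi> \<mu> by (simp add: D_def)
  define K where "K = (D + 2) / \<gamma>"
  have K: "0 < K" using D \<gamma> by (simp add: K_def)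
  obtain \<delta> where \<delta>: "0 < \<delta>"
    "\<And>t. prob {\<omega> \<in> space M. (\<Sum>i=1..t. wt i \<omega>) < \<delta> * real t} \<le> exp (- K * real t)"
    by (rule small_sum_prob[OF K]) blast
  define \<epsilon> where "\<epsilon> = min (1/2) (\<Delta> / (8 * (1 + 2 / \<delta>)))"
  have \<epsilon>: "0 < \<epsilon>" "\<epsilon> \<le> 1/2"
    unfolding \<epsilon>_def using \<Delta> \<delta>(1) by (simp add: add_pos_pos, intro min.cobounded1)
  have \<epsilon>\<Delta>: "\<epsilon> * (1 + 2 / \<delta>) \<le> \<Delta> / 8"
  proof -
    have p: "0 < 1 + 2 / \<delta>" using \<delta> by (simp add: add_pos_pos)
    have "\<epsilon> * (1 + 2 / \<delta>) \<le> (\<Delta> / (8 * (1 + 2 / \<delta>))) * (1 + 2 / \<delta>)"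
      using p unfolding \<epsilon>_def by (intro mult_right_mono min.cobounded2) simp
    also have "\<dots> = \<Delta> / 8"
    proof -
      have "\<Delta> / (8 * p) * p = \<Delta> / 8" if "0 < p" for p :: real using that by simp
      from this[OF p] show ?thesis .
    qed
    finally show ?thesis .
  qed
  define n0 where "n0 n = nat \<lceil>real n powr \<epsilon>\<rceil>" for n
  define d where "d n = real n powr - (\<epsilon> / 4)" for n
  define t1 where "t1 n = nat \<lceil>\<gamma> * ln (real n)\<rceil> + 1" for n
  have n0: "real n powr \<epsilon> \<le> real (n0 n)" "real (n0 n) \<le> real n powr \<epsilon> + 1" for n
    unfolding n0_def by (simp_all add: of_nat_ceiling)
  define A0 where "A0 = 6 + 4 / \<delta>"
  define E where "E n = real (k + 1) / g * exp A0 * real n powr - (\<Delta> / 2)" for n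
  define B where "B n = (1 / g) ^ k * (real n powr - 1 + 2
      * (real n powr (D + 1) * exp (- (2 * \<mu>\<^sup>2 * real n powr (\<epsilon> / 2)))))" for n
  show thesis
  proof (rule that[of z \<delta> d t1 n0 E B])
    show "1 \<le> z" "z \<le> 1 + \<mu>" "0 < \<delta>" using z \<delta> by auto
    show "0 \<le> d n" for n by (simp add: d_def)
    show "0 \<le> E n" for n using g by (simp add: E_def)
    show "0 \<le> B n" for n using g by (simp add: B_def)
    show "poly_small E" unfolding E_def
      by (intro poly_small_cmult poly_smallI[of "\<Delta> / 2" _ 1]) (use \<Delta> in auto)
    show "poly_small B" unfolding B_def using \<mu> \<epsilon>
      by (intro poly_small_cmult poly_small_add poly_small_stretched poly_smallI[of 1 _ 1]) auto
    show "poly_small (\<lambda>n. d n * (1 + ln (real n)))"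
      unfolding d_def using \<epsilon> by (intro poly_small_powr_ln) auto
    show "poly_small (\<lambda>n. (1 + ln (real n)) / real (n0 n))"
    proof (rule poly_small_mono[OF poly_small_powr_ln[OF \<epsilon>(1)], where D = 1])
      show "eventually (\<lambda>n. \<bar>(1 + ln (real n)) / real (n0 n)\<bar> \<le> 1 * \<bar>real n powr - \<epsilon>
          * (1 + ln (real n))\<bar>) sequentially"
        using eventually_ge_at_top[of 1]
      proof eventually_elim
        case (elim n)
        have p: "0 < real n powr \<epsilon>" using elim by simp
        then have "0 < real (n0 n)" using n0(1)[of n] by linarith
        then have "\<bar>1 + ln (real n)\<bar> / real (n0 n) \<le> \<bar>1 + ln (real n)\<bar> / real n powr \<epsilon>"
          by (intro divide_left_mono mult_pos_pos n0 abs_ge_zero p)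
        then show ?case using elim by (simp add: abs_mult powr_minus divide_inverse mult.commute)
      qed
    qed
    show "eventually (\<lambda>n. admissible \<mu> (d n) \<delta> (t1 n) (n0 n) k \<and> n0 n \<le> n) sequentially"
    proof -
      have "eventually (\<lambda>n. real n powr - (\<epsilon> / 4) \<le> 1/2) sequentially"
        using \<epsilon> by real_asymp
      moreover have "eventually (\<lambda>n. 2 \<le> \<mu> * real n powr \<epsilon>) sequentially"
        using \<epsilon> \<mu> by real_asymp
      moreover have "eventually (\<lambda>n. real k \<le> \<mu> * real n powr (3 * \<epsilon> / 4)) sequentially"
        using \<epsilon> \<mu> by real_asymp
      moreover have "eventually (\<lambda>n. real n powr \<epsilon> + 1 \<le> real n) sequentially"
      proof -
        have "eventually (\<lambda>n. real n powr (1/2) + 1 \<le> real n) sequentially" by real_asymp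
        then show ?thesis using eventually_ge_at_top[of 1]
        proof eventually_elim
          case (elim n)
          have "real n powr \<epsilon> \<le> real n powr (1/2)" using elim \<epsilon> by (intro powr_mono) auto
          then show ?case using elim by simp
        qed
      qed
      ultimately show ?thesis using eventually_ge_at_top[of 1]
      proof eventually_elim
        case (elim n)
        have "\<mu> * real n powr \<epsilon> \<le> \<mu> * real (n0 n)" using n0[of n] \<mu> by (intro mult_left_mono) auto
        then have 1: "2 \<le> \<mu> * real (n0 n)" using elim by linarith
        have "real k \<le> \<mu> * real n powr (3 * \<epsilon> / 4)" using elim by simp
        also have "\<dots> = d n * (\<mu> * real n powr \<epsilon>)"
        proof -
          have "- (\<epsilon> / 4) + \<epsilon> = 3 * \<epsilon> / 4" by simp
          then have "real n powr (3 * \<epsilon> / 4) = d n * real n powr \<epsilon>"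
            unfolding d_def powr_add[symmetric] by simp
          then show ?thesis by simp
        qed
        also have "\<dots> \<le> d n * (\<mu> * real (n0 n))"
          by (rule mult_left_mono[OF \<open>\<mu> * real n powr \<epsilon> \<le> \<mu> * real (n0 n)\<close>]) (simp add: d_def)
        finally have 2: "real k \<le> d n * (\<mu> * real (n0 n))" .
        have "real (n0 n) \<le> real n" using n0[of n] elim by linarith
        then show ?case
          unfolding admissible_def using 1 2 elim \<mu> \<delta> by (auto simp: d_def t1_def)
      qed
    qed
    show "eventually (\<lambda>n. \<forall>e. \<forall>m::nat. real m < c * ln (real n) \<longrightarrow>
      (real (n0 n) + real k) * (early_mass z \<delta> (t1 n) (n0 n) * growth \<mu> z (n0 n) n / z ^ m)
        \<le> E n * (real n * mean_geo e \<mu> m)) sequentially"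
    proof -
      have "eventually (\<lambda>n. real n powr (1/2) + 1 \<le> real n) sequentially" by real_asymp
      then show ?thesis using eventually_ge_at_top[of 1]
      proof eventually_elim
        case (elim n)
        \<comment> \<open>In logarithmic coordinates all factors are exponentials and the exponents add up.\<close>
        define X where "X = ln (real n)"
        define Y where "Y = ln (real (n0 n))"
        have n: "0 < real n" using elim by simp
        have X: "0 \<le> X" "real n = exp X" using elim by (auto simp: X_def)
        have nX: "real n powr a = exp (a * X)" for a using n by (simp add: powr_def X_def)
        have n1: "1 \<le> real n powr \<epsilon>" using elim \<epsilon> by (simp add: ge_one_powr_ge_zero)
        have n0p: "1 \<le> real (n0 n)" using n1 n0[of n] by linarith
        have Y: "0 \<le> Y" "real (n0 n) = exp Y" using n0p by (auto simp: Y_def)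
        have YX: "Y \<le> 1 + \<epsilon> * X"
        proof -
          have "real (n0 n) \<le> 2 * real n powr \<epsilon>" using n0[of n] n1 by linarith
          also have "\<dots> \<le> exp 1 * exp (\<epsilon> * X)"
            unfolding nX using exp_ge_add_one_self[of 1] by (intro mult_right_mono) auto
          finally show ?thesis unfolding Y(2) by (simp add: exp_add[symmetric])
        qed
        have n0n: "n0 n \<le> n"
        proof -
          have "real n powr \<epsilon> \<le> real n powr (1/2)" using elim \<epsilon> by (intro powr_mono) auto
          then have "real (n0 n) \<le> real n" using n0[of n] elim by linarith
          then show ?thesis by simp
        qed
        have t1: "real (t1 n) \<le> \<gamma> * X + 2"
        proof -
          have "0 \<le> \<gamma> * X" using \<gamma> X(1) by simp
          then have "real (nat \<lceil>\<gamma> * X\<rceil>) = of_int \<lceil>\<gamma> * X\<rceil>" by simp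
          then show ?thesis unfolding t1_def X_def[symmetric] by linarith
        qed
        have y: "early_mass z \<delta> (t1 n) (n0 n) \<le> exp (2 * (\<gamma> * X + 2)) * exp (2 / \<delta> * (2 + \<epsilon> * X))"
        proof -
          have "early_mass z \<delta> (t1 n) (n0 n) \<le> (1 + z) ^ t1 n * exp (z / \<delta> * (1 + Y))"
            unfolding Y_def using z \<delta> n0p by (intro early_mass_le) (auto simp: t1_def)
          also have "\<dots> \<le> exp (2 * (\<gamma> * X + 2)) * exp (2 / \<delta> * (2 + \<epsilon> * X))"
          proof (intro mult_mono)
            have "1 + z \<le> exp 2" using exp_ge_add_one_self[of 2] z \<mu> by linarith
            then have "(1 + z) ^ t1 n \<le> exp 2 ^ t1 n" using z by (intro power_mono) auto
            also have "\<dots> = exp (2 * real (t1 n))"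
                by (simp add: exp_of_nat_mult[symmetric] mult.commute)
            also have "\<dots> \<le> exp (2 * (\<gamma> * X + 2))" using t1 by simp
            finally show "(1 + z) ^ t1 n \<le> exp (2 * (\<gamma> * X + 2))" .
            have "z / \<delta> * (1 + Y) \<le> 2 / \<delta> * (2 + \<epsilon> * X)"
              using z(1) z2 \<delta>(1) Y(1) YX by (intro mult_mono divide_right_mono) simp_all
            then show "exp (z / \<delta> * (1 + Y)) \<le> exp (2 / \<delta> * (2 + \<epsilon> * X))" by simp
          qed auto
          finally show ?thesis .
        qed
        have G: "growth \<mu> z (n0 n) n \<le> exp (1 + b * (X - Y))"
        proof -
          have "growth \<mu> z (n0 n) n \<le> exp b * (real n / real (n0 n)) powr b"
            unfolding b_def using z \<mu> n0p n0n by (intro growth_le) auto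
          also have "(real n / real (n0 n)) powr b = exp (b * (X - Y))"
            unfolding X(2) Y(2) exp_diff[symmetric] by (simp add: powr_def)
          also have "exp b * \<dots> \<le> exp 1 * exp (b * (X - Y))" using b by (intro mult_right_mono) auto
          finally show ?thesis by (simp add: exp_add)
        qed
        have y0: "0 \<le> early_mass z \<delta> (t1 n) (n0 n)"
          using early_mass_ge_1[OF \<delta>(1) z(1), of "t1 n" "n0 n"] by linarith
        have G0: "0 \<le> growth \<mu> z (n0 n) n" using growth_pos[OF \<mu>(1) z(1), of "n0 n" n] by simp
        have all: "(real (n0 n) + real k) * (early_mass z \<delta> (t1 n) (n0 n) * growth \<mu> z (n0 n) n)
            \<le> real (k + 1) * exp A0 * exp ((2 * \<gamma> + 2 * \<epsilon> / \<delta> + b + \<epsilon>) * X)"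
        proof -
          have k: "real (n0 n) + real k \<le> real (k + 1) * exp Y"
          proof -
            have "real k * 1 \<le> real k * real (n0 n)" using n0p by (intro mult_left_mono) auto
            then show ?thesis unfolding Y(2)[symmetric] by (simp add: distrib_right)
          qed
          have "(real (n0 n) + real k) * (early_mass z \<delta> (t1 n) (n0 n) * growth \<mu> z (n0 n) n)
            \<le> (real (k + 1) * exp Y) * ((exp (2 * (\<gamma> * X + 2)) * exp (2 / \<delta> * (2 + \<epsilon> * X)))
                * exp (1 + b * (X - Y)))"
            using k y G y0 G0 by (intro mult_mono mult_nonneg_nonneg) auto
          also have "\<dots> = real (k + 1) * exp (Y
              + (2 * (\<gamma> * X + 2) + 2 / \<delta> * (2 + \<epsilon> * X) + (1 + b * (X - Y))))"
            by (simp only: exp_add mult.assoc)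
          also have "\<dots> \<le> real (k + 1) * exp (A0 + (2 * \<gamma> + 2 * \<epsilon> / \<delta> + b + \<epsilon>) * X)"
          proof -
            have "(1 - b) * Y \<le> 1 * Y" using b Y by (intro mult_right_mono) auto
            then have "(1 - b) * Y \<le> 1 + \<epsilon> * X" using YX by linarith
            then have "Y + (2 * (\<gamma> * X + 2) + 2 / \<delta> * (2 + \<epsilon> * X) + (1 + b * (X - Y)))
                \<le> A0 + (2 * \<gamma> + 2 * \<epsilon> / \<delta> + b + \<epsilon>) * X"
              by (simp add: A0_def algebra_simps)
            then show ?thesis by (intro mult_left_mono) auto
          qed
          finally show ?thesis by (simp add: exp_add)
        qed
        show ?case
        proof (intro allI impI)
          fix e and m :: nat assume m: "real m < c * ln (real n)"
          have inv: "1 / z ^ m \<le> mean_geo e \<mu> m / g * exp ((s + \<xi>) * (c * X))"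
          proof -
            have zm: "z ^ m = exp ((ln (1 + \<mu>) - s) * real m)"
            proof -
              have "z = exp (ln (1 + \<mu>) - s)" using zs \<mu>
                  by (simp add: exp_diff exp_minus field_simps)
              then show ?thesis by (simp add: exp_of_nat_mult[symmetric] mult.commute)
            qed
            have "1 / z ^ m = exp (- (\<xi> + ln (1 + \<mu>)) * real m) * exp ((s + \<xi>) * real m)"
            proof -
              have "exp (- (\<xi> + ln (1 + \<mu>)) * real m) * exp ((s + \<xi>) * real m)
                  = exp (- ((ln (1 + \<mu>) - s) * real m))"
                unfolding mult_exp_exp by (simp add: algebra_simps)
              then show ?thesis unfolding zm by (simp only: exp_minus divide_inverse mult_1_left)
            qed
            also have "\<dots> \<le> (mean_geo e \<mu> m / g) * exp ((s + \<xi>) * (c * X))"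
            proof (rule mult_mono)
              show "exp (- (\<xi> + ln (1 + \<mu>)) * real m) \<le> mean_geo e \<mu> m / g"
                using geo_ge[of m e] g(1) by (simp only: pos_le_divide_eq mult.commute)
              have "(s + \<xi>) * real m \<le> (s + \<xi>) * (c * X)"
                using m s \<xi> unfolding X_def by (intro mult_left_mono) simp_all
              then show "exp ((s + \<xi>) * real m) \<le> exp ((s + \<xi>) * (c * X))"
                by (simp only: exp_le_cancel_iff)
              show "0 \<le> mean_geo e \<mu> m / g" using mean_geo_bounds(1)[OF \<mu>(1), of e m] g(1) by simp
            qed simp
            finally show ?thesis .
          qed
          have "(real (n0 n) + real k) * (early_mass z \<delta> (t1 n) (n0 n) * growth \<mu> z (n0 n) n
              / z ^ m)
              = ((real (n0 n) + real k) * (early_mass z \<delta> (t1 n) (n0 n) * growth \<mu> z (n0 n) n))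
                  * (1 / z ^ m)"
            by simp
          also have "\<dots> \<le> (real (k + 1) * exp A0 * exp ((2 * \<gamma> + 2 * \<epsilon> / \<delta> + b + \<epsilon>) * X))
              * (mean_geo e \<mu> m / g * exp ((s + \<xi>) * (c * X)))"
            by (rule mult_mono[OF all inv]) (use z in simp_all)
          also have "\<dots> = (real (k + 1) / g * exp A0) * mean_geo e \<mu> m
              * exp ((2 * \<gamma> + 2 * \<epsilon> / \<delta> + b + \<epsilon>) * X + (s + \<xi>) * (c * X))"
            by (simp add: exp_add)
          also have "\<dots> \<le> (real (k + 1) / g * exp A0) * mean_geo e \<mu> m * exp (- (\<Delta> / 2) * X + X)"
          proof (rule mult_left_mono)
            have "2 * \<gamma> + 2 * \<epsilon> / \<delta> + b + \<epsilon> + (s + \<xi>) * c = \<Delta> / 8 + \<epsilon> * (1 + 2 / \<delta>) + \<Delta> / 8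
                + (1 - \<Delta>)"
            proof -
              have "\<xi> * c = \<Delta> / 8" using c(1) by (simp add: \<xi>_def)
              then have "(s + \<xi>) * c = c * s + \<Delta> / 8"
                  by (simp add: distrib_right mult.commute[of s c])
              moreover have "\<epsilon> * (1 + 2 / \<delta>) = \<epsilon> + 2 * \<epsilon> / \<delta>" by (simp add: distrib_left)
              moreover have "c * s = 1 - b - \<Delta>" by (simp add: \<Delta>_def)
              moreover have "2 * \<gamma> = \<Delta> / 8" by (simp add: \<gamma>_def)
              ultimately show ?thesis by linarith
            qed
            also have "\<dots> \<le> 1 - \<Delta> / 2" using \<epsilon>\<Delta> \<Delta> by linarith
            finally have "(2 * \<gamma> + 2 * \<epsilon> / \<delta> + b + \<epsilon> + (s + \<xi>) * c) * X \<le> (1 - \<Delta> / 2) * X"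
              using X by (intro mult_right_mono) auto
            then show "exp ((2 * \<gamma> + 2 * \<epsilon> / \<delta> + b + \<epsilon>) * X + (s + \<xi>) * (c * X))
                \<le> exp (- (\<Delta> / 2) * X + X)"
              by (simp add: algebra_simps)
            show "0 \<le> real (k + 1) / g * exp A0 * mean_geo e \<mu> m"
              using g mean_geo_bounds(1)[OF \<mu>(1), of e m] by simp
          qed
          also have "\<dots> = E n * (real n * mean_geo e \<mu> m)"
            unfolding E_def nX exp_add X(2)[symmetric] by (simp add: mult_ac)
          finally show "(real (n0 n) + real k)
              * (early_mass z \<delta> (t1 n) (n0 n) * growth \<mu> z (n0 n) n / z ^ m)
              \<le> E n * (real n * mean_geo e \<mu> m)" .
        qed
      qed
    qed
    show "eventually (\<lambda>n. \<forall>e. \<forall>m::nat \<Rightarrow> nat. (\<forall>l\<in>{1..k}. real (m l) < c * ln (real n)) \<longrightarrow>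
      prob (space M - good_event \<mu> (d n) \<delta> (t1 n) (n0 n) n) \<le> B n * (\<Prod>l=1..k. mean_geo e \<mu> (m l)))
          sequentially"
    proof -
      have "eventually (\<lambda>n. real n powr (1/2) + 1 \<le> real n) sequentially" by real_asymp
      then show ?thesis using eventually_ge_at_top[of 1]
      proof eventually_elim
        case (elim n)
        define X where "X = ln (real n)"
        have n: "0 < real n" using elim by simp
        have X: "0 \<le> X" "real n = exp X" using elim by (auto simp: X_def)
        have nX: "real n powr a = exp (a * X)" for a using n by (simp add: powr_def X_def)
        have n1: "1 \<le> real n powr \<epsilon>" using elim \<epsilon> by (simp add: ge_one_powr_ge_zero)
        have n0p: "1 \<le> n0 n" using n1 n0[of n] by linarith
        have n0n: "n0 n \<le> n"
        proof -
          have "real n powr \<epsilon> \<le> real n powr (1/2)" using elim \<epsilon> by (intro powr_mono) auto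
          then have "real (n0 n) \<le> real n" using n0[of n] elim by linarith
          then show ?thesis by simp
        qed
        have d0: "0 < d n" using n by (simp add: d_def)
        define beta where "beta = real n powr - 1 + 2
            * (real n powr (D + 1) * exp (- (2 * \<mu>\<^sup>2 * real n powr (\<epsilon> / 2))))"
        have bad: "prob (space M - good_event \<mu> (d n) \<delta> (t1 n) (n0 n) n) \<le> beta * exp (- D * X)"
        proof -
          have "prob (space M - good_event \<mu> (d n) \<delta> (t1 n) (n0 n) n)
              \<le> real n * exp (- K * real (t1 n)) + 2 * real n
                  * exp (- 2 * (d n * \<mu>)\<^sup>2 * real (n0 n))"
            by (rule bad_event_prob[OF mean \<mu>(1) d0 n0p n0n less_imp_le[OF K] \<delta>(2)])
          also have "\<dots> \<le> exp (- 1 * X) * exp (- D * X) + 2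
              * (exp ((D + 1) * X) * exp (- (2 * \<mu>\<^sup>2 * real n powr (\<epsilon> / 2)))) * exp (- D * X)"
          proof (rule add_mono)
            have "\<gamma> * X \<le> real (nat \<lceil>\<gamma> * X\<rceil>)" by (rule real_nat_ceiling_ge)
            then have "\<gamma> * X \<le> real (t1 n)" unfolding t1_def X_def[symmetric] by simp
            then have "K * (\<gamma> * X) \<le> K * real (t1 n)" using K by (intro mult_left_mono) auto
            moreover have "K * (\<gamma> * X) = (D + 2) * X" using \<gamma> by (simp add: K_def)
            ultimately have "X + - K * real (t1 n) \<le> - 1 * X + - D * X" by (simp add: algebra_simps)
            then show "real n * exp (- K * real (t1 n)) \<le> exp (- 1 * X) * exp (- D * X)"
              unfolding X(2) exp_add[symmetric] by (simp only: exp_le_cancel_iff)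
            have "real n powr (\<epsilon> / 2) = (d n)\<^sup>2 * real n powr \<epsilon>"
              unfolding d_def nX power2_eq_square mult_exp_exp by (simp add: algebra_simps)
            also have "\<dots> \<le> (d n)\<^sup>2 * real (n0 n)" using n0[of n] by (intro mult_left_mono) auto
            finally have "\<mu>\<^sup>2 * real n powr (\<epsilon> / 2) \<le> \<mu>\<^sup>2 * ((d n)\<^sup>2 * real (n0 n))"
                by (intro mult_left_mono) auto
            then have "exp (- 2 * (d n * \<mu>)\<^sup>2 * real (n0 n))
                \<le> exp (- (2 * \<mu>\<^sup>2 * real n powr (\<epsilon> / 2)))"
              by (simp add: power_mult_distrib mult_ac)
            then have "2 * exp X * exp (- 2 * (d n * \<mu>)\<^sup>2 * real (n0 n)) \<le> 2 * exp X
                * exp (- (2 * \<mu>\<^sup>2 * real n powr (\<epsilon> / 2)))"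
              by (intro mult_left_mono) auto
            also have "\<dots> = 2 * (exp ((D + 1) * X) * exp (- (2 * \<mu>\<^sup>2 * real n powr (\<epsilon> / 2))))
                * exp (- D * X)"
            proof -
              have "exp X = exp ((D + 1) * X) * exp (- D * X)"
                unfolding mult_exp_exp by (simp add: algebra_simps)
              then show ?thesis by (simp only: mult_ac)
            qed
            finally show "2 * real n * exp (- 2 * (d n * \<mu>)\<^sup>2 * real (n0 n))
                \<le> 2 * (exp ((D + 1) * X) * exp (- (2 * \<mu>\<^sup>2 * real n powr (\<epsilon> / 2)))) * exp (- D * X)"
              using X(2) by simp
          qed
          also have "\<dots> = beta * exp (- D * X)" unfolding beta_def nX by (simp add: distrib_right)
          finally show ?thesis .
        qed
        have beta0: "0 \<le> beta" by (simp add: beta_def)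
        show ?case
        proof (intro allI impI)
          fix e and m :: "nat \<Rightarrow> nat" assume m: "\<forall>l\<in>{1..k}. real (m l) < c * ln (real n)"
          have "(\<Prod>l=1..k. g * exp (- (c * (\<xi> + ln (1 + \<mu>)) * X))) \<le> (\<Prod>l=1..k. mean_geo e \<mu> (m l))"
          proof (rule prod_mono, rule conjI)
            fix l assume l: "l \<in> {1..k}"
            have "(\<xi> + ln (1 + \<mu>)) * real (m l) \<le> (\<xi> + ln (1 + \<mu>)) * (c * X)"
              using m l \<xi> \<mu> by (intro mult_left_mono) (auto simp: X_def less_imp_le)
            note cm = this
            have "g * exp (- (c * (\<xi> + ln (1 + \<mu>)) * X)) \<le> g
                * exp (- (\<xi> + ln (1 + \<mu>)) * real (m l))"
            proof (rule mult_left_mono)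
              have "- (c * A * X) \<le> - A * real (m l)" if "A * real (m l) \<le> A * (c * X)" for A
                using that by (simp add: mult_ac)
              from this[OF cm]
              show "exp (- (c * (\<xi> + ln (1 + \<mu>)) * X)) \<le> exp (- (\<xi> + ln (1 + \<mu>)) * real (m l))"
                by (simp only: exp_le_cancel_iff)
            qed (use g in simp)
            also have "\<dots> \<le> mean_geo e \<mu> (m l)" by (rule geo_ge)
            finally show "g * exp (- (c * (\<xi> + ln (1 + \<mu>)) * X)) \<le> mean_geo e \<mu> (m l)" .
            show "0 \<le> g * exp (- (c * (\<xi> + ln (1 + \<mu>)) * X))" using g by simp
          qed
          also have "(\<Prod>l=1..k. g * exp (- (c * (\<xi> + ln (1 + \<mu>)) * X))) = g ^ k * exp (- D * X)"
            by (simp add: power_mult_distrib exp_of_nat_mult[symmetric] D_def mult_ac)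
          finally have T: "g ^ k * exp (- D * X) \<le> (\<Prod>l=1..k. mean_geo e \<mu> (m l))" .
          have "prob (space M - good_event \<mu> (d n) \<delta> (t1 n) (n0 n) n) \<le> beta * exp (- D * X)"
              by (rule bad)
          also have "\<dots> = (1 / g) ^ k * beta * (g ^ k * exp (- D * X))" using g
              by (simp add: power_divide)
          also have "\<dots> \<le> (1 / g) ^ k * beta * (\<Prod>l=1..k. mean_geo e \<mu> (m l))"
            using T beta0 g by (intro mult_left_mono) auto
          also have "(1 / g) ^ k * beta = B n" by (simp add: B_def beta_def)
          finally show "prob (space M - good_event \<mu> (d n) \<delta> (t1 n) (n0 n) n) \<le> B n
              * (\<Prod>l=1..k. mean_geo e \<mu> (m l))" .
        qed
      qed
    qed
  qed
qed

end

section \<open>Asymptotics of the degrees\<close>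

context bounded_wrt
begin

text \<open>The probability of interest times the number of choices of \<open>k\<close> distinct vertices.\<close>

definition degree_sum :: "bool \<Rightarrow> nat \<Rightarrow> nat \<Rightarrow> (nat \<Rightarrow> nat) \<Rightarrow> real"
  where "degree_sum e k n m = (\<Sum>J\<in>injections {1..k} {1..n}. prob (deg_event e {1..k} J n m))"

lemma degree_sum_asymp_upper:
  assumes mean: "\<mu> = (\<integral>x. W x \<partial>P)" and \<mu>: "0 < \<mu>" "\<mu> \<le> 1"
    and sup: "Sup {x::real. weight.prob {\<omega> \<in> space P. W \<omega> \<le> x} < 1} = 1"
    and c: "0 < c" "c < (1 + \<mu>) / \<mu>"
  obtains f where "near_one f"
    "eventually (\<lambda>n. \<forall>m. (\<forall>l\<in>{1..k}. real (m l) < c * ln (real n)) \<longrightarrow>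
      degree_sum e k n m \<le> real n ^ k * (\<Prod>l=1..k. mean_geo e \<mu> (m l)) * f n) sequentially"
proof -
  obtain z \<delta> n0 t1 d E B where z: "1 \<le> z" "z \<le> 1 + \<mu>" and \<delta>: "0 < \<delta>"
    and adm: "eventually (\<lambda>n. admissible \<mu> (d n) \<delta> (t1 n) (n0 n) k \<and> n0 n \<le> n) sequentially"
    and d: "poly_small (\<lambda>n. d n * (1 + ln (real n)))" "\<And>n. 0 \<le> d n"
    and "poly_small (\<lambda>n. (1 + ln (real n)) / real (n0 n))"
    and E: "poly_small E" "\<And>n. 0 \<le> E n" and B: "poly_small B" "\<And>n. 0 \<le> B n"
    and evE: "eventually (\<lambda>n. \<forall>e. \<forall>m::nat. real m < c * ln (real n) \<longrightarrow>
      (real (n0 n) + real k) * (early_mass z \<delta> (t1 n) (n0 n) * growth \<mu> z (n0 n) n / z ^ m)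
        \<le> E n * (real n * mean_geo e \<mu> m)) sequentially"
    and evB: "eventually (\<lambda>n. \<forall>e. \<forall>m::nat \<Rightarrow> nat. (\<forall>l\<in>{1..k}. real (m l) < c * ln (real n)) \<longrightarrow>
      prob (space M - good_event \<mu> (d n) \<delta> (t1 n) (n0 n) n) \<le> B n * (\<Prod>l=1..k. mean_geo e \<mu> (m l)))
          sequentially"
    by (rule asymptotic_frame[OF mean \<mu> sup c, of k]) blast
  define C where "C = 2 * real k / \<mu> + 4 * real k * c"
  define f where "f n = exp (C * (d n * (1 + ln (real n)))) * (1 + E n) ^ k + B n" for n
  have "near_one f" unfolding f_def
    by (intro near_one_add near_one_mult near_one_exp near_one_power near_one_one_plus
        poly_small_cmult d E B)
  moreover have "eventually (\<lambda>n. \<forall>m. (\<forall>l\<in>{1..k}. real (m l) < c * ln (real n)) \<longrightarrow>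
      degree_sum e k n m \<le> real n ^ k * (\<Prod>l=1..k. mean_geo e \<mu> (m l)) * f n) sequentially"
    using adm evE evB eventually_ge_at_top[of 1]
  proof eventually_elim
    case (elim n)
    show ?case
    proof (intro allI impI)
      fix m :: "nat \<Rightarrow> nat" assume m: "\<forall>l\<in>{1..k}. real (m l) < c * ln (real n)"
      let ?y = "early_mass z \<delta> (t1 n) (n0 n)"
      let ?bad = "prob (space M - good_event \<mu> (d n) \<delta> (t1 n) (n0 n) n)"
      define T where "T = (\<Prod>l=1..k. mean_geo e \<mu> (m l))"
      define X where "X = ln (real n)"
      have X: "0 \<le> X" using elim by (simp add: X_def)
      have mg: "0 \<le> mean_geo e \<mu> i" for i using mean_geo_bounds[OF \<mu>(1)] by simp
      have T0: "0 \<le> T" unfolding T_def using mg by (intro prod_nonneg) auto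
      have a: "admissible \<mu> (d n) \<delta> (t1 n) (n0 n) (card {1..k})" "n0 n \<le> n" using elim by auto
      have n0: "1 \<le> n0 n" using a \<mu> by (cases "n0 n") (auto simp: admissible_def)
      have y0: "0 \<le> ?y * growth \<mu> z (n0 n) n / z ^ i" for i
        using early_mass_ge_1[OF \<delta> z(1), of "t1 n" "n0 n"] growth_pos[OF \<mu>(1) z(1), of "n0 n" n] z
            by simp
      have A: "(\<Prod>s=n0 n..<n. 1 + 2 * d n * real (card {1..k}) / (\<mu> * real s))
          \<le> exp (2 * real k / \<mu> * (d n * (1 + X)))"
      proof -
        have "(\<Prod>s=n0 n..<n. 1 + 2 * d n * real (card {1..k}) / (\<mu> * real s))
            = (\<Prod>s=n0 n..<n. 1 + (2 * d n * real k / \<mu>) / real s)"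
          by simp
        also have "\<dots> \<le> exp (2 * d n * real k / \<mu> * (1 + ln (real n) - ln (real (n0 n))))"
          using n0 a d \<mu> by (intro prod_one_plus_le) auto
        also have "\<dots> \<le> exp (2 * d n * real k / \<mu> * (1 + X))"
          unfolding exp_le_cancel_iff X_def using d(2)[of n] \<mu> n0 by (intro mult_left_mono) auto
        also have "2 * d n * real k / \<mu> * (1 + X) = 2 * real k / \<mu> * (d n * (1 + X))" by simp
        finally show ?thesis .
      qed
      have M: "exp (4 * d n) ^ (\<Sum>l\<in>{1..k}. m l) \<le> exp (4 * real k * c * (d n * (1 + X)))"
      proof -
        have "real (\<Sum>l\<in>{1..k}. m l) \<le> (\<Sum>l\<in>{1..k}. c * X)"
          unfolding of_nat_sum using m by (intro sum_mono) (auto simp: X_def less_imp_le)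
        also have "\<dots> \<le> real k * c * (1 + X)" using c(1) by (simp add: distrib_left mult.assoc)
        finally have "4 * d n * real (\<Sum>l\<in>{1..k}. m l) \<le> 4 * d n * (real k * c * (1 + X))"
          using d(2)[of n] by (intro mult_left_mono) auto
        then show ?thesis by (simp add: exp_of_nat_mult[symmetric] mult_ac)
      qed
      have prod: "(\<Prod>l\<in>{1..k}. real n * mean_geo e \<mu> (m l) + real (n0 n)
          * (?y * growth \<mu> z (n0 n) n / z ^ m l))
          \<le> real n ^ k * T * (1 + E n) ^ k"
      proof -
        have "(\<Prod>l\<in>{1..k}. real n * mean_geo e \<mu> (m l) + real (n0 n)
            * (?y * growth \<mu> z (n0 n) n / z ^ m l))
            \<le> (\<Prod>l\<in>{1..k}. real n * mean_geo e \<mu> (m l) * (1 + E n))"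
        proof (rule prod_mono, rule conjI)
          fix l assume l: "l \<in> {1..k}"
          show "0 \<le> real n * mean_geo e \<mu> (m l) + real (n0 n)
              * (?y * growth \<mu> z (n0 n) n / z ^ m l)"
            by (intro add_nonneg_nonneg mult_nonneg_nonneg mg y0 of_nat_0_le_iff)
          have "real (n0 n) * (?y * growth \<mu> z (n0 n) n / z ^ m l)
              \<le> (real (n0 n) + real k) * (?y * growth \<mu> z (n0 n) n / z ^ m l)"
            using y0 by (intro mult_right_mono) auto
          also have "\<dots> \<le> E n * (real n * mean_geo e \<mu> (m l))" using elim m l by blast
          finally show "real n * mean_geo e \<mu> (m l) + real (n0 n)
              * (?y * growth \<mu> z (n0 n) n / z ^ m l)
              \<le> real n * mean_geo e \<mu> (m l) * (1 + E n)"
            by (simp add: algebra_simps)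
        qed
        also have "\<dots> = real n ^ k * T * (1 + E n) ^ k"
          by (simp add: prod.distrib T_def)
        finally show ?thesis .
      qed
      have prod0: "0 \<le> (\<Prod>l\<in>{1..k}. real n * mean_geo e \<mu> (m l) + real (n0 n)
          * (?y * growth \<mu> z (n0 n) n / z ^ m l))"
        by (intro prod_nonneg ballI add_nonneg_nonneg mult_nonneg_nonneg mg y0 of_nat_0_le_iff)
      have "degree_sum e k n m \<le> (\<Prod>s=n0 n..<n. 1 + 2 * d n * real (card {1..k}) / (\<mu> * real s))
          * exp (4 * d n) ^ (\<Sum>l\<in>{1..k}. m l)
          * (\<Prod>l\<in>{1..k}. real n * mean_geo e \<mu> (m l) + real (n0 n)
              * (?y * growth \<mu> z (n0 n) n / z ^ m l))
          + real n ^ card {1..k} * ?bad"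
        unfolding degree_sum_def by (rule degree_sum_upper[OF a(1) finite_atLeastAtMost z(1) a(2)])
      also have "\<dots> \<le> exp (2 * real k / \<mu> * (d n * (1 + X))) * exp (4 * real k * c * (d n * (1 + X)))
          * (real n ^ k * T * (1 + E n) ^ k) + real n ^ k * (B n * T)"
      proof (rule add_mono)
        show "(\<Prod>s=n0 n..<n. 1 + 2 * d n * real (card {1..k}) / (\<mu> * real s))
            * exp (4 * d n) ^ (\<Sum>l\<in>{1..k}. m l)
          * (\<Prod>l\<in>{1..k}. real n * mean_geo e \<mu> (m l) + real (n0 n)
              * (?y * growth \<mu> z (n0 n) n / z ^ m l))
          \<le> exp (2 * real k / \<mu> * (d n * (1 + X))) * exp (4 * real k * c * (d n * (1 + X)))
              * (real n ^ k * T * (1 + E n) ^ k)"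
          by (rule mult_mono[OF mult_mono[OF A M] prod])
             (rule prod0 exp_ge_zero zero_le_power mult_nonneg_nonneg)+
        have "?bad \<le> B n * T" unfolding T_def using elim m by blast
        then show "real n ^ card {1..k} * ?bad \<le> real n ^ k * (B n * T)"
          by (simp add: mult_left_mono)
      qed
      also have "\<dots> = real n ^ k * T * f n"
      proof -
        have "exp (2 * real k / \<mu> * (d n * (1 + X))) * exp (4 * real k * c * (d n * (1 + X)))
            = exp (C * (d n * (1 + X)))"
          unfolding mult_exp_exp C_def by (simp only: distrib_right)
        then show ?thesis unfolding f_def X_def by (simp add: algebra_simps)
      qed
      finally show "degree_sum e k n m \<le> real n ^ k * (\<Prod>l=1..k. mean_geo e \<mu> (m l)) * f n"
        by (simp add: T_def)
    qed
  qed
  ultimately show thesis by (rule that)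
qed

lemma degree_sum_asymp_lower:
  assumes mean: "\<mu> = (\<integral>x. W x \<partial>P)" and \<mu>: "0 < \<mu>" "\<mu> \<le> 1"
    and sup: "Sup {x::real. weight.prob {\<omega> \<in> space P. W \<omega> \<le> x} < 1} = 1"
    and c: "0 < c" "c < (1 + \<mu>) / \<mu>"
  obtains f where "near_one f"
    "eventually (\<lambda>n. \<forall>m. (\<forall>l\<in>{1..k}. real (m l) < c * ln (real n)) \<longrightarrow>
      real n ^ k * (\<Prod>l=1..k. mean_geo True \<mu> (m l)) * f n \<le> degree_sum True k n m) sequentially"
proof -
  obtain z \<delta> n0 t1 d E B where z: "1 \<le> z" "z \<le> 1 + \<mu>" and \<delta>: "0 < \<delta>"
    and adm: "eventually (\<lambda>n. admissible \<mu> (d n) \<delta> (t1 n) (n0 n) k \<and> n0 n \<le> n) sequentially"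
    and d: "poly_small (\<lambda>n. d n * (1 + ln (real n)))" "\<And>n. 0 \<le> d n"
    and N: "poly_small (\<lambda>n. (1 + ln (real n)) / real (n0 n))"
    and E: "poly_small E" "\<And>n. 0 \<le> E n" and B: "poly_small B" "\<And>n. 0 \<le> B n"
    and evE: "eventually (\<lambda>n. \<forall>e. \<forall>m::nat. real m < c * ln (real n) \<longrightarrow>
      (real (n0 n) + real k) * (early_mass z \<delta> (t1 n) (n0 n) * growth \<mu> z (n0 n) n / z ^ m)
        \<le> E n * (real n * mean_geo e \<mu> m)) sequentially"
    and evB: "eventually (\<lambda>n. \<forall>e. \<forall>m::nat \<Rightarrow> nat. (\<forall>l\<in>{1..k}. real (m l) < c * ln (real n)) \<longrightarrow>
      prob (space M - good_event \<mu> (d n) \<delta> (t1 n) (n0 n) n) \<le> B n * (\<Prod>l=1..k. mean_geo e \<mu> (m l)))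
          sequentially"
    by (rule asymptotic_frame[OF mean \<mu> sup c, of k]) blast
  define f1 where "f1 n = 1 - 4 * real k / \<mu> * (d n * (1 + ln (real n)))" for n
  define f2 where "f2 n = 1 - 4 * real k * c * (d n * (1 + ln (real n)))" for n
  define f3 where "f3 n = 1 - 4 * real k * c / \<mu> * ((1 + ln (real n)) / real (n0 n)) - E n" for n
  define f4 where "f4 n = f3 n ^ k - B n" for n
  have near: "near_one f1" "near_one f2" "near_one f3"
    unfolding f1_def f2_def f3_def
    by (intro near_one_one_minus near_one_diff[OF near_one_one_minus] poly_small_cmult d N E)+
  have near4: "near_one f4" unfolding f4_def by (intro near_one_diff near_one_power near B)
  have "near_one (\<lambda>n. f1 n * f2 n * f4 n)" by (intro near_one_mult near near4)
  moreover have "eventually (\<lambda>n. \<forall>m. (\<forall>l\<in>{1..k}. real (m l) < c * ln (real n)) \<longrightarrow>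
      real n ^ k * (\<Prod>l=1..k. mean_geo True \<mu> (m l)) * (f1 n * f2 n * f4 n) \<le> degree_sum True k n m)
          sequentially"
    using adm evE evB eventually_ge_at_top[of 1] near_one_gt_half[OF near(1)]
        near_one_gt_half[OF near(2)]
      near_one_gt_half[OF near(3)] near_one_gt_half[OF near4]
  proof eventually_elim
    case (elim n)
    show ?case
    proof (intro allI impI)
      fix m :: "nat \<Rightarrow> nat" assume m: "\<forall>l\<in>{1..k}. real (m l) < c * ln (real n)"
      let ?y = "early_mass z \<delta> (t1 n) (n0 n)"
      let ?bad = "prob (space M - good_event \<mu> (d n) \<delta> (t1 n) (n0 n) n)"
      define T where "T = (\<Prod>l=1..k. mean_geo True \<mu> (m l))"
      define X where "X = ln (real n)"
      define N where "N = real k * c * (1 + X)"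
      have X: "0 \<le> X" using elim by (simp add: X_def)
      have mg: "0 \<le> mean_geo True \<mu> i" for i using mean_geo_bounds[OF \<mu>(1)] by simp
      have T0: "0 \<le> T" unfolding T_def using mg by (intro prod_nonneg) auto
      have a: "admissible \<mu> (d n) \<delta> (t1 n) (n0 n) (card {1..k})" "n0 n \<le> n" using elim by auto
      have n0: "1 \<le> n0 n" using a \<mu> by (cases "n0 n") (auto simp: admissible_def)
      have y1: "1 \<le> ?y" by (rule early_mass_ge_1[OF \<delta> z(1)])
      have G0: "0 \<le> growth \<mu> z (n0 n) n / z ^ i" for i
        using growth_pos[OF \<mu>(1) z(1), of "n0 n" n] z by simp
      have sum_m: "real (\<Sum>l\<in>{1..k}. m l) \<le> N"
      proof -
        have "real (\<Sum>l\<in>{1..k}. m l) \<le> (\<Sum>l\<in>{1..k}. c * X)"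
          unfolding of_nat_sum using m by (intro sum_mono) (auto simp: X_def less_imp_le)
        also have "\<dots> \<le> N" using c(1) by (simp add: N_def distrib_left mult.assoc)
        finally show ?thesis .
      qed
      have A: "f1 n \<le> (\<Prod>s=n0 n..<n. 1 - 4 * d n * real (card {1..k}) / (\<mu> * real s))"
      proof -
        have "1 - (\<Sum>s=n0 n..<n. 4 * d n * real (card {1..k}) / (\<mu> * real s))
            \<le> (\<Prod>s=n0 n..<n. 1 - 4 * d n * real (card {1..k}) / (\<mu> * real s))"
          using admissible_small[OF a(1)] d(2)[of n] \<mu> by (intro prod_one_minus_ge) auto
        moreover have "(\<Sum>s=n0 n..<n. 4 * d n * real (card {1..k}) / (\<mu> * real s)) \<le> 4 * real k / \<mu>
            * (d n * (1 + X))"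
        proof -
          have "(\<Sum>s=n0 n..<n. 4 * d n * real (card {1..k}) / (\<mu> * real s)) = 4 * real k / \<mu> * d n
              * (\<Sum>s=n0 n..<n. 1 / real s)"
            unfolding sum_distrib_left by (intro sum.cong refl) (simp add: mult_ac)
          also have "\<dots> \<le> 4 * real k / \<mu> * d n * (1 + X)"
          proof (rule mult_left_mono)
            have "0 \<le> ln (real (n0 n))" using n0 by simp
            then show "(\<Sum>s=n0 n..<n. 1 / real s) \<le> 1 + X"
              using harmonic_le[OF n0 a(2)] unfolding X_def by linarith
            show "0 \<le> 4 * real k / \<mu> * d n" using \<mu> d(2)[of n] by simp
          qed
          finally show ?thesis by (simp add: mult_ac)
        qed
        ultimately show ?thesis unfolding f1_def X_def by linarith
      qed
      have M: "f2 n \<le> exp (- (4 * d n)) ^ (\<Sum>l\<in>{1..k}. m l)"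
      proof -
        have "4 * d n * real (\<Sum>l\<in>{1..k}. m l) \<le> 4 * d n * N"
          using sum_m d(2)[of n] by (intro mult_left_mono) auto
        then have "f2 n \<le> 1 + - (4 * d n * real (\<Sum>l\<in>{1..k}. m l))"
          by (simp add: f2_def N_def X_def mult_ac)
        also have "\<dots> \<le> exp (- (4 * d n * real (\<Sum>l\<in>{1..k}. m l)))" by (rule exp_ge_add_one_self)
        finally show ?thesis by (simp add: exp_of_nat_mult[symmetric] mult_ac)
      qed
      let ?main = "\<Prod>l\<in>{1..k}. max 0 (real n * mean_geo True \<mu> (m l)
          * (1 - 4 * N / (\<mu> * real (n0 n)))
             - (real (n0 n) + real (card {1..k})) * (growth \<mu> z (n0 n) n / z ^ m l))"
      have prod: "real n ^ k * T * f3 n ^ k \<le> ?main"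
      proof -
        have "real n ^ k * T * f3 n ^ k = (\<Prod>l\<in>{1..k}. real n * mean_geo True \<mu> (m l) * f3 n)"
          by (simp add: prod.distrib T_def)
        also have "\<dots> \<le> ?main"
        proof (rule prod_mono, rule conjI)
          fix l assume l: "l \<in> {1..k}"
          show "0 \<le> real n * mean_geo True \<mu> (m l) * f3 n" using mg elim by simp
          have "(real (n0 n) + real k) * (growth \<mu> z (n0 n) n / z ^ m l) \<le> (real (n0 n) + real k)
              * (?y * growth \<mu> z (n0 n) n / z ^ m l)"
            using mult_right_mono[OF y1 G0[of "m l"]] by (intro mult_left_mono) auto
          also have "\<dots> \<le> E n * (real n * mean_geo True \<mu> (m l))" using elim m l by blast
          finally have e: "(real (n0 n) + real k) * (growth \<mu> z (n0 n) n / z ^ m l) \<le> E n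
              * (real n * mean_geo True \<mu> (m l))" .
          have f3: "f3 n = 1 - 4 * N / (\<mu> * real (n0 n)) - E n"
            by (simp add: f3_def N_def X_def)
          have split: "R * (1 - q - E') = R * (1 - q) - E' * R" for R q E' :: real
            by (simp add: algebra_simps)
          have "real n * mean_geo True \<mu> (m l) * f3 n
              = real n * mean_geo True \<mu> (m l) * (1 - 4 * N / (\<mu> * real (n0 n))) - E n
                  * (real n * mean_geo True \<mu> (m l))"
            unfolding f3 by (rule split)
          then show "real n * mean_geo True \<mu> (m l) * f3 n
              \<le> max 0 (real n * mean_geo True \<mu> (m l) * (1 - 4 * N / (\<mu> * real (n0 n)))
             - (real (n0 n) + real (card {1..k})) * (growth \<mu> z (n0 n) n / z ^ m l))"
            using e by simp
        qed
        finally show ?thesis .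
      qed
      have bad: "?bad \<le> B n * T" unfolding T_def using elim m by blast
      have "real n ^ k * T * f4 n = real n ^ k * T * f3 n ^ k - real n ^ k * (B n * T)"
        by (simp add: f4_def algebra_simps)
      also have "\<dots> \<le> ?main - real n ^ card {1..k} * ?bad"
        using prod bad by (intro diff_mono) (simp_all add: mult_left_mono)
      finally have br: "real n ^ k * T * f4 n \<le> ?main - real n ^ card {1..k} * ?bad" .
      have "real n ^ k * T * (f1 n * f2 n * f4 n) = (f1 n * f2 n) * (real n ^ k * T * f4 n)" by simp
      also have "\<dots> \<le> ((\<Prod>s=n0 n..<n. 1 - 4 * d n * real (card {1..k}) / (\<mu> * real s))
          * exp (- (4 * d n)) ^ (\<Sum>l\<in>{1..k}. m l))
          * (?main - real n ^ card {1..k} * ?bad)"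
      proof (rule mult_mono[OF mult_mono[OF A M] br])
        show "0 \<le> (\<Prod>s=n0 n..<n. 1 - 4 * d n * real (card {1..k}) / (\<mu> * real s))" using A elim
            by linarith
        then show "0 \<le> (\<Prod>s=n0 n..<n. 1 - 4 * d n * real (card {1..k}) / (\<mu> * real s))
            * exp (- (4 * d n)) ^ (\<Sum>l\<in>{1..k}. m l)"
          by simp
        show "0 \<le> f2 n" using elim by linarith
        show "0 \<le> real n ^ k * T * f4 n" using T0 elim by simp
      qed
      also have "\<dots> \<le> degree_sum True k n m"
        unfolding degree_sum_def by (rule degree_sum_lower[OF a(1) finite_atLeastAtMost z a(2)
            sum_m])
      finally show "real n ^ k * (\<Prod>l=1..k. mean_geo True \<mu> (m l)) * (f1 n * f2 n * f4 n)
          \<le> degree_sum True k n m"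
        by (simp add: T_def)
    qed
  qed
  ultimately show thesis by (rule that)
qed

text \<open>The events that fix all degrees are disjoint, and those with degrees at least \<open>m\<close> lie in the
tail event.\<close>

lemma degree_sum_tail_ge:
  "(\<Sum>m'\<in>(\<Pi>\<^sub>E l\<in>{1..k}. {m l..<N}). degree_sum True k n m') \<le> degree_sum False k n m"
proof -
  let ?B = "\<Pi>\<^sub>E l\<in>{1..k}. {m l..<N}"
  have fin: "finite ?B" by (intro finite_PiE) auto
  have "(\<Sum>m'\<in>?B. prob (deg_event True {1..k} J n m')) \<le> prob (deg_event False {1..k} J n m)" for J
  proof -
    have "disjoint_family_on (deg_event True {1..k} J n) ?B"
      unfolding disjoint_family_on_def
    proof (intro ballI impI)
      fix m1 m2 assume "m1 \<in> ?B" "m2 \<in> ?B" "m1 \<noteq> m2"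
      then obtain l where "l \<in> {1..k}" "m1 l \<noteq> m2 l" by (metis PiE_ext)
      then show "deg_event True {1..k} J n m1 \<inter> deg_event True {1..k} J n m2 = {}"
        by (auto simp: deg_event_def attains_def)
    qed
    then have "(\<Sum>m'\<in>?B. prob (deg_event True {1..k} J n m'))
        = prob (\<Union>m'\<in>?B. deg_event True {1..k} J n m')"
      using fin deg_event_M[of "{1..k}"] by (intro finite_measure_finite_Union[symmetric]) auto
    also have "\<dots> \<le> prob (deg_event False {1..k} J n m)"
    proof (rule finite_measure_mono)
      show "(\<Union>m'\<in>?B. deg_event True {1..k} J n m') \<subseteq> deg_event False {1..k} J n m"
        by (auto simp: deg_event_def attains_def PiE_def Pi_def)
    qed (rule deg_event_M, simp)
    finally show ?thesis .
  qed
  then have "(\<Sum>J\<in>injections {1..k} {1..n}. \<Sum>m'\<in>?B. prob (deg_event True {1..k} J n m'))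
      \<le> degree_sum False k n m"
    unfolding degree_sum_def by (intro sum_mono)
  then show ?thesis unfolding degree_sum_def by (subst sum.swap)
qed

lemma mean_geo_telescope:
  assumes \<mu>: "0 < \<mu>" and "a \<le> N"
  shows "(\<Sum>i\<in>{a..<N}. mean_geo True \<mu> i) = mean_geo False \<mu> a - mean_geo False \<mu> N"
proof -
  have int: "integrable P (\<lambda>x. geo e \<mu> (W x) i)" for e i
    using geo_nonneg[of \<mu> _ e i] geo_le_power[of \<mu> _ 1 e i] \<mu>
    by (intro W_integrable[OF geo_measurable, where C = 1]) auto
  have "mean_geo True \<mu> i = mean_geo False \<mu> i - mean_geo False \<mu> (Suc i)" for i
  proof -
    have "mean_geo True \<mu> i = (\<integral>x. geo False \<mu> (W x) i - geo False \<mu> (W x) (Suc i) \<partial>P)"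
    proof (rule integral_cong_AE)
      show "AE x in P. geo True \<mu> (W x) i = geo False \<mu> (W x) i - geo False \<mu> (W x) (Suc i)"
        using weight_range
      proof eventually_elim
        case (elim x)
        define r where "r = W x / (\<mu> + W x)"
        have "\<mu> / (\<mu> + W x) = 1 - r" using elim \<mu> by (simp add: r_def field_simps)
        then have "geo True \<mu> (W x) i = (1 - r) * r ^ i" by (simp only: geo_def if_True r_def)
        moreover have "geo False \<mu> (W x) j = r ^ j" for j by (simp add: geo_def r_def)
        ultimately show ?case by (simp add: left_diff_distrib)
      qed
    qed (use int in auto)
    also have "\<dots> = mean_geo False \<mu> i - mean_geo False \<mu> (Suc i)"
      by (rule Bochner_Integration.integral_diff[OF int int])
    finally show ?thesis .
  qed
  then have "(\<Sum>i\<in>{a..<N}. mean_geo True \<mu> i) =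
      (\<Sum>i\<in>{a..<N}. mean_geo False \<mu> i - mean_geo False \<mu> (Suc i))"
    by simp
  also have "\<dots> = mean_geo False \<mu> a - mean_geo False \<mu> N"
    using sum_Suc_diff'[OF assms(2), of "\<lambda>i. - mean_geo False \<mu> i"] by simp
  finally show ?thesis .
qed

lemma mean_geo_decay:
  assumes \<mu>: "0 < \<mu>" "\<mu> \<le> 1" and "a \<le> N"
  shows "mean_geo False \<mu> N \<le> mean_geo False \<mu> a / (1 + \<mu>) ^ (N - a)"
proof -
  have b: "\<bar>geo False \<mu> x i\<bar> \<le> 1" if "0 < x" "x \<le> 1" for x i
    using geo_nonneg[of \<mu> x False i] geo_le_power[of \<mu> x 1 False i] \<mu> that by auto
  have meas: "(\<lambda>x. geo False \<mu> x a * (1 / (1 + \<mu>) ^ (N - a))) \<in> borel_measurable borel"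
    using geo_measurable[of False \<mu> a] by measurable
  have "mean_geo False \<mu> N \<le> (\<integral>x. geo False \<mu> (W x) a * (1 / (1 + \<mu>) ^ (N - a)) \<partial>P)"
  proof (rule W_integral_mono[OF geo_measurable _ meas, where C = 1 and D = 1])
    fix x :: real assume x: "0 < x" "x \<le> 1"
    show "\<bar>geo False \<mu> x N\<bar> \<le> 1" by (rule b[OF x])
    have p: "1 \<le> (1 + \<mu>) ^ (N - a)" using \<mu> by (intro one_le_power) simp
    have "\<bar>geo False \<mu> x a\<bar> * \<bar>1 / (1 + \<mu>) ^ (N - a)\<bar> \<le> 1 * 1"
      using b[OF x, of a] p by (intro mult_mono) auto
    then show "\<bar>geo False \<mu> x a * (1 / (1 + \<mu>) ^ (N - a))\<bar> \<le> 1" by (simp only: abs_mult mult_1)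
    have "geo False \<mu> x N = geo False \<mu> x a * geo False \<mu> x (N - a)"
      using assms by (simp add: geo_def power_add[symmetric])
    also have "\<dots> \<le> geo False \<mu> x a * (1 / (1 + \<mu>) ^ (N - a))"
      using geo_nonneg[of \<mu> x False a] geo_le_power[of \<mu> x "1 + \<mu>" False "N - a"] \<mu> x
      by (intro mult_left_mono) auto
    finally show "geo False \<mu> x N \<le> geo False \<mu> x a * (1 / (1 + \<mu>) ^ (N - a))" .
  qed
  then show ?thesis by simp
qed

text \<open>The bound for single degrees is available up to \<open>c' log n\<close> for some \<open>c' > c\<close>. Cutting the
geometric tails there loses the relative amount \<open>(1 + \<mu>)\<close> to the power \<open>(c - c') log n\<close>, which
is polynomially small.\<close>

lemma degree_sum_asymp_lower_tail:
  assumes mean: "\<mu> = (\<integral>x. W x \<partial>P)" and \<mu>: "0 < \<mu>" "\<mu> \<le> 1"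
    and sup: "Sup {x::real. weight.prob {\<omega> \<in> space P. W \<omega> \<le> x} < 1} = 1"
    and c: "0 < c" "c < (1 + \<mu>) / \<mu>"
  obtains f where "near_one f"
    "eventually (\<lambda>n. \<forall>m. (\<forall>l\<in>{1..k}. real (m l) < c * ln (real n)) \<longrightarrow>
      real n ^ k * (\<Prod>l=1..k. mean_geo False \<mu> (m l)) * f n \<le> degree_sum False k n m) sequentially"
proof -
  \<comment> \<open>Any value strictly between the two bounds would do.\<close>
  define c' where "c' = (c + (1 + \<mu>) / \<mu>) / 2"
  have "x < (x + y) / 2 \<and> (x + y) / 2 < y" if "x < y" for x y :: real using that by simp
  from this[OF c(2)] have c': "c < c'" "0 < c'" "c' < (1 + \<mu>) / \<mu>"
    unfolding c'_def using c(1) by linarith+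
  obtain f where f: "near_one f"
    and ev: "eventually (\<lambda>n. \<forall>m. (\<forall>l\<in>{1..k}. real (m l) < c' * ln (real n)) \<longrightarrow>
      real n ^ k * (\<Prod>l=1..k. mean_geo True \<mu> (m l)) * f n \<le> degree_sum True k n m) sequentially"
    by (rule degree_sum_asymp_lower[OF mean \<mu> sup c'(2,3), of k]) blast
  define a where "a = (c' - c) * ln (1 + \<mu>)"
  have a: "0 < a" using c' \<mu> by (simp add: a_def)
  define h where "h n = real n powr - a" for n :: nat
  have h: "poly_small h" unfolding h_def using a by (intro poly_smallI[of a _ 1]) auto
  have "near_one (\<lambda>n. (1 - h n) ^ k * f n)"
    by (intro near_one_mult near_one_power near_one_one_minus h f)
  moreover have "eventually (\<lambda>n. \<forall>m. (\<forall>l\<in>{1..k}. real (m l) < c * ln (real n)) \<longrightarrow>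
      real n ^ k * (\<Prod>l=1..k. mean_geo False \<mu> (m l)) * ((1 - h n) ^ k * f n)
          \<le> degree_sum False k n m) sequentially"
    using ev near_one_gt_half[OF f] near_one_gt_half[OF near_one_one_minus[OF h]]
        eventually_ge_at_top[of 1]
  proof eventually_elim
    case (elim n)
    show ?case
    proof (intro allI impI)
      fix m :: "nat \<Rightarrow> nat" assume m: "\<forall>l\<in>{1..k}. real (m l) < c * ln (real n)"
      define X where "X = ln (real n)"
      have X: "0 \<le> X" using elim by (simp add: X_def)
      define N where "N = nat \<lceil>c' * X\<rceil>"
      have N: "c' * X \<le> real N" unfolding N_def by (rule real_nat_ceiling_ge)
      have N': "real i < c' * X" if "i < N" for i
        using that unfolding N_def by (simp add: zless_nat_eq_int_zless less_ceiling_iff)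
      have mN: "m l \<le> N" "(c' - c) * X \<le> real (N - m l)" if l: "l \<in> {1..k}" for l
      proof -
        have "real (m l) < c * X" using m l by (simp add: X_def)
        moreover have "c * X \<le> c' * X" using c' X by (intro mult_right_mono) auto
        ultimately have "real (m l) \<le> real N" "(c' - c) * X \<le> real N - real (m l)"
          using N by (auto simp: algebra_simps)
        then show "m l \<le> N" "(c' - c) * X \<le> real (N - m l)" by auto
      qed
      let ?B = "\<Pi>\<^sub>E l\<in>{1..k}. {m l..<N}"
      have mg: "0 \<le> mean_geo e \<mu> i" for e i using mean_geo_bounds[OF \<mu>(1)] by simp
      have one: "mean_geo False \<mu> (m l) * (1 - h n) \<le> (\<Sum>i\<in>{m l..<N}. mean_geo True \<mu> i)"
          if l: "l \<in> {1..k}" for l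
      proof -
        have "h n = exp (- ((c' - c) * X * ln (1 + \<mu>)))"
          using elim by (simp add: h_def powr_def a_def X_def mult_ac)
        moreover have "(1 + \<mu>) ^ (N - m l) = exp (real (N - m l) * ln (1 + \<mu>))"
          using \<mu> by (simp add: exp_of_nat_mult)
        moreover have "(c' - c) * X * ln (1 + \<mu>) \<le> real (N - m l) * ln (1 + \<mu>)"
          using mN(2)[OF l] \<mu> by (intro mult_right_mono) auto
        ultimately have "1 / (1 + \<mu>) ^ (N - m l) \<le> h n"
          by (simp add: exp_minus divide_inverse)
        then have "mean_geo False \<mu> (m l) * (1 / (1 + \<mu>) ^ (N - m l)) \<le> mean_geo False \<mu> (m l)
            * h n"
          using mg by (intro mult_left_mono)
        then have "mean_geo False \<mu> N \<le> mean_geo False \<mu> (m l) * h n"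
          using mean_geo_decay[OF \<mu> mN(1)[OF l]] by simp
        then show ?thesis
          unfolding mean_geo_telescope[OF \<mu>(1) mN(1)[OF l]] by (simp add: algebra_simps)
      qed
      have "real n ^ k * (\<Prod>l=1..k. mean_geo False \<mu> (m l)) * ((1 - h n) ^ k * f n)
          = real n ^ k * f n * (\<Prod>l=1..k. mean_geo False \<mu> (m l) * (1 - h n))"
        by (simp add: prod.distrib)
      also have "\<dots> \<le> real n ^ k * f n * (\<Prod>l=1..k. \<Sum>i\<in>{m l..<N}. mean_geo True \<mu> i)"
        using one mg elim by (intro mult_left_mono prod_mono) (auto intro!: mult_nonneg_nonneg)
      also have "(\<Prod>l=1..k. \<Sum>i\<in>{m l..<N}. mean_geo True \<mu> i)
          = (\<Sum>m'\<in>?B. \<Prod>l=1..k. mean_geo True \<mu> (m' l))"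
        by (rule prod_sum_PiE) auto
      also have "real n ^ k * f n * \<dots> = (\<Sum>m'\<in>?B. real n ^ k * (\<Prod>l=1..k. mean_geo True \<mu> (m' l))
          * f n)"
        by (simp add: sum_distrib_left mult_ac)
      also have "\<dots> \<le> (\<Sum>m'\<in>?B. degree_sum True k n m')"
      proof (rule sum_mono)
        fix m' assume m': "m' \<in> ?B"
        then have "\<forall>l\<in>{1..k}. real (m' l) < c' * ln (real n)"
          using N' by (auto simp: PiE_def Pi_def X_def)
        then show "real n ^ k * (\<Prod>l=1..k. mean_geo True \<mu> (m' l)) * f n \<le> degree_sum True k n m'"
          using elim by blast
      qed
      also have "\<dots> \<le> degree_sum False k n m" by (rule degree_sum_tail_ge)
      finally show "real n ^ k * (\<Prod>l=1..k. mean_geo False \<mu> (m l)) * ((1 - h n) ^ k * f n)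
          \<le> degree_sum False k n m" .
    qed
  qed
  ultimately show thesis by (rule that)
qed

theorem degree_prob_asymp:
  assumes mean: "\<mu> = (\<integral>x. W x \<partial>P)" and \<mu>: "0 < \<mu>" "\<mu> \<le> 1"
    and sup: "Sup {x::real. weight.prob {\<omega> \<in> space P. W \<omega> \<le> x} < 1} = 1"
    and c: "0 < c" "c < (1 + \<mu>) / \<mu>"
    and U: "\<And>n. n \<ge> k \<Longrightarrow> uniform_without_replacement M k n (v n)"
    and I: "\<And>n. n \<ge> k \<Longrightarrow>
          indep_set (sets (vimage_algebra (space M) (\<lambda>\<omega>. \<lambda>l\<in>{1..k}. v n l \<omega>) (count_space UNIV)))
            (sets (history n))"
  obtains u where "poly_small u"
    "eventually (\<lambda>n. \<forall>m. (\<forall>l\<in>{1..k}. real (m l) < c * ln (real n)) \<longrightarrow>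
      (\<exists>\<delta>. \<bar>\<delta>\<bar> \<le> u n \<and> prob {\<omega> \<in> space M. \<forall>l\<in>{1..k}. attains e (wrt_degree par n (v n l \<omega>) \<omega>) (m l)}
        = (\<Prod>l=1..k. mean_geo e \<mu> (m l)) * (1 + \<delta>))) sequentially"
proof -
  obtain f where f: "near_one f"
    and ev_f: "eventually (\<lambda>n. \<forall>m. (\<forall>l\<in>{1..k}. real (m l) < c * ln (real n)) \<longrightarrow>
      degree_sum e k n m \<le> real n ^ k * (\<Prod>l=1..k. mean_geo e \<mu> (m l)) * f n) sequentially"
    by (rule degree_sum_asymp_upper[OF mean \<mu> sup c, of k e]) blast
  obtain g where g: "near_one g"
    and ev_g: "eventually (\<lambda>n. \<forall>m. (\<forall>l\<in>{1..k}. real (m l) < c * ln (real n)) \<longrightarrow>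
      real n ^ k * (\<Prod>l=1..k. mean_geo e \<mu> (m l)) * g n \<le> degree_sum e k n m) sequentially"
  proof (cases e)
    case True
    show thesis
      by (rule degree_sum_asymp_lower[OF mean \<mu> sup c, of k]) (rule that; simp add: True)
  next
    case False
    show thesis
      by (rule degree_sum_asymp_lower_tail[OF mean \<mu> sup c, of k]) (rule that; simp add: False)
  qed
  obtain g1 where g1: "0 < g1" "\<And>m. g1 * exp (- 1 * real m) / (1 + \<mu>) ^ m \<le> mean_geo True \<mu> m"
    by (rule mean_geo_lower[OF \<mu>(1) sup, of 1]) auto
  have pos: "0 < mean_geo e \<mu> i" for i
  proof -
    have "0 < g1 * exp (- 1 * real i) / (1 + \<mu>) ^ i" using g1 \<mu> by simp
    also have "\<dots> \<le> mean_geo True \<mu> i" by (rule g1(2))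
    also have "\<dots> \<le> mean_geo e \<mu> i" using mean_geo_True_le_False[OF \<mu>(1)] by (cases e) auto
    finally show ?thesis .
  qed
  \<comment> \<open>There are between \<open>(n - k)\<^sup>k\<close> and \<open>n\<^sup>k\<close> choices of the vertices.\<close>
  define q where "q n = (1 - real k / real n) ^ k" for n
  have q: "near_one q" unfolding q_def
    by (intro near_one_power near_one_one_minus poly_small_const_over_n)
  define u where "u n = \<bar>f n / q n - 1\<bar> + \<bar>g n - 1\<bar>" for n
  have abs: "poly_small (\<lambda>n. \<bar>F n\<bar>)" if "poly_small F" for F
    using poly_small_mono[OF that, of "\<lambda>n. \<bar>F n\<bar>" 1] by simp
  have "poly_small u" unfolding u_def
    by (intro poly_small_add abs near_one_divide f q g)
  moreover have "eventually (\<lambda>n. \<forall>m. (\<forall>l\<in>{1..k}. real (m l) < c * ln (real n)) \<longrightarrow>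
      (\<exists>\<delta>. \<bar>\<delta>\<bar> \<le> u n \<and> prob {\<omega> \<in> space M. \<forall>l\<in>{1..k}. attains e (wrt_degree par n (v n l \<omega>) \<omega>) (m l)}
        = (\<Prod>l=1..k. mean_geo e \<mu> (m l)) * (1 + \<delta>))) sequentially"
    using ev_f ev_g near_one_gt_half[OF q] near_one_gt_half[OF f] eventually_ge_at_top[of "k + 1"]
  proof eventually_elim
    case (elim n)
    show ?case
    proof (intro allI impI)
      fix m :: "nat \<Rightarrow> nat" assume m: "\<forall>l\<in>{1..k}. real (m l) < c * ln (real n)"
      let ?T = "\<Prod>l=1..k. mean_geo e \<mu> (m l)"
      define p where "p = prob {\<omega> \<in> space M. \<forall>l\<in>{1..k}. attains e (wrt_degree par n (v n l \<omega>) \<omega>)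
          (m l)}"
      define N where "N = real (card (injections {1..k} {1..n}))"
      have T: "0 < ?T" using pos by (intro prod_pos) auto
      have n: "0 < real n" "k \<le> n" "0 < real n ^ k" using elim by auto
      have Np: "N * p = degree_sum e k n m"
        unfolding N_def p_def degree_sum_def by
            (rule uniform_degree_prob[OF n(2) U[OF n(2)] I[OF n(2)]])
      have p0: "0 \<le> p" by (simp add: p_def)
      have N_le: "N \<le> real n ^ k"
        unfolding N_def using card_injections_le[of "{1..k}" "{1..n}"] by simp
      have N_ge: "real n ^ k * q n \<le> N"
      proof -
        have "real n ^ k * q n = (real n - real k) ^ k"
          unfolding q_def power_mult_distrib[symmetric] using n by (simp add: right_diff_distrib)
        also have "\<dots> \<le> N"
          unfolding N_def using card_injections_ge[of "{1..k}" "{1..n}"] n by simp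
        finally show ?thesis .
      qed
      have "real n ^ k * q n * p \<le> N * p" using N_ge p0 by (intro mult_right_mono)
      also have "\<dots> \<le> real n ^ k * ?T * f n" unfolding Np using elim m by blast
      finally have "real n ^ k * (q n * p) \<le> real n ^ k * (?T * f n)" by (simp only: mult.assoc)
      then have "q n * p \<le> ?T * f n" using n(3) by (rule mult_left_le_imp_le)
      then have up: "p \<le> ?T * (f n / q n)" using elim by (simp add: pos_le_divide_eq mult_ac)
      have "real n ^ k * (?T * g n) \<le> N * p" unfolding Np mult.assoc[symmetric] using elim m
          by blast
      also have "\<dots> \<le> real n ^ k * p" using N_le p0 by (intro mult_right_mono)
      finally have "real n ^ k * (?T * g n) \<le> real n ^ k * p" .
      then have lo: "?T * g n \<le> p" using n(3) by (rule mult_left_le_imp_le)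
      define \<delta> where "\<delta> = p / ?T - 1"
      have pT: "p / ?T \<le> f n / q n" "g n \<le> p / ?T"
        using up lo T by (simp_all only: pos_divide_le_eq pos_le_divide_eq mult.commute)
      have "\<bar>\<delta>\<bar> \<le> u n" using pT unfolding \<delta>_def u_def by linarith
      moreover have "p = ?T * (1 + \<delta>)"
      proof -
        have "x = t * (1 + (x / t - 1))" if "0 < t" for x t :: real using that by simp
        from this[OF T] show ?thesis unfolding \<delta>_def .
      qed
      ultimately show "\<exists>\<delta>. \<bar>\<delta>\<bar> \<le> u n \<and> prob {\<omega>
          \<in> space M. \<forall>l\<in>{1..k}. attains e (wrt_degree par n (v n l \<omega>) \<omega>) (m l)}
        = ?T * (1 + \<delta>)"
        unfolding p_def by blast
    qed
  qed
  ultimately show thesis by (rule that)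
qed

lemma mean_weight:
  "0 < (\<integral>x. W x \<partial>P)" "(\<integral>x. W x \<partial>P) \<le> 1"
proof -
  have b: "0 \<le> (\<integral>x. W x \<partial>P)" "(\<integral>x. W x \<partial>P) \<le> 1"
    using W_integral_const_bounds[of "\<lambda>x. x" 0 1] by auto
  show "(\<integral>x. W x \<partial>P) \<le> 1" by (rule b)
  have int: "integrable P W" using W_integrable[of "\<lambda>x. x" 1] by simp
  have "(\<integral>x. W x \<partial>P) \<noteq> 0"
  proof
    assume "(\<integral>x. W x \<partial>P) = 0"
    moreover have "AE x in P. 0 \<le> W x" using weight_range by eventually_elim simp
    ultimately have "AE x in P. W x = 0" using integral_nonneg_eq_0_iff_AE[OF int] by simp
    then have "AE x in P. False" using weight_range by eventually_elim simp
    then show False by simp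
  qed
  then show "0 < (\<integral>x. W x \<partial>P)" using b by simp
qed

end

theorem proposition5p1:
  fixes P :: "'b measure" and W :: "'b \<Rightarrow> real"
    and M :: "'a measure" and Ws :: "nat \<Rightarrow> 'a \<Rightarrow> real" and par :: "nat \<Rightarrow> 'a \<Rightarrow> nat"
    and v :: "nat \<Rightarrow> nat \<Rightarrow> 'a \<Rightarrow> nat" and k :: nat and \<mu> \<theta> c :: real
  assumes tree: "weighted_recursive_tree P W M Ws par"
    and range: "AE x in P. 0 < W x \<and> W x \<le> 1"
    and sup: "Sup {x::real. \<P>(\<omega> in P. W \<omega> \<le> x) < 1} = 1"
    and lower_tail: "\<exists>C>0. \<exists>\<rho>>0. \<exists>x\<^sub>1. 0 < x\<^sub>1 \<and> x\<^sub>1 < 1 \<and>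
          (\<forall>x\<in>{0..x\<^sub>1}. \<P>(\<omega> in P. W \<omega> \<le> x) \<le> C * x powr \<rho>)"
    and mu: "\<mu> = (\<integral>x. W x \<partial>P)"
    and theta: "\<theta> = 1 + \<mu>"
    and k: "k \<ge> 1"
    and uniform: "\<And>n. n \<ge> k \<Longrightarrow> uniform_without_replacement M k n (v n)"
    and indep: "\<And>n. n \<ge> k \<Longrightarrow>
          prob_space.indep_set M
            (sets (vimage_algebra (space M) (\<lambda>\<omega>. \<lambda>l\<in>{1..k}. v n l \<omega>) (count_space UNIV)))
            (sets (wrt_history M Ws par n))"
    and c: "0 < c" "c < \<theta> / (\<theta> - 1)"
  shows "\<exists>\<beta> \<beta>'. \<beta> \<ge> \<beta>' \<and> \<beta>' > 0 \<and>
    (\<exists>r. r \<in> o(\<lambda>n. real n powr (- \<beta>)) \<and>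
      (\<forall>\<^sub>F n in sequentially. \<forall>m :: nat \<Rightarrow> nat. (\<forall>l\<in>{1..k}. real (m l) < c * ln (real n)) \<longrightarrow>
        (\<exists>\<delta>. \<bar>\<delta>\<bar> \<le> r n \<and>
          \<P>(\<omega> in M. \<forall>l\<in>{1..k}. wrt_degree par n (v n l \<omega>) \<omega> = m l)
            = (\<Prod>l=1..k. \<integral>x. \<mu> / (\<mu> + W x) * (W x / (\<mu> + W x)) ^ m l \<partial>P) * (1 + \<delta>)))) \<and>
    (\<exists>r. r \<in> o(\<lambda>n. real n powr (- \<beta>')) \<and>
      (\<forall>\<^sub>F n in sequentially. \<forall>m :: nat \<Rightarrow> nat. (\<forall>l\<in>{1..k}. real (m l) < c * ln (real n)) \<longrightarrow>
        (\<exists>\<delta>. \<bar>\<delta>\<bar> \<le> r n \<and>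
          \<P>(\<omega> in M. \<forall>l\<in>{1..k}. wrt_degree par n (v n l \<omega>) \<omega> \<ge> m l)
            = (\<Prod>l=1..k. \<integral>x. (W x / (\<mu> + W x)) ^ m l \<partial>P) * (1 + \<delta>))))"
proof -
  interpret weighted_recursive_tree P W M Ws par by (rule tree)
  interpret bounded_wrt P W M Ws par by unfold_locales (rule range)
  have \<mu>: "0 < \<mu>" "\<mu> \<le> 1" using mean_weight by (simp_all add: mu)
  have c': "c < (1 + \<mu>) / \<mu>" using c(2) by (simp add: theta)
  obtain u where u: "poly_small u"
    and ev_u: "eventually (\<lambda>n. \<forall>m. (\<forall>l\<in>{1..k}. real (m l) < c * ln (real n)) \<longrightarrow>
      (\<exists>\<delta>. \<bar>\<delta>\<bar> \<le> u n \<and> prob {\<omega> \<in> space M. \<forall>l\<in>{1..k}. attains True (wrt_degree par n (v n l \<omega>) \<omega>)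
          (m l)}
        = (\<Prod>l=1..k. mean_geo True \<mu> (m l)) * (1 + \<delta>))) sequentially"
    by (rule degree_prob_asymp[OF mu \<mu> sup c(1) c' uniform indep, of True]) blast+
  obtain w where w: "poly_small w"
    and ev_w: "eventually (\<lambda>n. \<forall>m. (\<forall>l\<in>{1..k}. real (m l) < c * ln (real n)) \<longrightarrow>
      (\<exists>\<delta>. \<bar>\<delta>\<bar> \<le> w n \<and> prob {\<omega> \<in> space M. \<forall>l\<in>{1..k}. attains False (wrt_degree par n (v n l \<omega>) \<omega>)
          (m l)}
        = (\<Prod>l=1..k. mean_geo False \<mu> (m l)) * (1 + \<delta>))) sequentially"
    by (rule degree_prob_asymp[OF mu \<mu> sup c(1) c' uniform indep, of False]) blast+
  obtain \<beta> r where \<beta>: "0 < \<beta>" and r: "r \<in> o(\<lambda>n. real n powr - \<beta>)"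
    and ev_r: "eventually (\<lambda>n. \<bar>\<bar>u n\<bar> + \<bar>w n\<bar>\<bar> \<le> r n) sequentially"
  proof -
    have abs: "poly_small (\<lambda>n. \<bar>F n\<bar>)" if "poly_small F" for F
      using poly_small_mono[OF that, of "\<lambda>n. \<bar>F n\<bar>" 1] by simp
    have "poly_small (\<lambda>n. \<bar>u n\<bar> + \<bar>w n\<bar>)" by (intro poly_small_add abs u w)
    then show thesis by (rule poly_small_small_o) (rule that)
  qed
  have first: "\<forall>\<^sub>F n in sequentially. \<forall>m :: nat \<Rightarrow> nat. (\<forall>l\<in>{1..k}. real (m l) < c * ln (real n)) \<longrightarrow>
        (\<exists>\<delta>. \<bar>\<delta>\<bar> \<le> r n \<and>
          \<P>(\<omega> in M. \<forall>l\<in>{1..k}. wrt_degree par n (v n l \<omega>) \<omega> = m l)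
            = (\<Prod>l=1..k. \<integral>x. \<mu> / (\<mu> + W x) * (W x / (\<mu> + W x)) ^ m l \<partial>P) * (1 + \<delta>))"
    using ev_u ev_r
  proof eventually_elim
    case (elim n)
    have "u n \<le> r n" using elim(2) by linarith
    with elim(1) show ?case unfolding attains_def geo_def by (simp, meson order_trans)
  qed
  have second: "\<forall>\<^sub>F n in sequentially. \<forall>m :: nat \<Rightarrow> nat. (\<forall>l\<in>{1..k}. real (m l) < c * ln (real n)) \<longrightarrow>
        (\<exists>\<delta>. \<bar>\<delta>\<bar> \<le> r n \<and>
          \<P>(\<omega> in M. \<forall>l\<in>{1..k}. wrt_degree par n (v n l \<omega>) \<omega> \<ge> m l)
            = (\<Prod>l=1..k. \<integral>x. (W x / (\<mu> + W x)) ^ m l \<partial>P) * (1 + \<delta>))"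
    using ev_w ev_r
  proof eventually_elim
    case (elim n)
    have "w n \<le> r n" using elim(2) by linarith
    with elim(1) show ?case unfolding attains_def geo_def by (simp, meson order_trans)
  qed
  show ?thesis using \<beta> r first second by blast
qed

end
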